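(* Let $n\ge 3$ and $k\le \binom n2$. Then $$\overline{\min}\, S_k(K_n)=\begin{cases}\Theta(1) & \text{when } k\le n,\\[2pt] \Theta\left(\left(\frac kn\right)^2\log\left(\frac kn\right)\right) & \text{when } n<k\le n^{3/2},\\[2pt] \Theta\left(\left(\frac kn\right)^2\log\left(\frac{n^2}{k}\right)\right) & \text{when } n^{3/2}<k.\end{cases}$$
   Context: Here $n$ and $k$ are non-negative integers and $K_n$ is the complete graph on $n$ vertices. All graphs are simple and finite. A rectilinear drawing $\mathcal D$ of a graph represents the vertices by distinct points in the plane in general position and every edge by the line segment joining its endpoints, with no three edges sharing an interior point. A crossing of $\mathcal D$ is a common interior point of two distinct edges. For an integer $k\ge 0$, $S_k(\mathcal D)$ is the number of edges of $\mathcal D$ that are involved in at most $k$ crossings. $\overline{\min}\, S_k(G)$ is the minimum of $S_k(\mathcal D)$ over all rectilinear drawings $\mathcal D$ of $G$. The notation $f=\Theta(g)$ means that there are absolute positive constants $c,C$ with $c\,g\le f\le C\,g$ for all values of the variables $n,k$ in the stated range.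
   Formalization: In the range n<k≤n^{3/2}, log(k/n) is read as max(1, ln(k/n)); with the literal logarithm the upper bound fails at k=n+1, n→∞, where (k/n)^2 log(k/n)→0 while hull edges are always uncrossed. For k≥(1+ε)n, any fixed ε>0, both forms agree up to constants. *)

theory Defs
  imports "HOL-Analysis.Analysis"
begin

text \<open>
  A simple graph is given by a vertex set \<open>V\<close> and a set \<open>E\<close> of two-element subsets of \<open>V\<close>.
  A straight-line drawing is given by the positions \<open>p\<close> of the vertices alone.
\<close>

definition simple_graph :: "'a set \<Rightarrow> 'a set set \<Rightarrow> bool" where
  "simple_graph V E \<longleftrightarrow> finite V \<and> (\<forall>e\<in>E. e \<subseteq> V \<and> card e = 2)"

definition K_verts :: "nat \<Rightarrow> nat set" where
  "K_verts n = {..<n}"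

definition K_edges :: "nat \<Rightarrow> nat set set" where
  "K_edges n = {e. e \<subseteq> K_verts n \<and> card e = 2}"

lemma simple_graph_K: "simple_graph (K_verts n) (K_edges n)"
  by (auto simp: simple_graph_def K_verts_def K_edges_def)

definition edge_interior :: "('a \<Rightarrow> real^2) \<Rightarrow> 'a set \<Rightarrow> (real^2) set" where
  "edge_interior p e = convex hull (p ` e) - p ` e"

lemma edge_interior_eq_open_segment: "edge_interior p {u, v} = open_segment (p u) (p v)"
  by (simp add: edge_interior_def open_segment_def segment_convex_hull)

definition general_position :: "(real^2) set \<Rightarrow> bool" where
  "general_position P \<longleftrightarrow> (\<forall>T\<subseteq>P. card T = 3 \<longrightarrow> \<not> collinear T)"

definition rectilinear_drawing :: "'a set \<Rightarrow> 'a set set \<Rightarrow> ('a \<Rightarrow> real^2) \<Rightarrow> bool" where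
  "rectilinear_drawing V E p \<longleftrightarrow>
     inj_on p V \<and> general_position (p ` V) \<and>
     (\<forall>e\<in>E. \<forall>f\<in>E. \<forall>g\<in>E. e \<noteq> f \<and> f \<noteq> g \<and> e \<noteq> g \<longrightarrow>
        edge_interior p e \<inter> edge_interior p f \<inter> edge_interior p g = {})"

definition crossings :: "'a set set \<Rightarrow> ('a \<Rightarrow> real^2) \<Rightarrow> (real^2) set" where
  "crossings E p = {x. \<exists>e\<in>E. \<exists>f\<in>E. e \<noteq> f \<and> x \<in> edge_interior p e \<inter> edge_interior p f}"

text \<open>
  In a rectilinear drawing of a simple graph two distinct edges never overlap in a segment,
  so the set of crossings is finite and \<open>card\<close> below is the true count. As no three edges
  share an interior point, the crossings involving \<open>e\<close> are exactly those in its interior.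
\<close>

definition S :: "nat \<Rightarrow> 'a set set \<Rightarrow> ('a \<Rightarrow> real^2) \<Rightarrow> nat" where
  "S k E p = card {e\<in>E. card (crossings E p \<inter> edge_interior p e) \<le> k}"

text \<open>The infimum of a nonempty set of natural numbers is attained, hence a minimum.\<close>

definition min_S :: "nat \<Rightarrow> 'a set \<Rightarrow> 'a set set \<Rightarrow> nat" where
  "min_S k V E = Inf {S k E p | p. rectilinear_drawing V E p}"

definition Theta_on ::
  "(nat \<times> nat) set \<Rightarrow> (nat \<Rightarrow> nat \<Rightarrow> real) \<Rightarrow> (nat \<Rightarrow> nat \<Rightarrow> real) \<Rightarrow> bool" where
  "Theta_on R f g \<longleftrightarrow>
     (\<exists>c>0. \<exists>C>0. \<forall>(n, k)\<in>R. c * g n k \<le> f n k \<and> f n k \<le> C * g n k)"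

text \<open>
  The usual convention that, in an asymptotic formula, a logarithm means at least 1. It is
  needed when \<open>x\<close> may be arbitrarily close to 1: \<open>ln x\<close> would then be arbitrarily close to 0,
  whereas every drawing with \<open>n \<ge> 3\<close> has at least three uncrossed edges (those of the convex
  hull). For \<open>x \<ge> x0 > 1\<close> it differs from \<open>ln x\<close> by at most a constant factor.
\<close>

definition log1 :: "real \<Rightarrow> real" where
  "log1 x = max 1 (ln x)"

end

theory Submission
  imports Defs
begin

text \<open>
  Write \<open>x = k / n\<close>.

  Lower bound. Order the vertices by a generic linear function. An edge between two of the top \<open>m\<close>
  vertices is crossed only by the at most \<open>m n\<close> edges that have an end among them; for \<open>m = x\<close> this
  gives about \<open>x\<^sup>2\<close> edges. For \<open>x \<le> m \<le> min(c x\<^sup>2, n / 2)\<close> a packing argument in the arrangement of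
  these \<open>m n\<close> lines yields about \<open>x\<^sup>2\<close> pairs of vertices with ranks between \<open>m\<close> and \<open>2 m\<close> that are
  separated by at most \<open>k\<close> lines. Dyadic values of \<open>m\<close> give disjoint sets of edges and hence the
  logarithm of \<open>min(x, n / x)\<close>.

  Upper bound. Put \<open>n / 6\<close> points into a tiny sector at each corner of a regular hexagon, arranged as
  a lattice in the cone spanned by the directions to the second and the fourth next corners. Seen from one arm, the
  edges to another arm are almost parallel, so an edge inside an arm is crossed by
  \<open>n / 6\<close> edges for every lattice point that lies behind it in such a direction. At each point of the
  cone two of the available directions look back deep into the cone; thus an edge of length \<open>d\<close> at
  distance \<open>r\<close> from the corner has at least about \<open>n r d\<close> crossings, and there are about
  \<open>\<Sum>r r (x / r)\<^sup>2\<close> edges with at most \<open>k\<close> crossings.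
\<close>

section \<open>Orientation and crossings\<close>

text \<open>Up to constants, both bounds see the same scales. In the packing, each of the m points
  of an annulus is close to k^2 ordered pairs of crossing lines, out of (m n)^2 pairs in all.
  Cauchy-Schwarz yields m^2 k^2 / (m n)^2 = x^2 close pairs of points, whatever m is, so all dyadic
  m contribute alike. The condition m \<le> c x^2 makes this beat the m pairs of a point with
  itself; x \<le> m provides enough lines to walk through. In an arm, norms r > x admit no lightly
  crossed pair because distinct lattice points have distance at least 1, norms r < sqrt x hold too
  few points to matter, and r is at most about sqrt n. The range from sqrt x to min(x, sqrt n) has
  logarithmic length ln(min(x, n / x)) / 2. An obstacle is that the crossings must be certified in a
  drawing in general position, which the limiting hexagon is not. Orientations are computed as
  limits for shrinking arms, and only strict signs of leading terms are used, so a generic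
  perturbation of smaller order keeps every counted crossing.\<close>

definition cross2 :: "real^2 \<Rightarrow> real^2 \<Rightarrow> real" where
  "cross2 v w = v$1 * w$2 - v$2 * w$1"

definition orient :: "real^2 \<Rightarrow> real^2 \<Rightarrow> real^2 \<Rightarrow> real" where
  "orient a b c = cross2 (b - a) (c - a)"

lemma vec2_eq_iff: "(v::real^2) = w \<longleftrightarrow> v$1 = w$1 \<and> v$2 = w$2"
  by (simp add: vec_eq_iff forall_2)

lemma orient_coord: "orient a b c = (b$1 - a$1) * (c$2 - a$2) - (b$2 - a$2) * (c$1 - a$1)"
  by (simp add: orient_def cross2_def)

lemma orient_affine:
  "orient a b ((1 - t) *\<^sub>R z + t *\<^sub>R w) = (1 - t) * orient a b z + t * orient a b w"
  by (simp add: orient_coord algebra_simps)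

lemma orient_add_scale: "orient a b (z + t *\<^sub>R w) = orient a b z + t * cross2 (b - a) w"
  by (simp add: orient_coord cross2_def algebra_simps)

lemma collinear_iff_orient: "collinear {a, b, c} \<longleftrightarrow> orient a b c = 0"
proof (cases "a = c")
  case True
  then show ?thesis by (simp add: collinear_3_expand orient_coord)
next
  case ne: False
  show ?thesis
  proof
    assume "collinear {a, b, c}"
    then obtain u where "b = u *\<^sub>R a + (1 - u) *\<^sub>R c"
      using ne by (auto simp: collinear_3_expand)
    then have b: "b$1 = u * a$1 + (1 - u) * c$1" "b$2 = u * a$2 + (1 - u) * c$2"
      by simp_all
    show "orient a b c = 0"
      unfolding orient_coord b by algebra
  next
    assume o: "orient a b c = 0"
    have e: "(b$1 - a$1) * (c$2 - a$2) = (b$2 - a$2) * (c$1 - a$1)"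
      using o by (simp add: orient_coord)
    have "\<exists>u. b = u *\<^sub>R a + (1 - u) *\<^sub>R c"
    proof (cases "a$1 = c$1")
      case True
      then have n2: "a$2 - c$2 \<noteq> 0" using ne by (auto simp: vec2_eq_iff)
      then have b1: "b$1 = a$1" using e True by auto
      define u where "u = (b$2 - c$2) / (a$2 - c$2)"
      have "u * (a$2 - c$2) = b$2 - c$2" using n2 by (simp add: u_def)
      then show ?thesis
        using True b1 by (intro exI[where x=u]) (simp add: vec2_eq_iff algebra_simps)
    next
      case False
      then have n1: "a$1 - c$1 \<noteq> 0" by simp
      define u where "u = (b$1 - c$1) / (a$1 - c$1)"
      have u: "u * (a$1 - c$1) = b$1 - c$1" using n1 by (simp add: u_def)
      have "(u * (a$2 - c$2) - (b$2 - c$2)) * (a$1 - c$1) = (b$1 - c$1) * (a$2 - c$2) - (b$2 - c$2) * (a$1 - c$1)"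
        using u by algebra
      also have "\<dots> = 0" using e by (simp add: algebra_simps)
      finally have "u * (a$2 - c$2) = b$2 - c$2" using n1 by simp
      with u show ?thesis
        by (intro exI[where x=u]) (simp add: vec2_eq_iff algebra_simps)
    qed
    then show "collinear {a, b, c}" by (simp add: collinear_3_expand)
  qed
qed

text \<open>Both \<open>b\<close> and \<open>c\<close> lie on the one line through the distinct
  points \<open>a\<close> and \<open>z\<close>.\<close>

lemma orient_common_line:
  assumes "orient a b z = 0" "orient a c z = 0" "z \<noteq> a"
  shows "orient a b c = 0"
proof -
  have "cross2 (z - a) (z - a) = 0" by (simp add: cross2_def)
  have 1: "(b$1 - a$1) * (z$2 - a$2) = (b$2 - a$2) * (z$1 - a$1)"
    and 2: "(c$1 - a$1) * (z$2 - a$2) = (c$2 - a$2) * (z$1 - a$1)"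
    using assms by (simp_all add: orient_coord)
  have "orient a b c * (z$1 - a$1) = 0"
    using 1 2 unfolding orient_coord by algebra
  moreover have "orient a b c * (z$2 - a$2) = 0"
    using 1 2 unfolding orient_coord by algebra
  ultimately show ?thesis using assms(3) by (auto simp: vec2_eq_iff)
qed

lemma in_open_segmentI:
  fixes a b :: "'a::real_vector"
  assumes "a \<noteq> b" "0 < u" "u < 1"
  shows "(1 - u) *\<^sub>R a + u *\<^sub>R b \<in> open_segment a b"
  unfolding in_segment(2) using assms by (intro conjI exI[of _ u]) auto

lemma proper_crossing:
  assumes "orient a b c * orient a b d < 0" "orient c d a * orient c d b < 0"
  shows "open_segment a b \<inter> open_segment c d \<noteq> {}"
proof -
  define A where "A = orient c d a"
  define B where "B = orient c d b"
  define C where "C = orient a b c"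
  define D where "D = orient a b d"
  \<comment> \<open>Both differences are, up to sign, the determinant of the directions
    \<open>b - a\<close> and \<open>d - c\<close>. So \<open>t\<close> and \<open>s\<close> are
    Cramer's solution with a common denominator, and the sign assumptions put them strictly between
    0 and 1.\<close>
  have rel: "A - B = - (C - D)"
    unfolding A_def B_def C_def D_def orient_coord by algebra
  have AB: "A * B < 0" and CD: "C * D < 0" using assms by (auto simp: A_def B_def C_def D_def)
  define t where "t = A / (A - B)"
  define s where "s = C / (C - D)"
  have ABn: "A - B \<noteq> 0" using AB by (auto simp: mult_less_0_iff)
  have CDn: "C - D \<noteq> 0" using CD by (auto simp: mult_less_0_iff)
  have t: "0 < t" "t < 1"
    using AB by (auto simp: t_def mult_less_0_iff field_simps)
  have s: "0 < s" "s < 1"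
    using CD by (auto simp: s_def mult_less_0_iff field_simps)
  have tt: "t * (A - B) = A" and ss: "s * (C - D) = C" using ABn CDn by (auto simp: t_def s_def)
  have ss': "s * (A - B) = - C" by (simp only: rel mult_minus_right ss)
  have "((1 - t) * a$i + t * b$i - ((1 - s) * c$i + s * d$i)) * (A - B) = 0" if "i = 1 \<or> i = 2" for i
  proof -
    have "((1 - t) * a$i + t * b$i - ((1 - s) * c$i + s * d$i)) * (A - B)
        = a$i * (A - B) + (t * (A - B)) * (b$i - a$i) - c$i * (A - B) - (s * (A - B)) * (d$i - c$i)"
      by (simp add: algebra_simps)
    also have "\<dots> = a$i * (A - B) + A * (b$i - a$i) - c$i * (A - B) + C * (d$i - c$i)"
      unfolding tt ss' by simp
    also have "\<dots> = 0"
      using that unfolding A_def B_def C_def D_def orient_coord by (elim disjE; hypsubst; simp add: algebra_simps)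
    finally show ?thesis .
  qed
  then have "(1 - t) * a$i + t * b$i = (1 - s) * c$i + s * d$i" if "i = 1 \<or> i = 2" for i
    using ABn that by simp
  then have eq: "(1 - t) *\<^sub>R a + t *\<^sub>R b = (1 - s) *\<^sub>R c + s *\<^sub>R d"
    by (simp add: vec2_eq_iff)
  have "a \<noteq> b" "c \<noteq> d" using ABn CDn by (auto simp: A_def B_def C_def D_def)
  then have "(1 - t) *\<^sub>R a + t *\<^sub>R b \<in> open_segment a b" "(1 - s) *\<^sub>R c + s *\<^sub>R d \<in> open_segment c d"
    using s t by (simp_all add: in_open_segmentI)
  then show ?thesis using eq by auto
qed

lemma card2_obtain:
  assumes "card e = 2"
  obtains a b where "e = {a, b}" "a \<noteq> b"
  using assms by (auto simp: card_2_iff)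

lemma K_edgesE:
  assumes "e \<in> K_edges n"
  obtains a b where "e = {a, b}" "a \<noteq> b" "a < n" "b < n"
  using assms by (auto simp: K_edges_def K_verts_def card_2_iff)

lemma K_edgesI: "a \<noteq> b \<Longrightarrow> a < n \<Longrightarrow> b < n \<Longrightarrow> {a, b} \<in> K_edges n"
  by (auto simp: K_edges_def K_verts_def)

lemma finite_K_edges: "finite (K_edges n)"
  by (auto simp: K_edges_def K_verts_def)

definition crossing_edges :: "nat \<Rightarrow> (nat \<Rightarrow> real^2) \<Rightarrow> nat set \<Rightarrow> nat set set" where
  "crossing_edges n p e = {f\<in>K_edges n. f \<noteq> e \<and> edge_interior p e \<inter> edge_interior p f \<noteq> {}}"

lemma finite_crossing_edges: "finite (crossing_edges n p e)"
  by (auto simp: crossing_edges_def finite_K_edges)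

locale drawing =
  fixes n :: nat and p :: "nat \<Rightarrow> real^2"
  assumes draw: "rectilinear_drawing (K_verts n) (K_edges n) p"
begin

lemma p_inj: "i < n \<Longrightarrow> j < n \<Longrightarrow> p i = p j \<Longrightarrow> i = j"
  using draw by (auto simp: rectilinear_drawing_def inj_on_def K_verts_def)

lemma orient_nz:
  assumes "i < n" "j < n" "l < n" "i \<noteq> j" "j \<noteq> l" "i \<noteq> l"
  shows "orient (p i) (p j) (p l) \<noteq> 0"
proof -
  have "p i \<noteq> p j" "p j \<noteq> p l" "p i \<noteq> p l" using assms p_inj by blast+
  then have "card {p i, p j, p l} = 3" by simp
  moreover have "{p i, p j, p l} \<subseteq> p ` K_verts n" using assms by (auto simp: K_verts_def)
  ultimately have "\<not> collinear {p i, p j, p l}"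
    using draw unfolding rectilinear_drawing_def general_position_def by blast
  then show ?thesis by (simp add: collinear_iff_orient)
qed

lemma no_triple:
  assumes "e \<in> K_edges n" "f \<in> K_edges n" "g \<in> K_edges n" "e \<noteq> f" "f \<noteq> g" "e \<noteq> g"
  shows "edge_interior p e \<inter> edge_interior p f \<inter> edge_interior p g = {}"
  using draw assms unfolding rectilinear_drawing_def by metis

lemma crossing_point_unique:
  assumes "e \<in> K_edges n" "f \<in> K_edges n" "e \<noteq> f"
    and "z \<in> edge_interior p e" "z \<in> edge_interior p f"
    and "w \<in> edge_interior p e" "w \<in> edge_interior p f"
  shows "z = w"
proof (rule ccontr)
  assume zw: "z \<noteq> w"
  obtain a b where e: "e = {a, b}" "a \<noteq> b" "a < n" "b < n" using assms(1) by (rule K_edgesE)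
  obtain c d where f: "f = {c, d}" "c \<noteq> d" "c < n" "d < n" "d \<noteq> a" "d \<noteq> b"
  proof -
    obtain c d where f: "f = {c, d}" "c \<noteq> d" "c < n" "d < n" using assms(2) by (rule K_edgesE)
    show ?thesis
    proof (cases "d = a \<or> d = b")
      case True
      then have "c \<noteq> a" "c \<noteq> b" using f e assms(3) by auto
      then show ?thesis using that[of d c] f by auto
    next
      case False
      then show ?thesis using that[of c d] f by auto
    qed
  qed
  obtain t where t: "z = (1 - t) *\<^sub>R p a + t *\<^sub>R p b"
    using assms(4) unfolding e edge_interior_eq_open_segment by (auto simp: in_segment)
  obtain s where s: "w = (1 - s) *\<^sub>R p a + s *\<^sub>R p b"
    using assms(6) unfolding e edge_interior_eq_open_segment by (auto simp: in_segment)
  obtain t' where t': "z = (1 - t') *\<^sub>R p c + t' *\<^sub>R p d"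
    using assms(5) unfolding f edge_interior_eq_open_segment by (auto simp: in_segment)
  obtain s' where s': "w = (1 - s') *\<^sub>R p c + s' *\<^sub>R p d"
    using assms(7) unfolding f edge_interior_eq_open_segment by (auto simp: in_segment)
  have "s' \<noteq> t'" using zw t' s' by auto
  let ?o = "orient (p a) (p b)"
  have ab: "?o (p a) = 0" "?o (p b) = 0" by (auto simp: orient_coord)
  have 1: "(1 - t') * ?o (p c) + t' * ?o (p d) = 0"
    unfolding orient_affine[symmetric] t'[symmetric] unfolding t orient_affine ab by simp
  have 2: "(1 - s') * ?o (p c) + s' * ?o (p d) = 0"
    unfolding orient_affine[symmetric] s'[symmetric] unfolding s orient_affine ab by simp
  have "(t' - s') * ?o (p d) = (1 - s') * ((1 - t') * ?o (p c) + t' * ?o (p d)) - (1 - t') * ((1 - s') * ?o (p c) + s' * ?o (p d))"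
    by (simp add: algebra_simps)
  then have "(t' - s') * ?o (p d) = 0" unfolding 1 2 by simp
  then have "?o (p d) = 0" using \<open>s' \<noteq> t'\<close> by simp
  then show False using orient_nz[of a b d] e f by auto
qed

text \<open>Sending a crossing edge to its intersection with \<open>e\<close> is a bijection onto
  the crossings on \<open>e\<close>: injective since no three edges share an interior point,
  surjective since two edges share at most one.\<close>

lemma card_crossings:
  assumes e: "e \<in> K_edges n"
  shows "card (crossings (K_edges n) p \<inter> edge_interior p e) = card (crossing_edges n p e)"
proof -
  define g where "g f = (SOME z. z \<in> edge_interior p e \<inter> edge_interior p f)" for f
  have g: "g f \<in> edge_interior p e \<inter> edge_interior p f" if "f \<in> crossing_edges n p e" for f
  proof -
    have "\<exists>z. z \<in> edge_interior p e \<inter> edge_interior p f"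
      using that by (auto simp: crossing_edges_def)
    then show ?thesis unfolding g_def by (rule someI_ex)
  qed
  have "bij_betw g (crossing_edges n p e) (crossings (K_edges n) p \<inter> edge_interior p e)"
    unfolding bij_betw_def
  proof
    show "inj_on g (crossing_edges n p e)"
    proof (rule inj_onI, rule ccontr)
      fix f h assume fh: "f \<in> crossing_edges n p e" "h \<in> crossing_edges n p e" "g f = g h" "f \<noteq> h"
      have "g f \<in> edge_interior p e \<inter> edge_interior p f \<inter> edge_interior p h"
        using g[OF fh(1)] g[OF fh(2)] fh(3) by auto
      moreover have "edge_interior p e \<inter> edge_interior p f \<inter> edge_interior p h = {}"
        using no_triple[OF e, of f h] fh by (auto simp: crossing_edges_def)
      ultimately show False by auto
    qed
    show "g ` crossing_edges n p e = crossings (K_edges n) p \<inter> edge_interior p e"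
    proof
      show "g ` crossing_edges n p e \<subseteq> crossings (K_edges n) p \<inter> edge_interior p e"
      proof
        fix z assume "z \<in> g ` crossing_edges n p e"
        then obtain f where f: "f \<in> crossing_edges n p e" "z = g f" by auto
        have "f \<in> K_edges n" "f \<noteq> e" using f by (auto simp: crossing_edges_def)
        then show "z \<in> crossings (K_edges n) p \<inter> edge_interior p e"
          using g[OF f(1)] e f(2) unfolding crossings_def by auto
      qed
      show "crossings (K_edges n) p \<inter> edge_interior p e \<subseteq> g ` crossing_edges n p e"
      proof
        fix z assume "z \<in> crossings (K_edges n) p \<inter> edge_interior p e"
        then obtain f where f: "f \<in> K_edges n" "f \<noteq> e" "z \<in> edge_interior p f" "z \<in> edge_interior p e"
          unfolding crossings_def by auto
        then have fX: "f \<in> crossing_edges n p e" by (auto simp: crossing_edges_def)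
        have "z = g f"
          using crossing_point_unique[OF e f(1)] f g[OF fX] by auto
        then show "z \<in> g ` crossing_edges n p e" using fX by auto
      qed
    qed
  qed
  then show ?thesis by (metis bij_betw_same_card)
qed

lemma S_eq: "S k (K_edges n) p = card {e\<in>K_edges n. card (crossing_edges n p e) \<le> k}"
  unfolding S_def using card_crossings by (intro arg_cong[where f=card]) auto

end

section \<open>Pairs of points separated by few lines\<close>

text \<open>With ties the \<open>r\<close> smallest keys are not a well-defined set. What survives
  is that fewer than \<open>r\<close> elements lie strictly below each chosen one, and this later
  bounds the lines passed before a chosen line is reached.\<close>

lemma smallest_keys:
  fixes key :: "'a \<Rightarrow> 'b::linorder"
  assumes "finite A" "r \<le> card A"
  shows "\<exists>B\<subseteq>A. card B = r \<and> (\<forall>x\<in>B. card {y\<in>A. key y < key x} < r)"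
  using assms(2)
proof (induction r)
  case 0
  show ?case by (rule exI[where x="{}"]) auto
next
  case (Suc r)
  then obtain B where B: "B \<subseteq> A" "card B = r" "\<forall>x\<in>B. card {y\<in>A. key y < key x} < r" by auto
  have fB: "finite B" using B assms(1) finite_subset by blast
  have ne: "A - B \<noteq> {}"
  proof
    assume "A - B = {}"
    then have "A = B" using B by auto
    then show False using B Suc.prems by auto
  qed
  define x where "x = arg_min_on key (A - B)"
  have x: "x \<in> A - B" unfolding x_def using ne assms(1) by (intro arg_min_if_finite(1)) auto
  have xmin: "\<not> key y < key x" if "y \<in> A - B" for y
    using that ne assms(1) unfolding x_def by (meson arg_min_if_finite(2) finite_Diff)
  have "{y\<in>A. key y < key x} \<subseteq> B" using xmin by blast
  then have "card {y\<in>A. key y < key x} < Suc r" using card_mono[OF fB] B(2) by (simp add: less_Suc_eq_le)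
  moreover have "card {y\<in>A. key y < key z} < Suc r" if "z \<in> B" for z
    using bspec[OF B(3) that] by (rule less_SucI)
  ultimately have "\<forall>z\<in>insert x B. card {y\<in>A. key y < key z} < Suc r" by blast
  moreover have "insert x B \<subseteq> A" "card (insert x B) = Suc r" using B(1,2) x fB by auto
  ultimately show ?case by blast
qed

text \<open>The lines are indexed, so the same line may be listed several times. \<open>t\<close>
  limits the lines through a point, and at least \<open>\<rho>\<close> lines are met when walking
  along a line of the family.\<close>

locale line_family =
  fixes L :: "'l set" and a b :: "'l \<Rightarrow> real^2" and t \<rho> :: nat
  assumes finite_L: "finite L"
    and through_point: "\<And>z. card {l\<in>L. orient (a l) (b l) z = 0} \<le> t"
    and L_nonempty: "L \<noteq> {}"
    and transversal: "\<And>l. l \<in> L \<Longrightarrow> \<rho> \<le> card {l'\<in>L. cross2 (b l' - a l') (b l - a l) \<noteq> 0}"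
begin

definition sep :: "real^2 \<Rightarrow> real^2 \<Rightarrow> nat" where
  "sep z w = card {l\<in>L. orient (a l) (b l) z * orient (a l) (b l) w < 0}"

lemma sep_sym: "sep z w = sep w z"
  by (simp add: sep_def mult.commute)

text \<open>A line that separates \<open>z\<close> from \<open>w\<close> separates \<open>v\<close>
  from one of them unless it passes through \<open>v\<close>; the latter costs the summand
  \<open>t\<close>.\<close>

lemma sep_triangle: "sep z w \<le> sep z v + sep v w + t"
proof -
  let ?o = "\<lambda>l. orient (a l) (b l)"
  have "{l\<in>L. ?o l z * ?o l w < 0} \<subseteq>
      ({l\<in>L. ?o l z * ?o l v < 0} \<union> {l\<in>L. ?o l v * ?o l w < 0}) \<union> {l\<in>L. ?o l v = 0}"
    by (auto simp: mult_less_0_iff)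
  then have "sep z w \<le> card (({l\<in>L. ?o l z * ?o l v < 0} \<union> {l\<in>L. ?o l v * ?o l w < 0}) \<union> {l\<in>L. ?o l v = 0})"
    unfolding sep_def using finite_L by (intro card_mono) auto
  also have "\<dots> \<le> sep z v + sep v w + card {l\<in>L. ?o l v = 0}"
    unfolding sep_def by (intro order.trans[OF card_Un_le] add_mono card_Un_le order.refl)
  finally show ?thesis using through_point[of v] by linarith
qed

text \<open>Walk from \<open>z\<close> in both directions \<open>w\<close> and \<open>- w\<close>
  and take the \<open>\<rho>\<close> lines that are met soonest. A line that strictly separates
  \<open>z\<close> from the point where a chosen line is met has itself been met strictly sooner,
  and there are fewer than \<open>\<rho>\<close> of these.\<close>

lemma nearby_lines:
  assumes "\<rho> \<le> card {l\<in>L. cross2 (b l - a l) w \<noteq> 0}"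
  shows "\<exists>B\<subseteq>L. card B = \<rho> \<and> (\<forall>l\<in>B. cross2 (b l - a l) w \<noteq> 0 \<and>
           (\<exists>s. orient (a l) (b l) (z + s *\<^sub>R w) = 0 \<and> sep z (z + s *\<^sub>R w) \<le> \<rho>))"
proof -
  define A where "A = {l\<in>L. cross2 (b l - a l) w \<noteq> 0}"
  define s where "s l = - orient (a l) (b l) z / cross2 (b l - a l) w" for l
  have "finite A" using finite_L by (simp add: A_def)
  then obtain B where B: "B \<subseteq> A" "card B = \<rho>" "\<forall>l\<in>B. card {l'\<in>A. \<bar>s l'\<bar> < \<bar>s l\<bar>} < \<rho>"
    using smallest_keys[of A \<rho> "\<lambda>l. \<bar>s l\<bar>"] assms by (auto simp: A_def)
  have o: "orient (a l) (b l) (z + x *\<^sub>R w) = cross2 (b l - a l) w * (x - s l)" if "l \<in> A" for l x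
    using that by (simp add: orient_add_scale s_def A_def field_simps)
  have "sep z (z + s l *\<^sub>R w) \<le> \<rho>" if l: "l \<in> B" for l
  proof -
    have "l' \<in> {l'\<in>A. \<bar>s l'\<bar> < \<bar>s l\<bar>}"
      if "l' \<in> L" and neg: "orient (a l') (b l') z * orient (a l') (b l') (z + s l *\<^sub>R w) < 0" for l'
    proof -
      have "l' \<in> A"
      proof (rule ccontr)
        assume "l' \<notin> A"
        then have "orient (a l') (b l') (z + s l *\<^sub>R w) = orient (a l') (b l') z"
          using that(1) by (simp add: A_def orient_add_scale)
        then show False using neg by (simp add: mult_less_0_iff)
      qed
      let ?c = "cross2 (b l' - a l') w"
      have "(?c * (0 - s l')) * (?c * (s l - s l')) < 0"
        using neg o[OF \<open>l' \<in> A\<close>, of 0] o[OF \<open>l' \<in> A\<close>, of "s l"] by simp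
      then have "?c\<^sup>2 * (s l' * (s l' - s l)) < 0"
        by (simp add: algebra_simps power2_eq_square)
      then have "s l' * (s l' - s l) < 0"
        by (simp add: mult_less_0_iff not_less)
      then have "\<bar>s l'\<bar> < \<bar>s l\<bar>"
        by (auto simp: mult_less_0_iff)
      then show ?thesis using \<open>l' \<in> A\<close> by simp
    qed
    then have "sep z (z + s l *\<^sub>R w) \<le> card {l'\<in>A. \<bar>s l'\<bar> < \<bar>s l\<bar>}"
      unfolding sep_def using \<open>finite A\<close> by (intro card_mono) auto
    then show ?thesis using B(3) l by fastforce
  qed
  moreover have "orient (a l) (b l) (z + s l *\<^sub>R w) = 0" if "l \<in> B" for l
    using o[of l "s l"] that B(1) by auto
  ultimately have "\<forall>l\<in>B. \<exists>s. orient (a l) (b l) (z + s *\<^sub>R w) = 0 \<and> sep z (z + s *\<^sub>R w) \<le> \<rho>"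
    by (intro ballI exI conjI)
  moreover have "B \<subseteq> L" "\<forall>l\<in>B. cross2 (b l - a l) w \<noteq> 0" using B(1) by (auto simp: A_def)
  ultimately have "\<forall>l\<in>B. cross2 (b l - a l) w \<noteq> 0 \<and> (\<exists>s. orient (a l) (b l) (z + s *\<^sub>R w) = 0 \<and> sep z (z + s *\<^sub>R w) \<le> \<rho>)"
      and "B \<subseteq> L"
    by (metis, metis)
  then show ?thesis by (intro exI[of _ B] conjI B(2))
qed

text \<open>A pair of non-parallel lines stands for the vertex of the arrangement in which they
  meet. The bound is the cost of two walks of cost \<open>\<rho>\<close> each, joined by
  \<open>sep_triangle\<close>.\<close>

definition vertex_near :: "real^2 \<Rightarrow> 'l \<times> 'l \<Rightarrow> bool" where
  "vertex_near z x \<longleftrightarrow> (case x of (l, l') \<Rightarrow> cross2 (b l' - a l') (b l - a l) \<noteq> 0 \<and>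
     (\<exists>u. orient (a l) (b l) u = 0 \<and> orient (a l') (b l') u = 0 \<and> sep z u \<le> 2 * \<rho> + t))"

text \<open>Two walks: one from \<open>z\<close> that reaches \<open>\<rho>\<close> lines, and from
  each point reached another one along the line just found. The second walk never leaves its line,
  so each of its \<open>\<rho>\<close> hits lies on both lines. Ordered pairs (first line, second
  line) keep all these hits distinct.\<close>

lemma nearby_vertices: "\<exists>X. X \<subseteq> L \<times> L \<and> card X = \<rho>\<^sup>2 \<and> (\<forall>x\<in>X. vertex_near z x)"
proof -
  define hits where "hits v w l \<longleftrightarrow> cross2 (b l - a l) w \<noteq> 0 \<and>
      (\<exists>s. orient (a l) (b l) (v + s *\<^sub>R w) = 0 \<and> sep v (v + s *\<^sub>R w) \<le> \<rho>)" for v w l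
  have hits: "\<exists>B\<subseteq>L. card B = \<rho> \<and> (\<forall>l'\<in>B. hits v (b l - a l) l')" if "l \<in> L" for l v
    unfolding hits_def using that by (intro nearby_lines transversal)
  obtain l0 where "l0 \<in> L" using L_nonempty by auto
  then obtain B where B: "B \<subseteq> L" "card B = \<rho>" "\<forall>l\<in>B. hits z (b l0 - a l0) l"
    using hits by metis
  have "\<forall>l\<in>B. \<exists>v. orient (a l) (b l) v = 0 \<and> sep z v \<le> \<rho>"
    using B(3) unfolding hits_def by blast
  then obtain v where v: "\<And>l. l \<in> B \<Longrightarrow> orient (a l) (b l) (v l) = 0"
      "\<And>l. l \<in> B \<Longrightarrow> sep z (v l) \<le> \<rho>" by metis
  have "\<forall>l\<in>B. \<exists>C\<subseteq>L. card C = \<rho> \<and> (\<forall>l'\<in>C. hits (v l) (b l - a l) l')"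
    using hits B(1) by blast
  then obtain C where C: "\<And>l. l \<in> B \<Longrightarrow> C l \<subseteq> L" "\<And>l. l \<in> B \<Longrightarrow> card (C l) = \<rho>"
      "\<And>l l'. l \<in> B \<Longrightarrow> l' \<in> C l \<Longrightarrow> hits (v l) (b l - a l) l'"
    by metis
  have fin: "finite B" "\<And>l. l \<in> B \<Longrightarrow> finite (C l)"
    using B(1) C(1) finite_L finite_subset by blast+
  have "card (Sigma B C) = \<rho>\<^sup>2"
    using fin C(2) B(2) by (simp add: power2_eq_square)
  moreover have "Sigma B C \<subseteq> L \<times> L" using B(1) C(1) by blast
  moreover have "vertex_near z (l, l')" if l: "l \<in> B" "l' \<in> C l" for l l'
  proof -
    obtain s where s: "orient (a l') (b l') (v l + s *\<^sub>R (b l - a l)) = 0" "sep (v l) (v l + s *\<^sub>R (b l - a l)) \<le> \<rho>"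
        and cr: "cross2 (b l' - a l') (b l - a l) \<noteq> 0"
      using C(3)[OF l] unfolding hits_def by blast
    have "orient (a l) (b l) (v l + s *\<^sub>R (b l - a l)) = 0"
      using v(1)[OF l(1)] by (simp add: orient_add_scale cross2_def)
    moreover have "sep z (v l + s *\<^sub>R (b l - a l)) \<le> 2 * \<rho> + t"
      using sep_triangle[of z "v l + s *\<^sub>R (b l - a l)" "v l"] v(2)[OF l(1)] s(2) by linarith
    ultimately show ?thesis using s(1) cr unfolding vertex_near_def by blast
  qed
  ultimately show ?thesis by (intro exI[of _ "Sigma B C"]) auto
qed

lemma vertex_unique:
  assumes "cross2 (b l' - a l') (b l - a l) \<noteq> 0"
    and "orient (a l) (b l) u = 0" "orient (a l') (b l') u = 0"
    and "orient (a l) (b l) w = 0" "orient (a l') (b l') w = 0"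
  shows "u = w"
proof -
  have 1: "cross2 (b l - a l) (u - w) = 0" "cross2 (b l' - a l') (u - w) = 0"
    using assms by (simp_all add: orient_coord cross2_def algebra_simps)
  have "cross2 (b l' - a l') (b l - a l) * (u - w)$1 = 0" "cross2 (b l' - a l') (b l - a l) * (u - w)$2 = 0"
    using 1 unfolding cross2_def by algebra+
  then have "(u - w)$1 = 0" "(u - w)$2 = 0" using assms(1) by auto
  then show ?thesis by (simp add: vec2_eq_iff)
qed

text \<open>
  Double counting with the Cauchy--Schwarz inequality: every point has \<open>\<rho>\<^sup>2\<close> pairs of lines that
  meet near it, and two points that share such a pair are near each other.
\<close>

lemma close_pairs:
  assumes "finite Q"
  shows "(card Q)\<^sup>2 * \<rho>\<^sup>2 \<le> (card L)\<^sup>2 * card {(z, w)\<in>Q \<times> Q. sep z w \<le> 4 * \<rho> + 3 * t}"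
proof (cases "\<rho> = 0")
  case True
  then show ?thesis by simp
next
  case False
  obtain X where X: "\<And>z. X z \<subseteq> L \<times> L" "\<And>z. card (X z) = \<rho>\<^sup>2" "\<And>z x. x \<in> X z \<Longrightarrow> vertex_near z x"
    using nearby_vertices by metis
  have finX: "finite (X z)" for z using X(1) finite_L finite_subset by blast
  define P where "P = {(z, w)\<in>Q \<times> Q. sep z w \<le> 4 * \<rho> + 3 * t}"
  \<comment> \<open>Twice \<open>2 * \<rho> + t\<close> for reaching the common vertex, and
    \<open>t\<close> more for the lines through it.\<close>
  have close: "sep z w \<le> 4 * \<rho> + 3 * t" if zx: "x \<in> X z" and wx: "x \<in> X w" for x z w
  proof -
    obtain l l' where x: "x = (l, l')" by (cases x)
    obtain u where u: "orient (a l) (b l) u = 0" "orient (a l') (b l') u = 0" "sep z u \<le> 2 * \<rho> + t"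
        and cr: "cross2 (b l' - a l') (b l - a l) \<noteq> 0"
      using X(3)[OF zx] unfolding vertex_near_def x by auto
    obtain u' where u': "orient (a l) (b l) u' = 0" "orient (a l') (b l') u' = 0" "sep w u' \<le> 2 * \<rho> + t"
      using X(3)[OF wx] unfolding vertex_near_def x by auto
    have "u = u'" by (rule vertex_unique[OF cr u(1,2) u'(1,2)])
    then have "sep w u \<le> 2 * \<rho> + t" using u'(3) by simp
    then show ?thesis using sep_triangle[of z w u] u(3) sep_sym[of w u] by linarith
  qed
  define c where "c x = (\<Sum>z\<in>Q. if x \<in> X z then 1 else 0 :: nat)" for x
  have LL: "finite (L \<times> L)" using finite_L by simp
  have ind: "(\<Sum>x\<in>L \<times> L. if x \<in> Y then 1 else 0 :: nat) = card Y" if "Y \<subseteq> L \<times> L" for Y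
    using that LL by (simp add: Int_absorb1 flip: sum.inter_restrict)
  have "(\<Sum>x\<in>L \<times> L. c x) = (\<Sum>z\<in>Q. \<Sum>x\<in>L \<times> L. if x \<in> X z then 1 else 0)"
    unfolding c_def by (rule sum.swap)
  also have "\<dots> = card Q * \<rho>\<^sup>2" using ind[OF X(1)] X(2) by simp
  finally have 1: "(\<Sum>x\<in>L \<times> L. c x) = card Q * \<rho>\<^sup>2" .
  have "(c x)\<^sup>2 = (\<Sum>z\<in>Q. \<Sum>w\<in>Q. if x \<in> X z \<inter> X w then 1 else 0)" for x
    unfolding c_def power2_eq_square sum_product by (intro sum.cong) auto
  then have "(\<Sum>x\<in>L \<times> L. (c x)\<^sup>2) = (\<Sum>x\<in>L \<times> L. \<Sum>z\<in>Q. \<Sum>w\<in>Q. if x \<in> X z \<inter> X w then 1 else 0)"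
    by simp
  also have "\<dots> = (\<Sum>z\<in>Q. \<Sum>x\<in>L \<times> L. \<Sum>w\<in>Q. if x \<in> X z \<inter> X w then 1 else 0)"
    by (rule sum.swap)
  also have "\<dots> = (\<Sum>z\<in>Q. \<Sum>w\<in>Q. \<Sum>x\<in>L \<times> L. if x \<in> X z \<inter> X w then 1 else 0)"
    by (intro sum.cong refl sum.swap)
  also have "\<dots> = (\<Sum>z\<in>Q. \<Sum>w\<in>Q. card (X z \<inter> X w))"
    using X(1) by (intro sum.cong refl ind) auto
  also have "\<dots> \<le> (\<Sum>z\<in>Q. \<Sum>w\<in>Q. if (z, w) \<in> P then \<rho>\<^sup>2 else 0)"
  proof (intro sum_mono)
    fix z w assume "z \<in> Q" "w \<in> Q"
    show "card (X z \<inter> X w) \<le> (if (z, w) \<in> P then \<rho>\<^sup>2 else 0)"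
    proof (cases "X z \<inter> X w = {}")
      case True
      then show ?thesis by simp
    next
      case False
      then have "(z, w) \<in> P" using close \<open>z \<in> Q\<close> \<open>w \<in> Q\<close> unfolding P_def by blast
      moreover have "card (X z \<inter> X w) \<le> card (X z)" using finX by (intro card_mono) auto
      ultimately show ?thesis using X(2) by simp
    qed
  qed
  also have "\<dots> = (\<Sum>y\<in>Q \<times> Q. if y \<in> P then \<rho>\<^sup>2 else 0)"
    by (simp add: sum.cartesian_product)
  also have "\<dots> = card P * \<rho>\<^sup>2"
  proof -
    have "P \<subseteq> Q \<times> Q" by (auto simp: P_def)
    then show ?thesis using assms by (simp add: Int_absorb1 flip: sum.inter_restrict)
  qed
  finally have 2: "(\<Sum>x\<in>L \<times> L. (c x)\<^sup>2) \<le> card P * \<rho>\<^sup>2" .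
  have "(\<Sum>x\<in>L \<times> L. real (c x))\<^sup>2 \<le> real (card (L \<times> L)) * (\<Sum>x\<in>L \<times> L. (real (c x))\<^sup>2)"
    using sum_squared_le_sum_of_squares[of "\<lambda>x. real (c x)" "L \<times> L"] LL by (simp add: mult.commute)
  then have "real ((card Q * \<rho>\<^sup>2)\<^sup>2) \<le> real (card (L \<times> L) * (\<Sum>x\<in>L \<times> L. (c x)\<^sup>2))"
    unfolding 1[symmetric] by (simp add: of_nat_sum)
  then have "(card Q * \<rho>\<^sup>2)\<^sup>2 \<le> (card L)\<^sup>2 * (\<Sum>x\<in>L \<times> L. (c x)\<^sup>2)"
    unfolding of_nat_le_iff by (simp add: card_cartesian_product power2_eq_square)
  also have "\<dots> \<le> (card L)\<^sup>2 * (card P * \<rho>\<^sup>2)" using 2 by simp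
  finally have "\<rho>\<^sup>2 * ((card Q)\<^sup>2 * \<rho>\<^sup>2) \<le> \<rho>\<^sup>2 * ((card L)\<^sup>2 * card P)"
    by (simp add: power2_eq_square algebra_simps)
  then show ?thesis using False unfolding P_def[symmetric] by simp
qed

end

section \<open>Lightly crossed edges in an extreme annulus\<close>

context drawing
begin

text \<open>The orientation relative to the line of \<open>i\<close> and \<open>j\<close> is affine
  and vanishes at a point strictly between \<open>u\<close> and \<open>v\<close>. If it vanished at
  one end it would vanish at both, and general position would force the two edges to be equal; so
  the sign change is strict.\<close>

lemma crossing_separates:
  assumes e: "{u, v} \<in> K_edges n" and f: "{i, j} \<in> crossing_edges n p {u, v}"
  shows "orient (p i) (p j) (p u) * orient (p i) (p j) (p v) < 0"
proof -
  have ne: "{i, j} \<noteq> {u, v}" and fE: "{i, j} \<in> K_edges n" using f by (auto simp: crossing_edges_def)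
  have uv: "u \<noteq> v" "u < n" "v < n" and ij: "i \<noteq> j" "i < n" "j < n"
    using e fE by (auto simp: K_edges_def K_verts_def card_2_iff doubleton_eq_iff)
  obtain z where z: "z \<in> open_segment (p u) (p v)" "z \<in> open_segment (p i) (p j)"
    using f by (auto simp: crossing_edges_def edge_interior_eq_open_segment)
  obtain t where t: "0 < t" "t < 1" "z = (1 - t) *\<^sub>R p u + t *\<^sub>R p v"
    using z(1) by (auto simp: in_segment)
  obtain s where s: "z = (1 - s) *\<^sub>R p i + s *\<^sub>R p j"
    using z(2) by (auto simp: in_segment)
  let ?o = "orient (p i) (p j)"
  have o0: "?o (p i) = 0" "?o (p j) = 0" by (auto simp: orient_coord)
  have "(1 - t) * ?o (p u) + t * ?o (p v) = 0"
    unfolding orient_affine[symmetric] t(3)[symmetric] unfolding s orient_affine o0 by simp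
  moreover have on: "w \<in> {i, j}" if "?o (p w) = 0" "w < n" for w
    using orient_nz[of i j w] that ij by auto
  moreover have "?o (p u) \<noteq> 0"
  proof
    assume u0: "?o (p u) = 0"
    then have "?o (p v) = 0" using calculation(1) t by simp
    then show False using on[OF u0] on uv ne by auto
  qed
  ultimately have eq: "t * ?o (p v) = - ((1 - t) * ?o (p u))" and nz: "?o (p u) \<noteq> 0" by linarith+
  have "t * (?o (p u) * ?o (p v)) = ?o (p u) * (t * ?o (p v))" by (simp only: ac_simps)
  also have "\<dots> = - ((1 - t) * (?o (p u))\<^sup>2)"
    unfolding eq by (simp add: power2_eq_square)
  also have "\<dots> < 0" using nz t by simp
  finally show ?thesis using t by (simp add: mult_less_0_iff)
qed

lemma no_crossing_adjacent:
  assumes e: "{u, v} \<in> K_edges n"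
  shows "{u, w} \<notin> crossing_edges n p {u, v}"
  using crossing_separates[OF e, of u w] by (auto simp: orient_coord)

text \<open>Two distinct points have equal height for at most one \<open>c\<close>, so only finitely
  many values are excluded.\<close>

lemma generic_height: "\<exists>c. inj_on (\<lambda>v. (p v)$1 + c * (p v)$2) {..<n}"
proof -
  define bad where "bad i j = {c. (p i)$1 + c * (p i)$2 = (p j)$1 + c * (p j)$2}" for i j
  have "finite (bad i j)" if "i < n" "j < n" "i \<noteq> j" for i j
  proof (cases "(p i)$2 = (p j)$2")
    case True
    then have "(p i)$1 \<noteq> (p j)$1" using p_inj[of i j] that by (auto simp: vec2_eq_iff)
    then show ?thesis using True by (simp add: bad_def)
  next
    case False
    have "bad i j \<subseteq> {((p j)$1 - (p i)$1) / ((p i)$2 - (p j)$2)}"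
      using False by (auto simp: bad_def field_simps)
    then show ?thesis using finite_subset by blast
  qed
  then have "finite (\<Union>i<n. \<Union>j\<in>{..<n} - {i}. bad i j)" by auto
  then obtain c where c: "c \<notin> (\<Union>i<n. \<Union>j\<in>{..<n} - {i}. bad i j)"
    using ex_new_if_finite infinite_UNIV_char_0 by blast
  have "inj_on (\<lambda>v. (p v)$1 + c * (p v)$2) {..<n}"
    by (rule inj_onI) (use c in \<open>auto simp: bad_def\<close>)
  then show ?thesis by blast
qed

end

section \<open>Ranks by height, with rank 0 at the top, and edges among the highest vertices\<close>

locale drawing_height = drawing +
  fixes c :: real
  assumes height_inj: "inj_on (\<lambda>v. (p v)$1 + c * (p v)$2) {..<n}"
begin

definition height :: "real^2 \<Rightarrow> real" where
  "height z = z$1 + c * z$2"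

definition rank :: "nat \<Rightarrow> nat" where
  "rank v = card {w. w < n \<and> height (p v) < height (p w)}"

definition top_verts :: "nat \<Rightarrow> nat set" where
  "top_verts m = {v. v < n \<and> rank v < m}"

lemma height_affine: "height ((1 - t) *\<^sub>R z + t *\<^sub>R w) = (1 - t) * height z + t * height w"
  by (simp add: height_def algebra_simps)

lemma rank_mono: "height (p v) \<le> height (p w) \<Longrightarrow> rank w \<le> rank v"
  unfolding rank_def by (intro card_mono) auto

lemma rank_strict: "w < n \<Longrightarrow> height (p v) < height (p w) \<Longrightarrow> rank w < rank v"
  unfolding rank_def by (intro psubset_card_mono) auto

lemma rank_image: "rank ` {..<n} = {..<n}" and rank_inj: "inj_on rank {..<n}"
proof -
  show inj: "inj_on rank {..<n}"
  proof (rule inj_onI, rule ccontr)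
    fix v w assume vw: "v \<in> {..<n}" "w \<in> {..<n}" "rank v = rank w" "v \<noteq> w"
    have "height (p v) \<noteq> height (p w)"
      using inj_onD[OF height_inj] vw unfolding height_def by blast
    then have "height (p v) < height (p w) \<or> height (p w) < height (p v)" by auto
    then show False using rank_strict[of w v] rank_strict[of v w] vw by auto
  qed
  have "rank v < n" if "v < n" for v
  proof -
    have "{w. w < n \<and> height (p v) < height (p w)} \<subset> {..<n}" using that by auto
    then have "rank v < card {..<n}" unfolding rank_def by (intro psubset_card_mono) auto
    then show ?thesis by simp
  qed
  then have "rank ` {..<n} \<subseteq> {..<n}" by auto
  then show "rank ` {..<n} = {..<n}" using inj by (intro endo_inj_surj) auto
qed

lemma card_top: "m \<le> n \<Longrightarrow> card (top_verts m) = m"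
proof -
  assume m: "m \<le> n"
  have "rank ` top_verts m = {..<m}"
  proof
    show "rank ` top_verts m \<subseteq> {..<m}" by (auto simp: top_verts_def)
    show "{..<m} \<subseteq> rank ` top_verts m"
    proof
      fix r assume r: "r \<in> {..<m}"
      then have "r \<in> rank ` {..<n}" using m rank_image by auto
      then show "r \<in> rank ` top_verts m" using r by (auto simp: top_verts_def)
    qed
  qed
  moreover have "inj_on rank (top_verts m)"
    by (rule inj_on_subset[OF rank_inj]) (auto simp: top_verts_def)
  ultimately show ?thesis using card_image by fastforce
qed

lemma top_lt: "v \<in> top_verts m \<Longrightarrow> v < n" by (simp add: top_verts_def)

lemma finite_top: "finite (top_verts m)" by (simp add: top_verts_def)

lemma height_top:
  assumes "u \<in> top_verts m" "w < n" "w \<notin> top_verts m"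
  shows "height (p w) < height (p u)"
proof (rule ccontr)
  assume "\<not> height (p w) < height (p u)"
  then have "rank w \<le> rank u" by (intro rank_mono) simp
  then show False using assms by (simp add: top_verts_def)
qed

text \<open>Height is affine along segments, and every vertex outside the top is strictly lower than
  every vertex in it. A segment with both ends outside therefore stays below a segment with both
  ends inside.\<close>

lemma crossing_meets_top:
  assumes e: "e \<in> K_edges n" "e \<subseteq> top_verts m" and f: "f \<in> crossing_edges n p e"
  obtains i j where "f = {i, j}" "i \<in> top_verts m" "j < n" "j \<noteq> i"
proof -
  obtain u v where uv: "e = {u, v}" "u \<noteq> v" "u < n" "v < n" using e(1) by (rule K_edgesE)
  have "f \<in> K_edges n" using f by (simp add: crossing_edges_def)
  then obtain i j where ij: "f = {i, j}" "i \<noteq> j" "i < n" "j < n" by (rule K_edgesE)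
  have "i \<in> top_verts m \<or> j \<in> top_verts m"
  proof (rule ccontr)
    assume "\<not> (i \<in> top_verts m \<or> j \<in> top_verts m)"
    then have h: "height (p w) < height (p x)" if "w \<in> {i, j}" "x \<in> {u, v}" for w x
      using that e(2) uv ij by (intro height_top[of x m w]) auto
    obtain z where z: "z \<in> open_segment (p u) (p v)" "z \<in> open_segment (p i) (p j)"
      using f unfolding uv ij by (auto simp: crossing_edges_def edge_interior_eq_open_segment)
    obtain t where t: "0 < t" "t < 1" "z = (1 - t) *\<^sub>R p u + t *\<^sub>R p v"
      using z(1) by (auto simp: in_segment)
    obtain s where s: "0 < s" "s < 1" "z = (1 - s) *\<^sub>R p i + s *\<^sub>R p j"
      using z(2) by (auto simp: in_segment)
    define M where "M = max (height (p i)) (height (p j))"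
    have M: "height (p i) \<le> M" "height (p j) \<le> M" "M < height (p u)" "M < height (p v)"
      using h by (auto simp: M_def)
    have "height z \<le> (1 - s) * M + s * M"
      unfolding s(3) height_affine using M s by (intro add_mono mult_left_mono) auto
    moreover have "(1 - t) * M + t * M < height z"
      unfolding t(3) height_affine using M t by (intro add_strict_mono mult_strict_left_mono) auto
    ultimately show False by (simp add: algebra_simps)
  qed
  then show ?thesis using that[of i j] that[of j i] ij by auto
qed

lemma crossings_top_le:
  assumes "e \<in> K_edges n" "e \<subseteq> top_verts m" "m \<le> n"
  shows "card (crossing_edges n p e) \<le> m * n"
proof -
  have "crossing_edges n p e \<subseteq> (\<lambda>(i, j). {i, j}) ` (top_verts m \<times> {..<n})"
  proof
    fix f assume "f \<in> crossing_edges n p e"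
    then obtain i j where "f = {i, j}" "i \<in> top_verts m" "j < n"
      using crossing_meets_top[OF assms(1,2)] by metis
    then show "f \<in> (\<lambda>(i, j). {i, j}) ` (top_verts m \<times> {..<n})" by auto
  qed
  then have "card (crossing_edges n p e) \<le> card (top_verts m \<times> {..<n})"
    using finite_top by (meson finite_SigmaI finite_lessThan surj_card_le)
  then show ?thesis using assms(3) by (simp add: card_cartesian_product card_top)
qed

text \<open>The edge chosen joins the two highest vertices; it need not lie on the hull. An edge
  crossing it would have one of them as an end, but edges with a common end do not cross.\<close>

lemma hull_edge_uncrossed:
  assumes "2 \<le> n"
  shows "\<exists>e\<in>K_edges n. crossing_edges n p e = {}"
proof -
  have "card (top_verts 2) = 2" using assms by (simp add: card_top)
  then obtain u v where uv: "top_verts 2 = {u, v}" "u \<noteq> v" by (auto simp: card_2_iff)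
  then have e: "{u, v} \<in> K_edges n" using top_lt by (intro K_edgesI) blast+
  then have e': "{v, u} \<in> K_edges n" by (simp add: insert_commute)
  have "f \<notin> crossing_edges n p {u, v}" for f
  proof
    assume f: "f \<in> crossing_edges n p {u, v}"
    obtain i j where "f = {i, j}" "i \<in> top_verts 2"
      by (rule crossing_meets_top[OF e _ f, of 2]) (use uv in auto)
    then show False
      using f uv(1) no_crossing_adjacent[OF e] no_crossing_adjacent[OF e'] by (auto simp: insert_commute)
  qed
  then show ?thesis using e by blast
qed

definition low_edges :: "nat \<Rightarrow> nat set set" where
  "low_edges k = {e\<in>K_edges n. card (crossing_edges n p e) \<le> k}"

lemma finite_low_edges: "finite (low_edges k)"
  unfolding low_edges_def using finite_K_edges by auto

lemma low_edges_pos: "2 \<le> n \<Longrightarrow> 1 \<le> card (low_edges k)"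
proof -
  assume "2 \<le> n"
  then obtain e where "e \<in> K_edges n" "crossing_edges n p e = {}" using hull_edge_uncrossed by blast
  then have "e \<in> low_edges k" by (simp add: low_edges_def)
  then show ?thesis using finite_low_edges[of k] by (simp add: Suc_le_eq card_gt_0_iff) blast
qed

lemma low_edges_base:
  assumes "m * n \<le> k" "m \<le> n"
  shows "m choose 2 \<le> card (low_edges k)"
proof -
  have "{e. e \<subseteq> top_verts m \<and> card e = 2} \<subseteq> low_edges k"
  proof
    fix e assume "e \<in> {e. e \<subseteq> top_verts m \<and> card e = 2}"
    then have e: "e \<subseteq> top_verts m" "e \<in> K_edges n"
      using top_lt by (auto simp: K_edges_def K_verts_def)
    then show "e \<in> low_edges k"
      using crossings_top_le[OF e(2,1) assms(2)] assms(1) by (simp add: low_edges_def)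
  qed
  then have "card {e. e \<subseteq> top_verts m \<and> card e = 2} \<le> card (low_edges k)"
    using finite_low_edges by (intro card_mono)
  then show ?thesis using n_subsets[OF finite_top, of m 2] card_top[OF assms(2)] by simp
qed

section \<open>Annuli of ranks and the lines through the top vertices\<close>

definition annulus :: "nat \<Rightarrow> nat set" where
  "annulus m = top_verts (2 * m) - top_verts m"

lemma card_annulus: "2 * m \<le> n \<Longrightarrow> card (annulus m) = m"
proof -
  assume "2 * m \<le> n"
  moreover have "top_verts m \<subseteq> top_verts (2 * m)" by (auto simp: top_verts_def)
  ultimately show ?thesis
    by (simp add: annulus_def card_Diff_subset[OF finite_top] card_top)
qed

text \<open>Ordered pairs: the line of an edge with both ends in the top occurs twice. This makes
  the count exact, and every edge that can cross an edge among the top vertices is still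
  represented.\<close>

definition rays :: "nat \<Rightarrow> (nat \<times> nat) set" where
  "rays m = (SIGMA i:top_verts m. {..<n} - {i})"

lemma card_rays: "m \<le> n \<Longrightarrow> card (rays m) = m * (n - 1)"
proof -
  assume "m \<le> n"
  have "card (rays m) = (\<Sum>i\<in>top_verts m. card ({..<n} - {i}))"
    unfolding rays_def using finite_top by (intro card_SigmaI) auto
  also have "\<dots> = (\<Sum>i\<in>top_verts m. n - 1)"
    using top_lt by (intro sum.cong) auto
  finally show ?thesis using \<open>m \<le> n\<close> by (simp add: card_top)
qed

lemma finite_rays: "finite (rays m)"
  unfolding rays_def using finite_top by auto

lemma card_inj_fst:
  assumes "A \<subseteq> rays m" "inj_on fst A"
  shows "card A \<le> n"
proof -
  have "fst ` A \<subseteq> {..<n}" using assms(1) top_lt by (auto simp: rays_def)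
  then have "card (fst ` A) \<le> card {..<n}" by (intro card_mono) auto
  then show ?thesis using card_image[OF assms(2)] by simp
qed

text \<open>Rays that start at \<open>z\<close> differ in their second vertex, so there are at most
  \<open>n\<close>. Any other starting vertex sends at most one ray through \<open>z\<close>, since
  two would make three vertices collinear.\<close>

lemma rays_through_point:
  "card {l\<in>rays m. orient (p (fst l)) (p (snd l)) z = 0} \<le> 2 * n"
proof -
  define A where "A = {l\<in>rays m. p (fst l) = z}"
  define B where "B = {l\<in>rays m. orient (p (fst l)) (p (snd l)) z = 0 \<and> p (fst l) \<noteq> z}"
  have "inj_on snd A"
  proof (rule inj_onI)
    fix x y assume "x \<in> A" "y \<in> A" "snd x = snd y"
    moreover from this have "fst x = fst y"
      using top_lt by (intro p_inj) (auto simp: A_def rays_def)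
    ultimately show "x = y" by (simp add: prod_eq_iff)
  qed
  moreover have "snd ` A \<subseteq> {..<n}" by (auto simp: A_def rays_def)
  ultimately have A: "card A \<le> n"
    using card_mono[of "{..<n}" "snd ` A"] by (simp add: card_image)
  have "inj_on fst B"
  proof (rule inj_onI, rule ccontr)
    fix x y assume xy: "x \<in> B" "y \<in> B" "fst x = fst y" "x \<noteq> y"
    have "orient (p (fst x)) (p (snd x)) z = 0" "orient (p (fst x)) (p (snd y)) z = 0" "z \<noteq> p (fst x)"
      using xy(1,2) by (auto simp: B_def xy(3)[symmetric])
    then have "orient (p (fst x)) (p (snd x)) (p (snd y)) = 0" by (rule orient_common_line)
    moreover have "snd x \<noteq> snd y" using xy by (auto simp: prod_eq_iff)
    ultimately show False
      using orient_nz[of "fst x" "snd x" "snd y"] xy top_lt by (auto simp: B_def rays_def)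
  qed
  then have B: "card B \<le> n" by (intro card_inj_fst[of B m]) (auto simp: B_def)
  have "{l\<in>rays m. orient (p (fst l)) (p (snd l)) z = 0} \<subseteq> A \<union> B"
    by (auto simp: A_def B_def)
  then have "card {l\<in>rays m. orient (p (fst l)) (p (snd l)) z = 0} \<le> card (A \<union> B)"
    using finite_rays by (intro card_mono) (auto simp: A_def B_def)
  also have "\<dots> \<le> card A + card B" by (rule card_Un_le)
  finally show ?thesis using A B by linarith
qed

lemma rays_parallel:
  assumes "w \<noteq> 0"
  shows "card {l\<in>rays m. cross2 (p (snd l) - p (fst l)) w = 0} \<le> n"
proof (rule card_inj_fst[of _ m])
  show "inj_on fst {l\<in>rays m. cross2 (p (snd l) - p (fst l)) w = 0}"
  proof (rule inj_onI, rule ccontr)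
    fix x y assume xy: "x \<in> {l\<in>rays m. cross2 (p (snd l) - p (fst l)) w = 0}"
      "y \<in> {l\<in>rays m. cross2 (p (snd l) - p (fst l)) w = 0}" "fst x = fst y" "x \<noteq> y"
    let ?z = "p (fst x) + w"
    have "orient (p (fst x)) (p (snd x)) ?z = 0" "orient (p (fst x)) (p (snd y)) ?z = 0" "?z \<noteq> p (fst x)"
      using xy(1,2) assms by (auto simp: orient_def xy(3)[symmetric])
    then have "orient (p (fst x)) (p (snd x)) (p (snd y)) = 0" by (rule orient_common_line)
    moreover have "snd x \<noteq> snd y" using xy by (auto simp: prod_eq_iff)
    ultimately show False
      using orient_nz[of "fst x" "snd x" "snd y"] xy top_lt by (auto simp: rays_def)
  qed
qed auto

text \<open>The packing bound for \<open>m\<close> points, \<open>2 * m * (n - 1)\<close> lines and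
  \<open>t = 2 * n\<close>; the factor \<open>m\<^sup>2\<close> cancels. Among the close ordered
  pairs, at most \<open>m\<close> lie on the diagonal and each edge accounts for at most two. The
  summand \<open>6 * n\<close> in the assumption is \<open>3 * t\<close>.\<close>

lemma low_edges_annulus:
  assumes m: "0 < m" "2 * m \<le> n" and \<rho>: "\<rho> + n \<le> 2 * m * (n - 1)" "4 * \<rho> + 6 * n \<le> k"
  shows "\<rho>\<^sup>2 \<le> (2 * (n - 1))\<^sup>2 * (m + 2 * card {e\<in>low_edges k. e \<subseteq> annulus m})"
proof -
  define L where "L = rays (2 * m)"
  define a where "a l = p (fst l)" for l :: "nat \<times> nat"
  define b where "b l = p (snd l)" for l :: "nat \<times> nat"
  have cL: "card L = 2 * m * (n - 1)" unfolding L_def using m by (simp add: card_rays)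
  interpret line_family L a b "2 * n" \<rho>
  proof
    show "finite L" by (simp add: L_def finite_rays)
    show "card {l\<in>L. orient (a l) (b l) z = 0} \<le> 2 * n" for z
      unfolding L_def a_def b_def by (rule rays_through_point)
    have "0 < card L" using cL m by simp
    then show "L \<noteq> {}" by auto
    fix l assume l: "l \<in> L"
    have w: "b l - a l \<noteq> 0"
    proof
      assume "b l - a l = 0"
      then have "snd l = fst l"
        using l top_lt by (intro p_inj) (auto simp: L_def rays_def a_def b_def)
      then show False using l by (auto simp: L_def rays_def)
    qed
    let ?Z = "{l'\<in>L. cross2 (b l' - a l') (b l - a l) = 0}"
    have "L = ?Z \<union> {l'\<in>L. cross2 (b l' - a l') (b l - a l) \<noteq> 0}" by auto
    then have "card L \<le> card ?Z + card {l'\<in>L. cross2 (b l' - a l') (b l - a l) \<noteq> 0}"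
      by (metis (no_types, lifting) card_Un_le)
    moreover have "card ?Z \<le> n" using rays_parallel[OF w, of "2 * m"] by (simp add: L_def a_def b_def)
    ultimately show "\<rho> \<le> card {l'\<in>L. cross2 (b l' - a l') (b l - a l) \<noteq> 0}"
      using \<rho>(1) cL by linarith
  qed
  have annlt: "v < n" if "v \<in> annulus m" for v using that top_lt by (auto simp: annulus_def)
  have finA: "finite (annulus m)" using finite_top by (simp add: annulus_def)
  have pinj: "inj_on p (annulus m)" using p_inj annlt by (auto intro: inj_onI)
  define E where "E = {e\<in>low_edges k. e \<subseteq> annulus m}"
  have finE: "finite E" using finite_low_edges by (simp add: E_def)
  have inE: "{u, v} \<in> E"
    if uv: "u \<in> annulus m" "v \<in> annulus m" "u \<noteq> v" and s: "sep (p u) (p v) \<le> 4 * \<rho> + 3 * (2 * n)" for u v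
  proof -
    have e: "{u, v} \<in> K_edges n" using uv annlt by (intro K_edgesI) auto
    have top: "{u, v} \<subseteq> top_verts (2 * m)" using uv by (auto simp: annulus_def)
    have "crossing_edges n p {u, v} \<subseteq> (\<lambda>(i, j). {i, j}) ` {l\<in>L. orient (a l) (b l) (p u) * orient (a l) (b l) (p v) < 0}"
    proof
      fix f assume f: "f \<in> crossing_edges n p {u, v}"
      then obtain i j where ij: "f = {i, j}" "i \<in> top_verts (2 * m)" "j < n" "j \<noteq> i"
        using crossing_meets_top[OF e top] by metis
      then have "(i, j) \<in> {l\<in>L. orient (a l) (b l) (p u) * orient (a l) (b l) (p v) < 0}"
        using crossing_separates[OF e, of i j] f by (auto simp: L_def rays_def a_def b_def)
      then show "f \<in> (\<lambda>(i, j). {i, j}) ` {l\<in>L. orient (a l) (b l) (p u) * orient (a l) (b l) (p v) < 0}"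
        using ij(1) by (intro rev_image_eqI) auto
    qed
    then have "card (crossing_edges n p {u, v}) \<le> sep (p u) (p v)"
      unfolding sep_def using finite_L by (intro surj_card_le) auto
    then show ?thesis using s \<rho>(2) e uv by (simp add: E_def low_edges_def)
  qed
  define P where "P = {(z, w)\<in>p ` annulus m \<times> p ` annulus m. sep z w \<le> 4 * \<rho> + 3 * (2 * n)}"
  define D where "D = (\<lambda>v. (v, v)) ` annulus m"
  define U where "U = {(u, v). u < v \<and> {u, v} \<in> E}"
  define V where "V = {(u, v). v < u \<and> {u, v} \<in> E}"
  have inj: "finite W \<and> card W \<le> card E" if "inj_on (\<lambda>(u, v). {u, v}) W" "(\<lambda>(u, v). {u, v}) ` W \<subseteq> E" for W
    using inj_on_finite[OF that finE] card_inj_on_le[OF that finE] by simp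
  have Uc: "finite U \<and> card U \<le> card E" by (rule inj) (auto simp: U_def inj_on_def doubleton_eq_iff)
  have Vc: "finite V \<and> card V \<le> card E" by (rule inj) (auto simp: V_def inj_on_def doubleton_eq_iff)
  have "P \<subseteq> (\<lambda>(u, v). (p u, p v)) ` (D \<union> (U \<union> V))"
  proof
    fix x assume "x \<in> P"
    then obtain u v where uv: "x = (p u, p v)" "u \<in> annulus m" "v \<in> annulus m" "sep (p u) (p v) \<le> 4 * \<rho> + 3 * (2 * n)"
      by (auto simp: P_def)
    have "(u, v) \<in> D \<union> (U \<union> V)"
      using inE[OF uv(2,3) _ uv(4)] uv(2) by (cases u v rule: linorder_cases) (auto simp: D_def U_def V_def)
    then show "x \<in> (\<lambda>(u, v). (p u, p v)) ` (D \<union> (U \<union> V))" using uv(1) by (intro rev_image_eqI) auto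
  qed
  then have "card P \<le> card (D \<union> (U \<union> V))"
    using Uc Vc finA by (intro surj_card_le) (auto simp: D_def)
  also have "\<dots> \<le> card D + (card U + card V)"
    by (intro order.trans[OF card_Un_le] add_mono card_Un_le order.refl)
  also have "\<dots> \<le> m + 2 * card E"
    using Uc Vc card_image_le[OF finA, of "\<lambda>v. (v, v)"] card_annulus[OF m(2)] by (simp add: D_def)
  finally have P: "card P \<le> m + 2 * card E" .
  have "m\<^sup>2 * \<rho>\<^sup>2 \<le> (2 * m * (n - 1))\<^sup>2 * card P"
    using close_pairs[of "p ` annulus m"] finA card_image[OF pinj] card_annulus[OF m(2)] cL
    by (simp add: P_def)
  also have "\<dots> = m\<^sup>2 * ((2 * (n - 1))\<^sup>2 * card P)" by (simp add: power2_eq_square algebra_simps)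
  finally have "\<rho>\<^sup>2 \<le> (2 * (n - 1))\<^sup>2 * card P" using m(1) by simp
  also have "\<dots> \<le> (2 * (n - 1))\<^sup>2 * (m + 2 * card E)" using P by simp
  finally show ?thesis by (simp add: E_def)
qed

end

section \<open>From a single annulus to the sum over dyadic annuli\<close>

context drawing_height
begin

text \<open>The \<open>m = k div n\<close> highest vertices span about half of
  \<open>m\<^sup>2\<close> edges, each with at most \<open>m * n \<le> k\<close> crossings. For
  \<open>m = 1\<close> there are none, and the uncrossed edge takes their place.\<close>

lemma low_edges_quadratic:
  assumes n: "3 \<le> n" and k: "n \<le> k" "k \<le> n choose 2"
  shows "(real k / real n)\<^sup>2 / 16 \<le> card (low_edges k)"
proof -
  define x where "x = real k / real n"
  define m where "m = k div n"
  have "k < (m + 1) * n"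
    using dividend_less_div_times[of n k] n unfolding m_def by simp
  then have "real k < (real m + 1) * real n"
    by (metis of_nat_1 of_nat_add of_nat_less_iff of_nat_mult)
  then have xm: "x < real m + 1" unfolding x_def using n by (simp add: field_simps)
  have m1: "1 \<le> m" unfolding m_def using k n by (simp add: Suc_le_eq div_greater_zero_iff)
  have x0: "0 \<le> x" by (simp add: x_def)
  show ?thesis
  proof (cases "m = 1")
    case True
    then have "x < 2" using xm by simp
    then have "x\<^sup>2 \<le> 2\<^sup>2" using x0 by (intro power_mono) auto
    moreover have "1 \<le> card (low_edges k)" using low_edges_pos n by simp
    ultimately show ?thesis unfolding x_def[symmetric] by simp
  next
    case False
    then have m2: "2 \<le> m" using m1 by simp
    have "m \<le> n"
    proof -
      have "n * (n - 1) div 2 \<le> n * n"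
        by (rule order.trans[OF div_le_dividend]) simp
      then have "k div n \<le> (n * n) div n" using k(2) by (intro div_le_mono) (simp add: choose_two)
      then show ?thesis unfolding m_def using n by simp
    qed
    moreover have "m * n \<le> k" unfolding m_def by simp
    ultimately have "m choose 2 \<le> card (low_edges k)" by (intro low_edges_base)
    then have "real (m choose 2) \<le> card (low_edges k)" by simp
    moreover have "real (m choose 2) = real m * (real m - 1) / 2"
      using m1 by (simp add: choose_two real_of_nat_div of_nat_diff)
    moreover have "x\<^sup>2 \<le> (2 * real m)\<^sup>2" using xm m1 x0 by (intro power_mono) auto
    moreover have "real m * 2 \<le> real m * real m" using m2 by (intro mult_left_mono) auto
    ultimately show ?thesis unfolding x_def[symmetric]
      by (simp add: power2_eq_square algebra_simps)
  qed
qed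

text \<open>Taking \<open>\<rho>\<close> near \<open>k / 4\<close>, the loss of \<open>6 * n\<close>
  and the rounding still leave \<open>k \<le> 8 * \<rho>\<close> when \<open>16 * n \<le> k\<close>.
  The packing bound becomes \<open>x\<^sup>2 \<le> 256 * m + 512 * E\<close>, of which the first
  summand is at most half. That \<open>x \<le> m\<close> ensures enough transversal lines.\<close>

lemma low_edges_annulus_real:
  assumes n: "3 \<le> n" and x: "x = real k / real n" "16 \<le> x"
    and m: "x \<le> real m" "512 * real m \<le> x\<^sup>2" "2 * m \<le> n"
  shows "x\<^sup>2 / 1024 \<le> card {e\<in>low_edges k. e \<subseteq> annulus m}"
proof -
  define E where "E = card {e\<in>low_edges k. e \<subseteq> annulus m}"
  define \<rho> where "\<rho> = (k - 6 * n) div 4"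
  have kx: "real k = x * real n" using x n by simp
  have "real (16 * n) \<le> real k" unfolding kx using x(2) by (simp add: mult_right_mono)
  then have k16: "16 * n \<le> k" by linarith
  have "real k \<le> real (m * n)" unfolding kx using m(1) by (simp add: mult_right_mono)
  then have km: "k \<le> m * n" by linarith
  have m16: "16 \<le> m" using m(1) x(2) by linarith
  have a: "16 * n \<le> m * n" using m16 by simp
  have b: "3 * m \<le> m * n" using n by simp
  have c: "2 * m * (n - 1) = 2 * (m * n) - 2 * m" by (simp add: algebra_simps)
  have "\<rho> + n \<le> 2 * m * (n - 1)"
    unfolding c \<rho>_def using a b km by linarith
  moreover have "4 * \<rho> + 6 * n \<le> k" unfolding \<rho>_def using k16 by linarith
  ultimately have "\<rho>\<^sup>2 \<le> (2 * (n - 1))\<^sup>2 * (m + 2 * E)"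
    unfolding E_def using m16 m(3) by (intro low_edges_annulus) auto
  also have "\<dots> \<le> (2 * n)\<^sup>2 * (m + 2 * E)" by (intro mult_right_mono power_mono) auto
  finally have "real (\<rho>\<^sup>2) \<le> real ((2 * n)\<^sup>2 * (m + 2 * E))" by linarith
  then have 1: "(real \<rho>)\<^sup>2 \<le> (2 * real n)\<^sup>2 * (real m + 2 * real E)" by simp
  have "k \<le> 8 * \<rho>" unfolding \<rho>_def using k16 n by linarith
  then have "x * real n / 8 \<le> real \<rho>" using kx by linarith
  then have "(x * real n / 8)\<^sup>2 \<le> (real \<rho>)\<^sup>2" using x by (intro power_mono) auto
  with 1 have "(real n)\<^sup>2 * x\<^sup>2 \<le> (real n)\<^sup>2 * (256 * (real m + 2 * real E))"
    by (simp add: power_mult_distrib power_divide algebra_simps)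
  then have "x\<^sup>2 \<le> 256 * real m + 512 * real E" using n by simp
  then have "x\<^sup>2 \<le> 1024 * real E" using m(2) by simp
  then show ?thesis unfolding E_def[symmetric] by simp
qed

lemma annulus_disjoint:
  assumes "s < s'"
  shows "annulus (m * 2 ^ s) \<inter> annulus (m * 2 ^ s') = {}"
proof -
  have "2 ^ Suc s \<le> (2::nat) ^ s'" using assms by (intro power_increasing) auto
  then have "2 * (m * 2 ^ s) \<le> m * 2 ^ s'" by (metis mult.left_commute mult_le_mono2 power_Suc)
  then have "top_verts (2 * (m * 2 ^ s)) \<subseteq> top_verts (m * 2 ^ s')"
    unfolding top_verts_def by (blast intro: less_le_trans)
  then show ?thesis by (auto simp: annulus_def)
qed

lemma low_edges_dyadic:
  assumes n: "3 \<le> n" and x: "x = real k / real n"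
    and X: "1024 \<le> X" "X \<le> x" "X \<le> real n / x"
  shows "log 2 (X / 1024) * (x\<^sup>2 / 1024) \<le> card (low_edges k)"
proof -
  \<comment> \<open>For \<open>s < T\<close> the factor 1024 gives
    \<open>m0 * 2 ^ s \<le> x * X / 512\<close>, using \<open>m0 \<le> 2 * x\<close>. As
    \<open>X\<close> is at most \<open>x\<close> and at most \<open>n / x\<close>, both size
    conditions on an annulus follow.\<close>
  define T where "T = nat \<lfloor>log 2 (X / 1024)\<rfloor> + 1"
  define m0 where "m0 = nat \<lceil>x\<rceil>"
  define E where "E s = {e\<in>low_edges k. e \<subseteq> annulus (m0 * 2 ^ s)}" for s
  have x1: "1024 \<le> x" using X by linarith
  have lg: "0 \<le> log 2 (X / 1024)" using X by simp
  have m0: "x \<le> real m0" "real m0 \<le> 2 * x" unfolding m0_def using x1 by linarith+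
  have E: "x\<^sup>2 / 1024 \<le> real (card (E s))" if "s < T" for s
    unfolding E_def
  proof (rule low_edges_annulus_real[OF n x])
    show "16 \<le> x" using x1 by simp
    have "real s \<le> log 2 (X / 1024)" using that lg unfolding T_def by linarith
    then have "2 powr real s \<le> X / 1024" using X by (simp add: le_log_iff)
    then have p: "2 ^ s \<le> X / 1024" by (simp add: powr_realpow)
    have "x * 1 \<le> real m0 * 2 ^ s" using m0 x1 by (intro mult_mono) auto
    then show "x \<le> real (m0 * 2 ^ s)" by simp
    have up: "real (m0 * 2 ^ s) \<le> 2 * x * (X / 1024)"
      unfolding of_nat_mult of_nat_power using m0 p x1 by (intro mult_mono) auto
    have "x * X \<le> x * x" using X x1 by (intro mult_left_mono) auto
    then show "512 * real (m0 * 2 ^ s) \<le> x\<^sup>2" using up by (simp add: power2_eq_square mult.commute)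
    have "x * X \<le> real n" using X(3) x1 by (simp add: field_simps)
    then have "real (2 * (m0 * 2 ^ s)) \<le> real n" using up by (simp add: mult.commute[of x X])
    then show "2 * (m0 * 2 ^ s) \<le> n" by linarith
  qed
  have dis: "E s \<inter> E s' = {}" if "s \<noteq> s'" for s s'
  proof -
    have "annulus (m0 * 2 ^ s) \<inter> annulus (m0 * 2 ^ s') = {}"
      using that annulus_disjoint[of s s' m0] annulus_disjoint[of s' s m0] by (cases s s' rule: linorder_cases) auto
    moreover have "e \<noteq> {}" if "e \<in> low_edges k" for e
      using that by (auto simp: low_edges_def K_edges_def)
    ultimately show ?thesis unfolding E_def by blast
  qed
  have finE: "finite (E s)" for s using finite_low_edges by (simp add: E_def)
  have "real T * (x\<^sup>2 / 1024) \<le> (\<Sum>s<T. real (card (E s)))"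
    using E sum_bounded_below[of "{..<T}" "x\<^sup>2 / 1024" "\<lambda>s. real (card (E s))"] by simp
  also have "\<dots> = real (card (\<Union>s<T. E s))"
    using finE dis by (subst card_UN_disjoint) auto
  also have "\<dots> \<le> real (card (low_edges k))"
    using finite_low_edges by (intro of_nat_mono card_mono) (auto simp: E_def)
  finally have "real T * (x\<^sup>2 / 1024) \<le> card (low_edges k)" .
  moreover have "log 2 (X / 1024) \<le> real T" unfolding T_def using lg by linarith
  ultimately show ?thesis
    by (meson divide_nonneg_pos mult_right_mono order_trans zero_le_power2 zero_less_numeral)
qed

text \<open>Up to \<open>X = 2 ^ 20\<close> the logarithm is at most 20, and the quadratic bound
  suffices. Beyond it the binary logarithm of \<open>X\<close> is at least 20, so subtracting 10 for
  the division by 1024 loses at most half.\<close>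

lemma low_edges_lower:
  assumes n: "3 \<le> n" and k: "n \<le> k" "k \<le> n choose 2" and x: "x = real k / real n"
  shows "x\<^sup>2 / 2048 * max 1 (ln (min x (real n / x))) \<le> card (low_edges k)"
proof -
  define X where "X = min x (real n / x)"
  have q: "x\<^sup>2 / 16 \<le> card (low_edges k)" using low_edges_quadratic[OF n k] x by simp
  have x1: "1 \<le> x" using x k n by simp
  have X0: "0 < X" using x1 n by (simp add: X_def)
  show ?thesis
  proof (cases "X \<le> 2 ^ 20")
    case True
    have "ln X \<le> ln (2 ^ 20)" using True X0 by (subst ln_le_cancel_iff) auto
    also have "\<dots> = 20 * ln 2" using ln_realpow[of 2 20] by simp
    also have "\<dots> \<le> 20" using ln_2_less_1 by simp
    finally have "max 1 (ln X) \<le> 20" by simp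
    then have "x\<^sup>2 / 2048 * max 1 (ln X) \<le> x\<^sup>2 / 2048 * 20" by (intro mult_left_mono) auto
    also have "\<dots> \<le> x\<^sup>2 / 16" by simp
    finally show ?thesis using q unfolding X_def by linarith
  next
    case False
    then have X: "2 ^ 20 < X" by simp
    have "ln (2 ^ 20) \<le> ln X" using X X0 by (subst ln_le_cancel_iff) auto
    then have lnX: "20 * ln 2 \<le> ln X" using ln_realpow[of 2 20] by simp
    have l2: "0 < ln (2::real)" "ln (2::real) < 1" using ln_2_less_1 by auto
    have l1: "1 \<le> ln X" using lnX ln2_ge_two_thirds by linarith
    have "ln (1024::real) = 10 * ln 2" using ln_realpow[of 2 10] by simp
    then have lg: "log 2 (X / 1024) = ln X / ln 2 - 10"
      using X0 by (simp add: log_def ln_div diff_divide_distrib)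
    have "20 \<le> ln X / ln 2" using lnX l2 by (simp add: field_simps)
    moreover have "ln X \<le> ln X / ln 2" using l1 l2 by (simp add: field_simps)
    ultimately have "ln X / 2 \<le> log 2 (X / 1024)" unfolding lg by linarith
    then have "ln X / 2 * (x\<^sup>2 / 1024) \<le> log 2 (X / 1024) * (x\<^sup>2 / 1024)" by (intro mult_right_mono) auto
    also have "\<dots> \<le> card (low_edges k)"
      using X by (intro low_edges_dyadic[OF n x]) (auto simp: X_def)
    finally show ?thesis unfolding X_def[symmetric] using l1 by (simp add: max_def mult.commute)
  qed
qed

end

context drawing
begin

lemma S_pos:
  assumes "2 \<le> n"
  shows "1 \<le> S k (K_edges n) p"
proof -
  obtain c where "inj_on (\<lambda>v. (p v)$1 + c * (p v)$2) {..<n}" using generic_height by blast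
  then interpret drawing_height n p c by unfold_locales
  show ?thesis using low_edges_pos[OF assms, of k] by (simp add: S_eq low_edges_def)
qed

lemma S_lower:
  assumes n: "3 \<le> n" and k: "n \<le> k" "k \<le> n choose 2" and x: "x = real k / real n"
  shows "x\<^sup>2 / 2048 * max 1 (ln (min x (real n / x))) \<le> S k (K_edges n) p"
proof -
  obtain c where "inj_on (\<lambda>v. (p v)$1 + c * (p v)$2) {..<n}" using generic_height by blast
  then interpret drawing_height n p c by unfold_locales
  show ?thesis using low_edges_lower[OF assms] by (simp add: S_eq low_edges_def)
qed

end

section \<open>Generic drawings\<close>

lemma negligible_line:
  assumes "a \<noteq> b"
  shows "negligible {z. orient a b z = 0}"
proof -
  define v :: "real^2" where "v = vector [- (b$2 - a$2), b$1 - a$1]"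
  have v: "v$1 = - (b$2 - a$2)" "v$2 = b$1 - a$1" by (simp_all add: v_def)
  have "v \<noteq> 0" using assms v by (auto simp: vec2_eq_iff)
  have "{z. orient a b z = 0} = {z. v \<bullet> z = v \<bullet> a}"
    by (auto simp: orient_coord inner_vec_def sum_2 v algebra_simps)
  then show ?thesis using negligible_hyperplane[of v "v \<bullet> a"] \<open>v \<noteq> 0\<close> by simp
qed

text \<open>Finitely many points and lines have measure zero, whereas a ball has not.\<close>

lemma avoid_lines:
  assumes "finite F" "0 < \<epsilon>"
  shows "\<exists>z. dist z q < \<epsilon> \<and> z \<notin> F \<and> (\<forall>a\<in>F. \<forall>b\<in>F. a \<noteq> b \<longrightarrow> orient a b z \<noteq> 0)"
proof -
  define N where "N = F \<union> (\<Union>a\<in>F. \<Union>b\<in>F - {a}. {z. orient a b z = 0})"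
  have "negligible (\<Union>b\<in>F - {a}. {z. orient a b z = 0})" for a
  proof (rule negligible_Union)
    show "finite ((\<lambda>b. {z. orient a b z = 0}) ` (F - {a}))" using assms(1) by simp
    show "negligible t" if t: "t \<in> (\<lambda>b. {z. orient a b z = 0}) ` (F - {a})" for t
    proof -
      obtain b where "t = {z. orient a b z = 0}" "b \<noteq> a" using t by blast
      then show ?thesis using negligible_line[of a b] by simp
    qed
  qed
  then have "negligible (\<Union>a\<in>F. \<Union>b\<in>F - {a}. {z. orient a b z = 0})"
    using assms(1) by (intro negligible_Union finite_imageI) blast+
  then have "negligible N"
    unfolding N_def using negligible_finite[OF assms(1)] by (intro negligible_Un)
  moreover have "\<not> negligible (ball q \<epsilon>)"
    using assms(2) by (intro open_not_negligible) auto
  ultimately obtain z where "z \<in> ball q \<epsilon>" "z \<notin> N"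
    using negligible_subset by blast
  then show ?thesis
    by (intro exI[of _ z]) (auto simp: N_def dist_commute)
qed

lemma (in drawing) finite_crossings: "finite (crossings (K_edges n) p)"
proof -
  have "finite (edge_interior p e \<inter> edge_interior p f)" if "e \<in> K_edges n" "f \<in> K_edges n" "e \<noteq> f" for e f
  proof (cases "edge_interior p e \<inter> edge_interior p f = {}")
    case False
    then obtain z where z: "z \<in> edge_interior p e" "z \<in> edge_interior p f" by auto
    have "edge_interior p e \<inter> edge_interior p f \<subseteq> {z}"
      using crossing_point_unique[OF that _ _ z] by auto
    then show ?thesis using finite_subset by blast
  qed simp
  then have "finite (\<Union>e\<in>K_edges n. \<Union>f\<in>K_edges n - {e}. edge_interior p e \<inter> edge_interior p f)"
    by (intro finite_UN_I finite_K_edges finite_Diff) blast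
  moreover have "crossings (K_edges n) p = (\<Union>e\<in>K_edges n. \<Union>f\<in>K_edges n - {e}. edge_interior p e \<inter> edge_interior p f)"
    unfolding crossings_def by blast
  ultimately show ?thesis by simp
qed

lemma orient_cyclic: "orient b c a = orient a b c"
  by (simp add: orient_coord algebra_simps)

lemma orient_swap: "orient b a c = - orient a b c"
  by (simp add: orient_coord algebra_simps)

lemma orient_open_segment: "x \<in> open_segment a b \<Longrightarrow> orient a b x = 0"
  by (auto simp: in_segment orient_affine) (simp add: orient_coord)

lemma edge_interior_fun_upd: "v \<notin> e \<Longrightarrow> edge_interior (p(v := z)) e = edge_interior p e"
  unfolding edge_interior_def by (intro arg_cong2[where f=minus] arg_cong2[where f="(hull)"] refl image_cong) auto

text \<open>The set \<open>F\<close> of old vertices and old crossings spans finitely many lines,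
  and \<open>z\<close> avoids them. So no collinear triple arises, two new edges share only their
  end \<open>z\<close>, and a new edge through an old crossing would place \<open>z\<close> on a
  line spanned by that crossing and a vertex.\<close>

lemma generic_extension:
  assumes "drawing n p" "0 < \<epsilon>"
  shows "\<exists>z. dist z q < \<epsilon> \<and> drawing (Suc n) (p(n := z))"
proof -
  interpret drawing n p by fact
  define F where "F = p ` {..<n} \<union> crossings (K_edges n) p"
  have "finite F" using finite_crossings by (simp add: F_def)
  then obtain z where z: "dist z q < \<epsilon>" "z \<notin> F" and off: "\<And>a b. a \<in> F \<Longrightarrow> b \<in> F \<Longrightarrow> a \<noteq> b \<Longrightarrow> orient a b z \<noteq> 0"
    using avoid_lines[OF _ assms(2)] by metis
  define p' where "p' = p(n := z)"
  have p': "p' n = z" "\<And>i. i < n \<Longrightarrow> p' i = p i" by (auto simp: p'_def)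
  have pF: "p i \<in> F" if "i < n" for i using that by (simp add: F_def)
  have old: "e \<in> K_edges n \<and> edge_interior p' e = edge_interior p e" if "e \<in> K_edges (Suc n)" "n \<notin> e" for e
    using that unfolding p'_def by (auto simp: K_edges_def K_verts_def edge_interior_fun_upd less_Suc_eq)
  have new: "\<exists>i<n. e = {n, i}" if e: "e \<in> K_edges (Suc n)" "n \<in> e" for e
  proof -
    obtain a b where "e = {a, b}" "a \<noteq> b" "a < Suc n" "b < Suc n" using e(1) by (rule K_edgesE)
    then show ?thesis using e(2) by (auto simp: less_Suc_eq)
  qed
  have two_new: "edge_interior p' e \<inter> edge_interior p' f = {}"
    if ef: "e \<in> K_edges (Suc n)" "n \<in> e" "f \<in> K_edges (Suc n)" "n \<in> f" "e \<noteq> f" for e f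
  proof (rule ccontr)
    assume "edge_interior p' e \<inter> edge_interior p' f \<noteq> {}"
    then obtain x where x: "x \<in> edge_interior p' e" "x \<in> edge_interior p' f" by auto
    obtain i j where ij: "i < n" "e = {n, i}" "j < n" "f = {n, j}" using new ef by metis
    have seg: "x \<in> open_segment z (p i)" "x \<in> open_segment z (p j)"
      using x ij by (auto simp: edge_interior_eq_open_segment p')
    then have "x \<noteq> z" by (auto simp: open_segment_def)
    then have "orient z (p i) (p j) = 0"
      using orient_common_line[OF seg[THEN orient_open_segment]] by blast
    moreover have "p i \<noteq> p j" using ij ef(5) p_inj by auto
    ultimately show False using off[OF pF pF] ij orient_cyclic[of "p i" "p j" z] by auto
  qed
  have one_new: "edge_interior p' e \<inter> edge_interior p' f \<inter> edge_interior p' g = {}"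
    if ef: "e \<in> K_edges (Suc n)" "n \<notin> e" "f \<in> K_edges (Suc n)" "n \<notin> f" "e \<noteq> f"
      and g: "g \<in> K_edges (Suc n)" "n \<in> g" for e f g
  proof (rule ccontr)
    assume "edge_interior p' e \<inter> edge_interior p' f \<inter> edge_interior p' g \<noteq> {}"
    then obtain x where x: "x \<in> edge_interior p' e" "x \<in> edge_interior p' f" "x \<in> edge_interior p' g" by auto
    then have "x \<in> crossings (K_edges n) p" using old ef unfolding crossings_def by blast
    then have "x \<in> F" by (simp add: F_def)
    obtain i where i: "i < n" "g = {n, i}" using new g by metis
    have seg: "x \<in> open_segment z (p i)" using x(3) i by (simp add: edge_interior_eq_open_segment p')
    then have "x \<noteq> p i" by (auto simp: open_segment_def)
    then have "orient (p i) x z \<noteq> 0" using off[OF pF[OF i(1)] \<open>x \<in> F\<close>] by auto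
    then show False using orient_open_segment[OF seg] orient_cyclic[of "p i" x z] by simp
  qed
  have "drawing (Suc n) p'"
  proof
    show "rectilinear_drawing (K_verts (Suc n)) (K_edges (Suc n)) p'"
      unfolding rectilinear_drawing_def
    proof (intro conjI ballI impI)
      have "z \<noteq> p i" "p i \<noteq> z" if "i < n" for i using z(2) pF[OF that] by auto
      then show "inj_on p' (K_verts (Suc n))"
        using p_inj by (auto simp: inj_on_def K_verts_def less_Suc_eq p')
      show "general_position (p' ` K_verts (Suc n))"
        unfolding general_position_def
      proof (intro allI impI)
        fix T assume T: "T \<subseteq> p' ` K_verts (Suc n)" "card T = 3"
        have sub: "p' ` K_verts (Suc n) \<subseteq> insert z (p ` {..<n})"
          by (auto simp: K_verts_def p' less_Suc_eq)
        show "\<not> collinear T"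
        proof (cases "z \<in> T")
          case False
          then have "T \<subseteq> p ` K_verts n" using T(1) sub unfolding K_verts_def by blast
          then show ?thesis using draw T(2) by (auto simp: rectilinear_drawing_def general_position_def)
        next
          case True
          then have "card (T - {z}) = 2" using T(2) by (simp add: card_Diff_singleton)
          then obtain a b where ab: "T - {z} = {a, b}" "a \<noteq> b" by (rule card2_obtain)
          then have "a \<in> F" "b \<in> F" using T(1) sub unfolding F_def by blast+
          then have "orient a b z \<noteq> 0" using off ab(2) by blast
          moreover have "T = {a, b, z}" using ab True by auto
          ultimately show ?thesis by (simp add: collinear_iff_orient)
        qed
      qed
      fix e f g assume efg: "e \<in> K_edges (Suc n)" "f \<in> K_edges (Suc n)" "g \<in> K_edges (Suc n)"
        "e \<noteq> f \<and> f \<noteq> g \<and> e \<noteq> g"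
      show "edge_interior p' e \<inter> edge_interior p' f \<inter> edge_interior p' g = {}"
      proof -
        consider "n \<in> e" "n \<in> f" | "n \<in> f" "n \<in> g" | "n \<in> e" "n \<in> g" | "n \<notin> e" "n \<notin> f" "n \<notin> g"
          | "n \<notin> e" "n \<notin> f" "n \<in> g" | "n \<notin> e" "n \<in> f" "n \<notin> g" | "n \<in> e" "n \<notin> f" "n \<notin> g"
          by blast
        then show ?thesis
        proof cases
          case 1
          then have "edge_interior p' e \<inter> edge_interior p' f = {}" using two_new efg by simp
          then show ?thesis by blast
        next
          case 2
          then have "edge_interior p' f \<inter> edge_interior p' g = {}" using two_new efg by simp
          then show ?thesis by blast
        next
          case 3
          then have "edge_interior p' e \<inter> edge_interior p' g = {}" using two_new efg by simp
          then show ?thesis by blast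
        next
          case 4
          then show ?thesis using old efg no_triple[of e f g] by simp
        next
          case 5
          then show ?thesis using one_new[of e f g] efg by simp
        next
          case 6
          then have "edge_interior p' e \<inter> edge_interior p' g \<inter> edge_interior p' f = {}"
            using one_new[of e g f] efg by simp
          then show ?thesis by blast
        next
          case 7
          then have "edge_interior p' f \<inter> edge_interior p' g \<inter> edge_interior p' e = {}"
            using one_new[of f g e] efg by simp
          then show ?thesis by blast
        qed
      qed
    qed
  qed
  then show ?thesis using z(1) unfolding p'_def by blast
qed

lemma generic_drawing:
  assumes "0 < \<epsilon>"
  shows "\<exists>p. drawing n p \<and> (\<forall>i<n. dist (p i) (q i) < \<epsilon>)"
proof (induction n)
  case 0
  have "drawing 0 q"
    by unfold_locales (auto simp: rectilinear_drawing_def K_verts_def K_edges_def general_position_def)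
  then show ?case by auto
next
  case (Suc n)
  then obtain p where p: "drawing n p" "\<forall>i<n. dist (p i) (q i) < \<epsilon>" by auto
  obtain z where "dist z (q n) < \<epsilon>" "drawing (Suc n) (p(n := z))"
    using generic_extension[OF p(1) assms] by metis
  moreover from this have "\<forall>i<Suc n. dist ((p(n := z)) i) (q i) < \<epsilon>" using p(2) by (simp add: less_Suc_eq)
  ultimately show ?case by blast
qed

section \<open>Six infinitesimal arms at the corners of a hexagon\<close>

text \<open>The perturbation into general position has size below
  \<open>(\<delta> m)\<^sup>2\<close>. After magnifying a cluster by \<open>1 / \<delta> m\<close>
  it still tends to 0, so the prescribed local shape \<open>W\<close> is the limit.\<close>

lemma clustered_drawings:
  fixes C W :: "nat \<Rightarrow> real^2"
  obtains p w :: "nat \<Rightarrow> nat \<Rightarrow> real^2" and \<delta> :: "nat \<Rightarrow> real"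
  where "\<And>m. drawing n (p m)" "\<And>m. 0 < \<delta> m" "\<delta> \<longlonglongrightarrow> 0"
    "\<And>m t. p m t = C t + \<delta> m *\<^sub>R w m t" "\<And>t. t < n \<Longrightarrow> (\<lambda>m. w m t) \<longlonglongrightarrow> W t"
proof -
  define \<delta> where "\<delta> m = inverse (real (Suc m))" for m
  have \<delta>0: "0 < \<delta> m" for m by (simp add: \<delta>_def)
  have lim: "\<delta> \<longlonglongrightarrow> 0" unfolding \<delta>_def by (rule LIMSEQ_inverse_real_of_nat)
  have "\<exists>q. drawing n q \<and> (\<forall>t<n. dist (q t) (C t + \<delta> m *\<^sub>R W t) < (\<delta> m)\<^sup>2)" for m
    using \<delta>0[of m] by (intro generic_drawing) simp
  then obtain p where p: "\<And>m. drawing n (p m)"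
      "\<And>m t. t < n \<Longrightarrow> dist (p m t) (C t + \<delta> m *\<^sub>R W t) < (\<delta> m)\<^sup>2" by metis
  define w where "w m t = (1 / \<delta> m) *\<^sub>R (p m t - C t)" for m t
  have pw: "p m t = C t + \<delta> m *\<^sub>R w m t" for m t
    using \<delta>0[of m] by (simp add: w_def)
  have "(\<lambda>m. w m t) \<longlonglongrightarrow> W t" if "t < n" for t
  proof -
    have "norm (w m t - W t) \<le> \<delta> m" for m
    proof -
      have "\<delta> m * norm (w m t - W t) = norm (\<delta> m *\<^sub>R (w m t - W t))" using \<delta>0[of m] by simp
      also have "\<dots> = dist (p m t) (C t + \<delta> m *\<^sub>R W t)"
        by (simp add: pw dist_norm algebra_simps)
      also have "\<dots> \<le> \<delta> m * \<delta> m" using p(2)[OF that, of m] by (simp add: power2_eq_square)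
      finally show ?thesis using \<delta>0[of m] by simp
    qed
    then have "\<forall>\<^sub>F m in sequentially. norm (w m t - W t) \<le> \<delta> m" by simp
    then have "(\<lambda>m. w m t - W t) \<longlonglongrightarrow> 0"
      using lim by (rule Lim_null_comparison)
    then show ?thesis by (simp add: LIM_zero_iff)
  qed
  then show ?thesis using that[OF p(1) \<delta>0 lim pw] by blast
qed

lemma tendsto_cross2: "(f \<longlongrightarrow> v) F \<Longrightarrow> (g \<longlongrightarrow> w) F \<Longrightarrow> ((\<lambda>m. cross2 (f m) (g m)) \<longlongrightarrow> cross2 v w) F"
  unfolding cross2_def by (intro tendsto_intros)

lemma orient_scale: "orient (z + d *\<^sub>R a) (z + d *\<^sub>R b) (z + d *\<^sub>R c) = d\<^sup>2 * orient a b c"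
  by (simp add: orient_coord power2_eq_square algebra_simps)

text \<open>A linear map of order six and determinant 1, conjugate to the rotation by 60 degrees.
  The orbit of (1, 0) is an affinely regular hexagon with integer coordinates, and orientations are
  invariant under the map.\<close>

definition rot :: "real^2 \<Rightarrow> real^2" where
  "rot v = vector [v$1 - v$2, v$1]"

lemma rot_coord [simp]: "rot v $ 1 = v$1 - v$2" "rot v $ 2 = v$1"
  by (simp_all add: rot_def)

lemma cross2_rot: "cross2 ((rot ^^ k) v) ((rot ^^ k) w) = cross2 v w"
  by (induction k) (simp_all add: cross2_def algebra_simps)

lemma rot_diff: "(rot ^^ k) (v - w) = (rot ^^ k) v - (rot ^^ k) w"
  by (induction k) (simp_all add: vec2_eq_iff)

lemma rot6: "(rot ^^ 6) = id"
  by (rule ext) (simp add: numeral_eq_Suc vec2_eq_iff)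

lemma rot_mod: "(rot ^^ (k mod 6)) = (rot ^^ k)"
proof -
  have "(rot ^^ (6 * j)) = id" for j
    by (induction j) (simp_all only: mult_0_right mult_Suc_right funpow_add rot6, simp_all)
  then have "(rot ^^ (6 * (k div 6) + k mod 6)) = (rot ^^ (k mod 6))" by (simp only: funpow_add id_o)
  then show ?thesis by simp
qed

lemma orient_rot: "orient ((rot ^^ k) a) ((rot ^^ k) b) ((rot ^^ k) c) = orient a b c"
  by (simp add: orient_def cross2_rot flip: rot_diff)

definition corner :: "nat \<Rightarrow> real^2" where
  "corner j = (rot ^^ j) (vector [1, 0])"

lemma corner_values:
  "corner 0 = vector [1, 0]" "corner 1 = vector [1, 1]" "corner 2 = vector [0, 1]"
  "corner 3 = vector [-1, 0]" "corner 4 = vector [-1, -1]" "corner 5 = vector [0, -1]"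
  by (simp_all add: corner_def numeral_eq_Suc vec2_eq_iff)

lemma corner_add: "corner (j + i) = (rot ^^ j) (corner i)"
  by (simp add: corner_def funpow_add)

lemma corner_mod: "corner (k mod 6) = corner k"
  by (simp add: corner_def rot_mod)

text \<open>
  Vertex \<open>t\<close> lies in arm \<open>t mod 6\<close>, whose local frame \<open>(-1, 1), (-2, -1)\<close> points from its
  corner to the second and the fourth next corners.
\<close>

definition local_pos :: "(nat \<Rightarrow> nat \<times> nat) \<Rightarrow> nat \<Rightarrow> real^2" where
  "local_pos loc i = vector [- real (fst (loc i)) - 2 * real (snd (loc i)), real (fst (loc i)) - real (snd (loc i))]"

text \<open>The cross product of a local position with the direction to the \<open>j\<close>-th next
  corner: it measures the position transverse to the edges that lead there. The last branch serves
  \<open>j = 5\<close>.\<close>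

definition slope_form :: "nat \<Rightarrow> nat \<times> nat \<Rightarrow> real" where
  "slope_form j uv = (case uv of (u, v) \<Rightarrow>
     (if j = 1 then - (real u + 2 * real v) else if j = 2 then - 3 * real v
      else if j = 4 then 3 * real u else 2 * real u + real v))"

lemma slope_form_eq:
  assumes "j \<in> {1, 2, 4, 5}"
  shows "cross2 (local_pos loc i) (corner j - corner 0) = slope_form j (loc i)"
  using assms by (auto simp: slope_form_def local_pos_def corner_values cross2_def split: prod.splits)
    (simp_all add: corner_values corner_values(2)[unfolded One_nat_def])

lemma js: "(1::nat) \<in> {1, 2, 4, 5}" "(5::nat) \<in> {1, 2, 4, 5}" by simp_all

lemma mod6_add: "t mod 6 = (s + i) mod 6 \<Longrightarrow> (t + j) mod 6 = (s + (i + j)) mod (6::nat)"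
  by (metis add.assoc mod_add_left_eq)

section \<open>Orientations in the limit of vanishing arms, and the crossings that they
  force\<close>

locale hex_family =
  fixes n :: nat and loc :: "nat \<Rightarrow> nat \<times> nat"
    and p w :: "nat \<Rightarrow> nat \<Rightarrow> real^2" and \<delta> :: "nat \<Rightarrow> real"
  assumes \<delta>: "\<And>m. 0 < \<delta> m" "\<delta> \<longlonglongrightarrow> 0"
    and pw: "\<And>m t. p m t = corner (t mod 6) + \<delta> m *\<^sub>R w m t"
    and wlim: "\<And>t. t < n \<Longrightarrow> (\<lambda>m. w m t) \<longlonglongrightarrow> (rot ^^ (t mod 6)) (local_pos loc (t div 6))"
begin

abbreviation g where "g j t \<equiv> slope_form j (loc (t div 6))"

abbreviation orient_lim where
  "orient_lim s t x d l \<equiv> (\<lambda>m. orient (p m s) (p m t) (p m x) / d m) \<longlonglongrightarrow> l"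

lemma \<delta>_sq: "0 < (\<delta> m)\<^sup>2"
  using \<delta>(1)[of m] by (rule zero_less_power)

lemma p_lim: "t < n \<Longrightarrow> (\<lambda>m. p m t) \<longlonglongrightarrow> corner t"
  unfolding pw corner_mod
  using tendsto_add[OF tendsto_const tendsto_scaleR[OF \<delta>(2) wlim], of t "corner t"] by simp

lemma orient_three_arms:
  assumes "s < n" "t < n" "x < n"
  shows "(\<lambda>m. orient (p m s) (p m t) (p m x)) \<longlonglongrightarrow> orient (corner s) (corner t) (corner x)"
  unfolding orient_def using assms by (intro tendsto_cross2 tendsto_diff p_lim)

text \<open>The difference of \<open>s\<close> and \<open>t\<close> has order
  \<open>\<delta>\<close> while that of \<open>x\<close> and \<open>s\<close> tends to a difference
  of corners. Dividing by \<open>\<delta>\<close> leaves a difference of two values of the form for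
  direction \<open>j\<close>.\<close>

lemma orient_two_arms:
  assumes st: "s < n" "t < n" "x < n" and "s mod 6 = t mod 6" "x mod 6 = (s + j) mod 6" and j: "j \<in> {1, 2, 4, 5}"
  shows "orient_lim s t x \<delta> (g j t - g j s)"
proof -
  define \<alpha> where "\<alpha> = s mod 6"
  have "orient (p m s) (p m t) (p m x) / \<delta> m = cross2 (w m t - w m s) (p m x - p m s)" for m
    using \<delta>(1)[of m] assms(4) by (simp add: orient_def pw cross2_def field_simps)
  moreover have "(\<lambda>m. cross2 (w m t - w m s) (p m x - p m s)) \<longlonglongrightarrow>
      cross2 ((rot ^^ \<alpha>) (local_pos loc (t div 6)) - (rot ^^ \<alpha>) (local_pos loc (s div 6))) (corner x - corner s)"
    using wlim[of s] wlim[of t] st assms(4) unfolding \<alpha>_def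
    by (intro tendsto_cross2 tendsto_diff p_lim) simp_all
  moreover have "corner x - corner s = (rot ^^ \<alpha>) (corner j - corner 0)"
  proof -
    have "corner x = corner (\<alpha> + j)"
      using corner_mod[of x] corner_mod[of "\<alpha> + j"] assms(5) unfolding \<alpha>_def by (simp add: mod_simps)
    moreover have "corner s = corner (\<alpha> + 0)" using corner_mod[of s] by (simp add: \<alpha>_def)
    ultimately show ?thesis by (simp only: corner_add rot_diff)
  qed
  moreover have "cross2 (local_pos loc (t div 6) - local_pos loc (s div 6)) (corner j - corner 0) = g j t - g j s"
    unfolding slope_form_eq[OF j, symmetric] by (simp add: cross2_def algebra_simps)
  ultimately show ?thesis by (simp add: cross2_rot flip: rot_diff)
qed

lemma orient_one_arm:
  assumes "s < n" "t < n" "x < n" "s mod 6 = t mod 6" "s mod 6 = x mod 6"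
  shows "orient_lim s t x (\<lambda>m. (\<delta> m)\<^sup>2) (orient (local_pos loc (s div 6)) (local_pos loc (t div 6)) (local_pos loc (x div 6)))"
proof -
  have "orient (p m s) (p m t) (p m x) / (\<delta> m)\<^sup>2 = orient (w m s) (w m t) (w m x)" for m
    using \<delta>(1)[of m] assms(4,5) by (simp add: pw orient_scale)
  moreover have "(\<lambda>m. orient (w m s) (w m t) (w m x)) \<longlonglongrightarrow>
     orient ((rot ^^ (s mod 6)) (local_pos loc (s div 6))) ((rot ^^ (s mod 6)) (local_pos loc (t div 6)))
       ((rot ^^ (s mod 6)) (local_pos loc (x div 6)))"
    using wlim[of s] wlim[of t] wlim[of x] assms unfolding orient_def
    by (intro tendsto_cross2 tendsto_diff) simp_all
  ultimately show ?thesis by (simp add: orient_rot)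
qed

definition cross_ev :: "nat \<Rightarrow> nat \<Rightarrow> nat \<Rightarrow> nat \<Rightarrow> bool" where
  "cross_ev s t h y \<longleftrightarrow> (\<forall>\<^sub>F m in sequentially. open_segment (p m s) (p m t) \<inter> open_segment (p m h) (p m y) \<noteq> {})"

text \<open>The four orientations may have the different orders 1, \<open>\<delta>\<close> and
  \<open>\<delta>\<^sup>2\<close>. Each is normalised by its own positive scale, which does not
  affect the signs that decide a crossing.\<close>

lemma cross_evI:
  assumes 1: "orient_lim s t h d1 l1" and 2: "orient_lim s t y d2 l2"
    and 3: "orient_lim h y s d3 l3" and 4: "orient_lim h y t d4 l4"
    and d: "\<And>m. 0 < d1 m" "\<And>m. 0 < d2 m" "\<And>m. 0 < d3 m" "\<And>m. 0 < d4 m"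
    and neg: "l1 * l2 < 0" "l3 * l4 < 0"
  shows "cross_ev s t h y"
proof -
  have "\<forall>\<^sub>F m in sequentially. orient (p m s) (p m t) (p m h) / d1 m * (orient (p m s) (p m t) (p m y) / d2 m) < 0"
    using order_tendstoD(2)[OF tendsto_mult[OF 1 2] neg(1)] .
  moreover have "\<forall>\<^sub>F m in sequentially. orient (p m h) (p m y) (p m s) / d3 m * (orient (p m h) (p m y) (p m t) / d4 m) < 0"
    using order_tendstoD(2)[OF tendsto_mult[OF 3 4] neg(2)] .
  ultimately show ?thesis
    unfolding cross_ev_def
  proof eventually_elim
    case (elim m)
    have "orient (p m s) (p m t) (p m h) * orient (p m s) (p m t) (p m y) < 0"
      using elim(1) d(1,2)[of m] by (simp add: divide_less_0_iff mult_less_0_iff zero_less_mult_iff)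
    moreover have "orient (p m h) (p m y) (p m s) * orient (p m h) (p m y) (p m t) < 0"
      using elim(2) d(3,4)[of m] by (simp add: divide_less_0_iff mult_less_0_iff zero_less_mult_iff)
    ultimately show ?case by (rule proper_crossing)
  qed
qed

lemma orient_cyc1: "orient_lim t x s d l \<Longrightarrow> orient_lim s t x d l"
  by (simp add: orient_cyclic)

lemma orient_cyc2: "orient_lim x s t d l \<Longrightarrow> orient_lim s t x d l"
  by (simp add: orient_cyclic)

text \<open>By \<open>between\<close>, the edge from \<open>h\<close>, which has almost the
  direction \<open>j\<close>, separates \<open>s\<close> from \<open>t\<close>. By
  \<open>behind\<close>, the line of \<open>s\<close> and \<open>t\<close> separates
  \<open>h\<close> from \<open>y\<close>, since \<open>y\<close> lies on the side given by the sign
  of \<open>g j t - g j s\<close>.\<close>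

lemma cross_same_arm:
  assumes lt: "s < n" "t < n" "h < n" "y < n"
    and arm: "t mod 6 = s mod 6" "h mod 6 = s mod 6" "y mod 6 = (s + j) mod 6" and j: "j \<in> {1, 2, 4, 5}"
    and between: "(g j h - g j s) * (g j h - g j t) < 0"
    and behind: "orient (local_pos loc (s div 6)) (local_pos loc (t div 6)) (local_pos loc (h div 6)) * (g j t - g j s) < 0"
  shows "cross_ev s t h y"
proof (rule cross_evI)
  have m: "y mod 6 = (h + j) mod 6" "y mod 6 = (t + j) mod 6" using arm by (metis mod_add_left_eq)+
  have th: "t mod 6 = h mod 6" using arm by simp
  show "orient_lim s t h (\<lambda>m. (\<delta> m)\<^sup>2) (orient (local_pos loc (s div 6)) (local_pos loc (t div 6)) (local_pos loc (h div 6)))"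
    by (rule orient_one_arm; rule lt arm arm[symmetric])
  show "orient_lim s t y \<delta> (g j t - g j s)"
    by (rule orient_two_arms; rule lt arm m arm[symmetric] th j)
  show "orient_lim h y s \<delta> (g j h - g j s)"
    by (rule orient_cyc2, rule orient_two_arms; rule lt arm m arm[symmetric] th j)
  show "orient_lim h y t \<delta> (g j h - g j t)"
    by (rule orient_cyc2, rule orient_two_arms; rule lt arm m arm[symmetric] th j)
qed (rule behind between \<delta>(1) \<delta>_sq)+

text \<open>Both edges join the same two adjacent arms and coincide in the limit. They cross when
  \<open>h\<close> and \<open>y\<close> lie on opposite sides of the first edge, which is read off
  from direction 1 at one arm and from direction 5, looking back, at the other.\<close>

lemma cross_parallel:
  assumes lt: "s < n" "t < n" "h < n" "y < n"
    and arm: "t mod 6 = (s + 1) mod 6" "h mod 6 = s mod 6" "y mod 6 = (s + 1) mod 6"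
    and opp: "(g 1 s - g 1 h) * (g 5 y - g 5 t) < 0"
  shows "cross_ev s t h y"
proof (rule cross_evI)
  have hs: "(h + 1) mod 6 = (s + 1) mod 6" using mod_add_cong[OF arm(2) refl] .
  have m: "t mod 6 = (h + 1) mod 6" "y mod 6 = (h + 1) mod 6" "s mod 6 = (t + 5) mod 6"
    "h mod 6 = (y + 5) mod 6" "t mod 6 = y mod 6" "y mod 6 = t mod 6"
    using arm hs mod6_add[OF arm(1), of 5] mod6_add[OF arm(3), of 5] by simp_all
  show "orient_lim s t h \<delta> (g 1 s - g 1 h)"
    by (rule orient_cyc2, rule orient_two_arms; rule lt arm m arm[symmetric] js)
  show "orient_lim s t y \<delta> (g 5 y - g 5 t)"
    by (rule orient_cyc1, rule orient_two_arms; rule lt arm m arm[symmetric] js)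
  show "orient_lim h y s \<delta> (g 1 h - g 1 s)"
    by (rule orient_cyc2, rule orient_two_arms; rule lt arm m arm[symmetric] js)
  show "orient_lim h y t \<delta> (g 5 t - g 5 y)"
    by (rule orient_cyc1, rule orient_two_arms; rule lt arm m arm[symmetric] js)
  show "(g 1 h - g 1 s) * (g 5 t - g 5 y) < 0"
    using opp minus_mult_minus[of "g 1 s - g 1 h" "g 5 y - g 5 t"] by (simp only: minus_diff_eq)
qed (rule opp \<delta>(1))+

lemma orient_corners:
  assumes "s < n" "t < n" "x < n" "t mod 6 = (s + i) mod 6" "x mod 6 = (s + j) mod 6"
  shows "orient_lim s t x (\<lambda>_. 1) (orient (corner 0) (corner i) (corner j))"
proof -
  have "corner t = corner (s + i)" "corner x = corner (s + j)" "corner s = corner (s + 0)"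
    using assms(4,5) by (metis corner_mod, metis corner_mod, simp)
  then have eq: "corner t = (rot ^^ s) (corner i)" "corner x = (rot ^^ s) (corner j)" "corner s = (rot ^^ s) (corner 0)"
    by (simp_all only: corner_add)
  show ?thesis using orient_three_arms[OF assms(1-3)] unfolding eq orient_rot by simp
qed

text \<open>The edges leave a common arm towards the next and the previous corner. The inequalities
  put \<open>h\<close> on the other side of \<open>st\<close> than \<open>y\<close>, and
  \<open>s\<close> on the other side of \<open>hy\<close> than \<open>t\<close>.\<close>

lemma cross_outer:
  assumes lt: "s < n" "t < n" "h < n" "y < n"
    and arm: "t mod 6 = (s + 1) mod 6" "h mod 6 = s mod 6" "y mod 6 = (s + 5) mod 6"
    and gt: "g 1 s < g 1 h" "g 5 s < g 5 h"
  shows "cross_ev s t h y"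
proof (rule cross_evI)
  have m: "t mod 6 = (h + 1) mod 6" "y mod 6 = (h + 5) mod 6"
    by (simp_all only: arm mod_add_cong[OF arm(2) refl])
  show "orient_lim s t h \<delta> (g 1 s - g 1 h)"
    by (rule orient_cyc2, rule orient_two_arms; rule lt arm m arm[symmetric] js)
  show "orient_lim s t y (\<lambda>_. 1) (orient (corner 0) (corner 1) (corner 5))"
    by (rule orient_corners; rule lt arm m)
  show "orient_lim h y s \<delta> (g 5 h - g 5 s)"
    by (rule orient_cyc2, rule orient_two_arms; rule lt arm m arm[symmetric] js)
  show "orient_lim h y t (\<lambda>_. 1) (orient (corner 0) (corner 5) (corner 1))"
    by (rule orient_corners; rule lt arm m)
  show "(g 1 s - g 1 h) * orient (corner 0) (corner 1) (corner 5) < 0"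
    "(g 5 h - g 5 s) * orient (corner 0) (corner 5) (corner 1) < 0"
    using gt unfolding corner_values by (simp_all add: orient_coord)
qed (rule \<delta>(1) zero_less_one)+

lemma cross_outer':
  assumes lt: "s < n" "t < n" "h < n" "y < n"
    and arm: "t mod 6 = (s + 1) mod 6" "h mod 6 = (s + 1) mod 6" "y mod 6 = (s + 2) mod 6"
    and gt: "g 5 h < g 5 t" "g 1 h < g 1 t"
  shows "cross_ev s t h y"
proof (rule cross_evI)
  have m: "s mod 6 = (t + 5) mod 6" "y mod 6 = (t + 1) mod 6" "s mod 6 = (h + 5) mod 6" "y mod 6 = (h + 1) mod 6"
    "t mod 6 = h mod 6"
    using arm mod6_add[OF arm(1), of 5] mod6_add[OF arm(1), of 1] mod6_add[OF arm(2), of 5] mod6_add[OF arm(2), of 1]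
    by (simp_all add: numeral_2_eq_2)
  show "orient_lim s t h \<delta> (g 5 h - g 5 t)"
    by (rule orient_cyc1, rule orient_two_arms; rule lt arm m arm[symmetric] js)
  show "orient_lim s t y (\<lambda>_. 1) (orient (corner 0) (corner 1) (corner 2))"
    by (rule orient_corners; rule lt arm m)
  show "orient_lim h y s (\<lambda>_. 1) (orient (corner 0) (corner 1) (corner 5))"
    by (rule orient_corners; rule lt arm m)
  show "orient_lim h y t \<delta> (g 1 h - g 1 t)"
    by (rule orient_cyc2, rule orient_two_arms; rule lt arm m arm[symmetric] js)
  show "(g 5 h - g 5 t) * orient (corner 0) (corner 1) (corner 2) < 0"
    "orient (corner 0) (corner 1) (corner 5) * (g 1 h - g 1 t) < 0"
    using gt unfolding corner_values by (simp_all add: orient_coord)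
qed (rule \<delta>(1) zero_less_one)+

text \<open>In a convex hexagon the chord from corner 1 to corner 4 crosses those from corner 0 to
  corners 2 and 3, so orientations of order 1 decide, wherever the vertices sit in their
  arms.\<close>

lemma cross_diagonal:
  assumes lt: "s < n" "t < n" "h < n" "y < n"
    and arm: "t mod 6 = (s + 2) mod 6 \<or> t mod 6 = (s + 3) mod 6" "h mod 6 = (s + 1) mod 6" "y mod 6 = (s + 4) mod 6"
  shows "cross_ev s t h y"
proof -
  define i where "i = (if t mod 6 = (s + 2) mod 6 then 2 else 3 :: nat)"
  have i: "t mod 6 = (s + i) mod 6" "i = 2 \<or> i = 3" using arm(1) by (auto simp: i_def)
  have "(h + (i - 1)) mod 6 = (s + (1 + (i - 1))) mod 6" by (rule mod6_add[OF arm(2)])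
  moreover have "1 + (i - 1) = i" using i(2) by auto
  ultimately have m: "y mod 6 = (h + 3) mod 6" "s mod 6 = (h + 5) mod 6" "t mod 6 = (h + (i - 1)) mod 6"
    using arm(3) i(1) mod6_add[OF arm(2), of 5] mod6_add[OF arm(2), of 3] by simp_all
  show ?thesis
  proof (rule cross_evI)
    show "orient_lim s t h (\<lambda>_. 1) (orient (corner 0) (corner i) (corner 1))"
      by (rule orient_corners; rule lt arm(2,3) m i(1))
    show "orient_lim s t y (\<lambda>_. 1) (orient (corner 0) (corner i) (corner 4))"
      by (rule orient_corners; rule lt arm(2,3) m i(1))
    show "orient_lim h y s (\<lambda>_. 1) (orient (corner 0) (corner 3) (corner 5))"
      by (rule orient_corners; rule lt arm(2,3) m i(1))
    show "orient_lim h y t (\<lambda>_. 1) (orient (corner 0) (corner 3) (corner (i - 1)))"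
      by (rule orient_corners; rule lt arm(2,3) m i(1))
    have c1: "corner (Suc 0) = vector [1, 1]" using corner_values(2) by simp
    show "orient (corner 0) (corner i) (corner 1) * orient (corner 0) (corner i) (corner 4) < 0"
      "orient (corner 0) (corner 3) (corner 5) * orient (corner 0) (corner 3) (corner (i - 1)) < 0"
      using i(2) by (auto simp: corner_values c1 orient_coord)
  qed (rule zero_less_one)+
qed

end


text \<open>
  The pairs of edges \<open>st\<close>, \<open>hy\<close> that cross in every drawing close enough to the limit in which
  the arms are infinitesimally small.
\<close>

definition forced_crossing :: "(nat \<Rightarrow> nat \<times> nat) \<Rightarrow> nat \<Rightarrow> nat \<Rightarrow> nat \<Rightarrow> nat \<Rightarrow> bool" where
  "forced_crossing loc s t h y \<longleftrightarrow> (let g = (\<lambda>j t. slope_form j (loc (t div 6))); q = (\<lambda>t. local_pos loc (t div 6)) in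
     (\<exists>j\<in>{1, 2, 4, 5}. t mod 6 = s mod 6 \<and> h mod 6 = s mod 6 \<and> y mod 6 = (s + j) mod 6 \<and>
        (g j h - g j s) * (g j h - g j t) < 0 \<and> orient (q s) (q t) (q h) * (g j t - g j s) < 0)
   \<or> (t mod 6 = (s + 1) mod 6 \<and> h mod 6 = s mod 6 \<and> y mod 6 = (s + 1) mod 6 \<and> (g 1 s - g 1 h) * (g 5 y - g 5 t) < 0)
   \<or> (t mod 6 = (s + 1) mod 6 \<and> h mod 6 = s mod 6 \<and> y mod 6 = (s + 5) mod 6 \<and> g 1 s < g 1 h \<and> g 5 s < g 5 h)
   \<or> (t mod 6 = (s + 1) mod 6 \<and> h mod 6 = (s + 1) mod 6 \<and> y mod 6 = (s + 2) mod 6 \<and> g 5 h < g 5 t \<and> g 1 h < g 1 t)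
   \<or> ((t mod 6 = (s + 2) mod 6 \<or> t mod 6 = (s + 3) mod 6) \<and> h mod 6 = (s + 1) mod 6 \<and> y mod 6 = (s + 4) mod 6))"

text \<open>Each forced crossing is present from some index on; there are finitely many quadruples
  of vertices, so one index serves all.\<close>

lemma hex_drawing:
  "\<exists>p. drawing n p \<and> (\<forall>s<n. \<forall>t<n. \<forall>h<n. \<forall>y<n. forced_crossing loc s t h y \<longrightarrow>
     open_segment (p s) (p t) \<inter> open_segment (p h) (p y) \<noteq> {})"
proof -
  obtain p w :: "nat \<Rightarrow> nat \<Rightarrow> real^2" and \<delta> :: "nat \<Rightarrow> real" where p: "\<And>m. drawing n (p m)"
    and \<delta>: "\<And>m. 0 < \<delta> m" "\<delta> \<longlonglongrightarrow> 0"
    and w: "\<And>m t. p m t = corner (t mod 6) + \<delta> m *\<^sub>R w m t"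
      "\<And>t. t < n \<Longrightarrow> (\<lambda>m. w m t) \<longlonglongrightarrow> (rot ^^ (t mod 6)) (local_pos loc (t div 6))"
    using clustered_drawings[of n "\<lambda>t. corner (t mod 6)" "\<lambda>t. (rot ^^ (t mod 6)) (local_pos loc (t div 6))"]
    by metis
  interpret hex_family n loc p w \<delta> by unfold_locales (rule \<delta> w; assumption?)+
  define T where "T = {x \<in> {..<n} \<times> {..<n} \<times> {..<n} \<times> {..<n}. case x of (s, t, h, y) \<Rightarrow> forced_crossing loc s t h y}"
  have "finite T" unfolding T_def by simp
  define meet where "meet m x \<longleftrightarrow> (case x of (s, t, h, y) \<Rightarrow>
    open_segment (p m s) (p m t) \<inter> open_segment (p m h) (p m y) \<noteq> {})" for m x
  have "cross_ev s t h y" if lt: "s < n" "t < n" "h < n" "y < n" and f: "forced_crossing loc s t h y" for s t h y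
    using f unfolding forced_crossing_def Let_def
    by (elim disjE bexE conjE)
       (rule cross_same_arm[OF lt] cross_parallel[OF lt] cross_outer[OF lt] cross_outer'[OF lt] cross_diagonal[OF lt];
         (assumption | rule disjI1, assumption | rule disjI2, assumption))+
  then have "\<forall>x\<in>T. \<forall>\<^sub>F m in sequentially. meet m x"
    by (auto simp: T_def cross_ev_def meet_def)
  then have "\<forall>\<^sub>F m in sequentially. \<forall>x\<in>T. meet m x"
    using \<open>finite T\<close> by (simp add: eventually_ball_finite)
  then obtain m where m: "\<forall>x\<in>T. meet m x"
    by (auto simp: eventually_sequentially)
  have "open_segment (p m s) (p m t) \<inter> open_segment (p m h) (p m y) \<noteq> {}"
    if "s < n" "t < n" "h < n" "y < n" "forced_crossing loc s t h y" for s t h y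
    using bspec[OF m, of "(s, t, h, y)"] that by (simp add: T_def meet_def)
  then show ?thesis using p[of m] by blast
qed

section \<open>The lattice filling an arm\<close>

text \<open>
  The congruence modulo 5 prevents two points of the lattice from lying on the same or adjacent
  integer lines both for the form \<open>u\<close> and for the form \<open>2 u + v\<close>, so that for one of them there are
  further lattice lines strictly between the two points; by symmetry the same holds for \<open>v\<close> and \<open>u + 2 v\<close>.
\<close>

definition Lam :: "(nat \<times> nat) set" where
  "Lam = {(u, v). u mod 5 = v mod 5}"

definition nrm :: "nat \<times> nat \<Rightarrow> nat" where
  "nrm x = fst x + snd x"

text \<open>Cantor's pairing runs through the antidiagonals one after another. Listing
  \<open>Lam\<close> in the order of this code therefore fills an arm outwards.\<close>

lemma prod_encode_mono:
  assumes "nrm x < nrm y"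
  shows "prod_encode x < prod_encode y"
proof -
  have tr: "triangle (m + d) \<ge> triangle m" for m d by (induction d) auto
  obtain d where d: "nrm y = Suc (nrm x) + d" using assms less_iff_Suc_add by auto
  have "prod_encode x < triangle (Suc (nrm x))"
    by (cases x) (simp add: prod_encode_def nrm_def)
  also have "\<dots> \<le> triangle (nrm y)" unfolding d by (rule tr)
  also have "\<dots> \<le> prod_encode y" by (cases y) (simp add: prod_encode_def nrm_def)
  finally show ?thesis .
qed

lemma lattice_enumeration:
  "\<exists>loc :: nat \<Rightarrow> nat \<times> nat. range loc = Lam \<and> inj loc \<and> (\<forall>i j. nrm (loc i) < nrm (loc j) \<longrightarrow> i < j)"
proof -
  define K where "K = prod_encode ` Lam"
  have "infinite Lam"
  proof
    assume "finite Lam"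
    moreover have "range (\<lambda>i. (i, i)) \<subseteq> Lam" by (auto simp: Lam_def)
    ultimately have "finite (range (\<lambda>i::nat. (i, i)))" by (rule finite_subset[rotated])
    then show False by (simp add: finite_image_iff inj_on_def)
  qed
  then have K: "infinite K" unfolding K_def by (simp add: finite_image_iff inj_prod_encode)
  define loc where "loc i = prod_decode (enumerate K i)" for i
  have enc: "prod_encode (loc i) = enumerate K i" for i by (simp add: loc_def)
  have "range loc = prod_decode ` range (enumerate K)" by (auto simp: loc_def)
  also have "\<dots> = Lam" by (simp add: range_enumerate[OF K]) (simp add: K_def image_image)
  finally have "range loc = Lam" .
  moreover have "inj loc"
    by (rule inj_onI) (metis K enc enumerate_mono_iff less_irrefl linorder_neqE_nat)
  moreover have "i < j" if "nrm (loc i) < nrm (loc j)" for i j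
    using prod_encode_mono[OF that] K by (simp add: enc)
  ultimately show ?thesis by blast
qed

section \<open>Lattice points below a chord, and coordinates adapted to a direction\<close>

lemma residue_count:
  fixes h :: real
  shows "h / 10 - 1 \<le> card {y::nat. y mod 10 = c mod 10 \<and> real y < h}"
proof -
  define r where "r = c mod 10"
  define B where "B = nat \<lceil>(h - real r) / 10\<rceil>"
  have r9: "real r \<le> 9" by (simp add: r_def)
  have fin: "finite {y::nat. y mod 10 = c mod 10 \<and> real y < h}"
    by (rule finite_subset[of _ "{..nat \<lceil>h\<rceil>}"]) (auto, linarith)
  have "(\<lambda>b. r + 10 * b) ` {..<B} \<subseteq> {y::nat. y mod 10 = c mod 10 \<and> real y < h}"
  proof
    fix y assume "y \<in> (\<lambda>b. r + 10 * b) ` {..<B}"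
    then obtain b where b: "b < B" "y = r + 10 * b" by auto
    have "real b < (h - real r) / 10" using b(1) unfolding B_def by linarith
    then have "real y < h" using b(2) by (simp add: field_simps)
    moreover have "y mod 10 = c mod 10" unfolding b(2) r_def by simp
    ultimately show "y \<in> {y::nat. y mod 10 = c mod 10 \<and> real y < h}" by simp
  qed
  then have "card ((\<lambda>b. r + 10 * b) ` {..<B}) \<le> card {y::nat. y mod 10 = c mod 10 \<and> real y < h}"
    using fin by (intro card_mono)
  moreover have "card ((\<lambda>b. r + 10 * b) ` {..<B}) = B" by (simp add: card_image inj_on_def)
  moreover have "h / 10 - 1 \<le> real B" 
    using r9 real_nat_ceiling_ge[of "(h - real r) / 10"] unfolding B_def diff_divide_distrib by linarith
  ultimately show ?thesis by linarith
qed

text \<open>The upper limit for \<open>y\<close> is the chord from \<open>(l1, y1)\<close> to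
  \<open>(l2, y2)\<close>. The residue prescribed in each column will select pairs that are
  coordinates of lattice points.\<close>

definition strip :: "(nat \<Rightarrow> nat) \<Rightarrow> nat \<Rightarrow> nat \<Rightarrow> nat \<Rightarrow> nat \<Rightarrow> (nat \<times> nat) set" where
  "strip c l1 y1 l2 y2 = {(s, y). l1 < s \<and> s < l2 \<and> y mod 10 = c s mod 10 \<and>
     real y < (real y1 * (real l2 - real s) + real y2 * (real s - real l1)) / (real l2 - real l1)}"

lemma sum_real_lessThan: "(\<Sum>i<D. real i) = real D * (real D - 1) / 2"
  by (induction D) (simp_all add: field_simps)

text \<open>Over the columns strictly between the ends the chord has mean height
  \<open>(y1 + y2) / 2\<close>, and a column of height \<open>h\<close> contains at least
  \<open>h / 10 - 1\<close> points.\<close>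

lemma strip_count:
  assumes "l1 < l2"
  shows "(real l2 - real l1 - 1) * ((real y1 + real y2) / 20 - 1) \<le> card (strip c l1 y1 l2 y2)"
proof -
  define h where "h s = (real y1 * (real l2 - real s) + real y2 * (real s - real l1)) / (real l2 - real l1)" for s
  define D where "D = l2 - l1"
  have D: "real D = real l2 - real l1" "0 < D" "l2 = l1 + D" using assms by (auto simp: D_def)
  define col where "col s = {y. y mod 10 = c s mod 10 \<and> real y < h s}" for s
  have fin: "finite (col s)" for s unfolding col_def
    by (rule finite_subset[of _ "{..nat \<lceil>h s\<rceil>}"]) (auto, linarith)
  have "strip c l1 y1 l2 y2 = Sigma {l1<..<l2} col"
    by (auto simp: strip_def col_def h_def)
  then have "real (card (strip c l1 y1 l2 y2)) = (\<Sum>s\<in>{l1<..<l2}. real (card (col s)))"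
    using fin by (simp add: of_nat_sum)
  also have "\<dots> \<ge> (\<Sum>s\<in>{l1<..<l2}. h s / 10 - 1)"
    using residue_count unfolding col_def by (intro sum_mono)
  finally have 1: "(\<Sum>s\<in>{l1<..<l2}. h s / 10 - 1) \<le> card (strip c l1 y1 l2 y2)" .
  have "(\<Sum>s\<in>{l1<..<l2}. h s / 10 - 1) = (\<Sum>i\<in>{0<..<D}. h (l1 + i) / 10 - 1)"
    by (rule sum.reindex_bij_witness[of _ "\<lambda>i. l1 + i" "\<lambda>s. s - l1"]) (auto simp: D(3))
  also have "\<dots> = (\<Sum>i<D. h (l1 + i) / 10 - 1) - (h l1 / 10 - 1)"
  proof -
    have "{..<D} = insert 0 {0<..<D}" using D(2) by auto
    then show ?thesis by simp
  qed
  also have "h l1 = real y1" unfolding h_def using D(1,2) by (simp flip: D(1))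
  also have "(\<Sum>i<D. h (l1 + i) / 10 - 1) = (\<Sum>i<D. (real y1 / 10 - 1) + real i * ((real y2 - real y1) / (10 * real D)))"
  proof (rule sum.cong)
    fix i
    show "h (l1 + i) / 10 - 1 = (real y1 / 10 - 1) + real i * ((real y2 - real y1) / (10 * real D))"
      unfolding h_def D(1)[symmetric] using D(2) by (simp add: D(3) field_simps)
  qed simp
  also have "\<dots> = real D * (real y1 / 10 - 1) + real D * (real D - 1) / 2 * ((real y2 - real y1) / (10 * real D))"
    by (simp only: sum.distrib sum_distrib_right[symmetric] sum_real_lessThan) simp
  also have "\<dots> = real D * (real y1 / 10 - 1) + (real D - 1) * (real y2 - real y1) / 20"
    using D(2) by (simp add: field_simps)
  also have "\<dots> - (real y1 / 10 - 1) = (real D - 1) * ((real y1 + real y2) / 20 - 1)"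
    by (simp add: field_simps)
  finally show ?thesis using 1 D(1) by simp
qed

text \<open>
  Coordinates of an arm adapted to the edges towards the \<open>j\<close>-th next arm: \<open>lam j\<close> is constant along
  these edges, and \<open>dep j\<close> measures how much of the arm lies behind a point.
\<close>

definition lam :: "nat \<Rightarrow> nat \<times> nat \<Rightarrow> nat" where
  "lam j x = (if j = 1 then fst x + 2 * snd x else if j = 2 then snd x else if j = 4 then fst x else 2 * fst x + snd x)"

definition dep :: "nat \<Rightarrow> nat \<times> nat \<Rightarrow> nat" where
  "dep j x = (if j = 1 \<or> j = 2 then fst x else snd x)"

text \<open>
  The condition \<open>y \<equiv> 7 s (mod 10)\<close> makes \<open>(s - y) / 2\<close> an integer that is congruent to \<open>y\<close> modulo 5.
\<close>

definition res :: "nat \<Rightarrow> nat \<Rightarrow> nat" where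
  "res j s = (if j = 2 \<or> j = 4 then s else 7 * s)"

text \<open>Recovers the lattice point from its coordinates \<open>lam j\<close> and
  \<open>dep j\<close>. For \<open>j = 1\<close> and \<open>j = 5\<close> the difference is a
  truncated one, hence the proviso \<open>y \<le> s\<close> in what follows.\<close>

definition lam_pt :: "nat \<Rightarrow> nat \<times> nat \<Rightarrow> nat \<times> nat" where
  "lam_pt j sy = (case sy of (s, y) \<Rightarrow> if j = 1 then (y, (s - y) div 2) else if j = 2 then (y, s)
     else if j = 4 then (s, y) else ((s - y) div 2, y))"

lemma lam_pt:
  assumes "j \<in> {1, 2, 4, 5}" "y mod 10 = res j s mod 10" "j = 2 \<or> j = 4 \<or> y \<le> s"
  shows "lam_pt j (s, y) \<in> Lam" "lam j (lam_pt j (s, y)) = s" "dep j (lam_pt j (s, y)) = y"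
proof -
  have 7: "((s - y) div 2) mod 5 = y mod 5" "2 * ((s - y) div 2) = s - y" if ys: "y mod 10 = 7 * s mod 10" "y \<le> s"
  proof -
    obtain d where d: "s = y + d" using ys(2) le_Suc_ex by blast
    have "y mod 10 = (7 * y + 7 * d) mod 10" using ys(1) by (simp add: d distrib_left)
    then have "y mod 10 mod 2 = (7 * y + 7 * d) mod 10 mod 2" by simp
    then have "y mod 2 = (7 * y + 7 * d) mod 2" by (simp add: mod_mod_cancel)
    then have "even d" by presburger
    then obtain e where e: "d = 2 * e" by blast
    have "y mod 10 = (7 * y + 14 * e) mod 10" using ys(1) by (simp add: d e distrib_left)
    then have "y mod 10 mod 5 = (7 * y + 14 * e) mod 10 mod 5" by simp
    then have "y mod 5 = (7 * y + 14 * e) mod 5" by (simp add: mod_mod_cancel)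
    also have "\<dots> = ((2 * y + 4 * e) + 5 * (y + 2 * e)) mod 5" by (simp add: algebra_simps)
    also have "\<dots> = (2 * y + 4 * e) mod 5" by (rule mod_mult_self2)
    also have "\<dots> = (2 * (y mod 5) + 4 * (e mod 5)) mod 5" by (intro mod_add_cong mod_mult_right_eq[symmetric])
    finally have "y mod 5 = (2 * (y mod 5) + 4 * (e mod 5)) mod 5" .
    moreover have "y mod 5 < 5" "e mod 5 < 5" by simp_all
    then have "y mod 5 \<in> {0, 1, 2, 3, 4}" "e mod 5 \<in> {0, 1, 2, 3, 4}" by auto
    ultimately have "e mod 5 = y mod 5" by auto
    then show "((s - y) div 2) mod 5 = y mod 5" "2 * ((s - y) div 2) = s - y" by (simp_all add: d e)
  qed
  have 1: "y mod 5 = s mod 5" if "y mod 10 = s mod 10"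
    using arg_cong[OF that, of "\<lambda>x. x mod 5"] by (simp add: mod_mod_cancel)
  show "lam_pt j (s, y) \<in> Lam" "lam j (lam_pt j (s, y)) = s" "dep j (lam_pt j (s, y)) = y"
    using assms 7 1 by (auto simp: lam_pt_def Lam_def lam_def dep_def res_def)
qed

text \<open>The sign of \<open>\<kappa> * \<omega>\<close> is what makes \<open>dep j\<close> a
  depth: for each of the four directions, lying behind an edge becomes lying below its chord in the
  coordinates \<open>lam j\<close> and \<open>dep j\<close>.\<close>

lemma slope_form_lam:
  assumes "j \<in> {1, 2, 4, 5}"
  obtains \<kappa> \<omega> :: real where "0 < \<kappa> * \<omega>" "\<And>x. slope_form j x = \<kappa> * real (lam j x)"
    "\<And>loc a b c. orient (local_pos loc a) (local_pos loc b) (local_pos loc c) =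
      \<omega> * ((real (lam j (loc b)) - real (lam j (loc a))) * (real (dep j (loc c)) - real (dep j (loc a)))
        - (real (dep j (loc b)) - real (dep j (loc a))) * (real (lam j (loc c)) - real (lam j (loc a))))"
proof -
  have o: "orient (local_pos loc a) (local_pos loc b) (local_pos loc c) =
      3 * ((real (fst (loc b)) - real (fst (loc a))) * (real (snd (loc c)) - real (snd (loc a)))
        - (real (snd (loc b)) - real (snd (loc a))) * (real (fst (loc c)) - real (fst (loc a))))" for loc a b c
    by (simp add: orient_coord local_pos_def algebra_simps)
  consider "j = 1" | "j = 2" | "j = 4" | "j = 5" using assms by auto
  then show ?thesis
  proof cases
    case 1
    show ?thesis
      by (rule that[of "-1" "-3/2"]) (simp_all add: o 1 slope_form_def lam_def dep_def algebra_simps split: prod.splits)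
  next
    case 2
    show ?thesis
      by (rule that[of "-3" "-3"]) (simp_all add: o 2 slope_form_def lam_def dep_def algebra_simps split: prod.splits)
  next
    case 3
    show ?thesis
      by (rule that[of 3 3]) (simp_all add: o 3 slope_form_def lam_def dep_def algebra_simps split: prod.splits)
  next
    case 4
    show ?thesis
      by (rule that[of 1 "3/2"]) (simp_all add: o 4 slope_form_def lam_def dep_def algebra_simps split: prod.splits)
  qed
qed

text \<open>As the norm is linear in the adapted coordinates, a point below a chord has smaller norm
  than one end of it. This is how such lattice points are known to be occupied by vertices.\<close>

lemma lam_dep_nrm:
  assumes "j \<in> {1, 2, 4, 5}"
  obtains m :: nat where "0 < m" "\<And>x. lam j x + dep j x = m * nrm x"
proof -
  consider "j = 1 \<or> j = 5" | "j = 2 \<or> j = 4" using assms by auto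
  then show ?thesis
    by cases (auto intro: that[of 2] that[of 1] simp: lam_def dep_def nrm_def)
qed

lemma lam1_5: "lam 1 x + lam 5 x = 3 * nrm x" "nrm x \<le> lam 1 x" "lam 1 x \<le> 2 * nrm x" "nrm x \<le> lam 5 x" "lam 5 x \<le> 2 * nrm x"
  by (auto simp: lam_def nrm_def)

lemma slope_form_1_5: "slope_form 1 x = - real (lam 1 x)" "slope_form 5 x = real (lam 5 x)"
  by (auto simp: slope_form_def lam_def split: prod.splits)

text \<open>For two directions with common depth \<open>V\<close>: the congruence excludes that both
  \<open>da\<close> and \<open>2 * da + db\<close> are at most 1 in absolute value, so
  \<open>M\<close> is at least 1. Then \<open>\<bar>da\<bar> + \<bar>db\<bar> \<le> 4 * (M + 1)
  \<le> 8 * M\<close> and \<open>V / 20 - 1 \<ge> V / 40\<close>; the constant is 640 = 2 * 8 *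
  40.\<close>

lemma separation_arith:
  fixes a b y V r :: real and da db :: int
  assumes "da mod 5 = db mod 5" "da \<noteq> 0 \<or> db \<noteq> 0"
    and 1: "da \<noteq> 0 \<Longrightarrow> (\<bar>da\<bar> - 1) * (V / 20 - 1) \<le> y" and 2: "2 * da + db \<noteq> 0 \<Longrightarrow> (\<bar>2 * da + db\<bar> - 1) * (V / 20 - 1) \<le> y"
    and V: "40 \<le> V" "r \<le> 2 * V"
  shows "r * (\<bar>da\<bar> + \<bar>db\<bar>) \<le> 640 * y"
proof -
  define M where "M = max (\<bar>da\<bar> - 1) (\<bar>2 * da + db\<bar> - 1)"
  have "\<not> (\<bar>da\<bar> \<le> 1 \<and> \<bar>2 * da + db\<bar> \<le> 1)"
  proof
    assume small: "\<bar>da\<bar> \<le> 1 \<and> \<bar>2 * da + db\<bar> \<le> 1"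
    then consider "da = -1" | "da = 0" | "da = 1" by linarith
    then show False
    proof cases
      case 1
      then have "db \<in> {1, 2, 3}" using small by auto
      then show False using assms(1) 1 by auto
    next
      case 2
      then have "db \<in> {-1, 0, 1}" using small by auto
      then show False using assms(1,2) 2 by auto
    next
      case 3
      then have "db \<in> {-1, -2, -3}" using small by auto
      then show False using assms(1) 3 by auto
    qed
  qed
  then have M1: "1 \<le> M" unfolding M_def by linarith
  have ab: "\<bar>da\<bar> + \<bar>db\<bar> \<le> 8 * M"
  proof -
    have "\<bar>da\<bar> - 1 \<le> M" "\<bar>2 * da + db\<bar> - 1 \<le> M" by (auto simp: M_def)
    moreover have "\<bar>db\<bar> \<le> 2 * \<bar>da\<bar> + \<bar>2 * da + db\<bar>" by linarith
    ultimately show ?thesis using M1 by linarith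
  qed
  have "real_of_int M * (V / 20 - 1) \<le> y"
  proof (cases "M = \<bar>da\<bar> - 1")
    case True
    then show ?thesis using 1 M1 by auto
  next
    case False
    then have "M = \<bar>2 * da + db\<bar> - 1" unfolding M_def by linarith
    then show ?thesis using 2 M1 by auto
  qed
  moreover have "real_of_int M * (V / 40) \<le> real_of_int M * (V / 20 - 1)"
    using M1 V by (intro mult_left_mono) auto
  ultimately have MV: "real_of_int M * V \<le> 40 * y" by linarith
  have "real_of_int (\<bar>da\<bar> + \<bar>db\<bar>) \<le> real_of_int (8 * M)" using ab by (simp only: of_int_le_iff)
  then have ab': "real_of_int (\<bar>da\<bar> + \<bar>db\<bar>) \<le> 8 * real_of_int M" by simp
  have "r * (\<bar>da\<bar> + \<bar>db\<bar>) \<le> (2 * V) * (8 * real_of_int M)"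
    using V by (intro mult_mono ab') simp_all
  also have "\<dots> = 16 * (real_of_int M * V)" by simp
  also have "\<dots> \<le> 640 * y" using MV by linarith
  finally show ?thesis by simp
qed

section \<open>Counting nearby lattice points\<close>

abbreviation H :: "real \<Rightarrow> nat \<Rightarrow> nat set" where
  "H a m \<equiv> {\<rho>\<in>{1..m}. a < real \<rho>}"

text \<open>Each step uses \<open>1 / (m + 1) \<le> ln (m + 1) - ln m\<close>. The summand 1 pays
  for the first index above \<open>a\<close>.\<close>

lemma harmonic_tail:
  assumes "0 < a"
  shows "(\<Sum>\<rho>\<in>H a m. 1 / real \<rho>) \<le> 1 + max 0 (ln (real m / a))"
proof (induction m)
  case 0
  then show ?case by simp
next
  case (Suc m)
  show ?case
  proof (cases "a < real (Suc m)")
    case False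
    then have e: "H a (Suc m) = {}" by auto
    show ?thesis unfolding e by simp
  next
    case True
    have "H a (Suc m) = insert (Suc m) (H a m)"
      using True by auto
    then have eq: "(\<Sum>\<rho>\<in>H a (Suc m). 1 / real \<rho>) =
        1 / real (Suc m) + (\<Sum>\<rho>\<in>H a m. 1 / real \<rho>)" by simp
    show ?thesis
    proof (cases "a < real m")
      case True
      have m: "0 < real m" using True assms by linarith
      have "ln (real m / real (Suc m)) \<le> real m / real (Suc m) - 1"
        using m by (intro ln_le_minus_one) simp
      also have "\<dots> = - (1 / real (Suc m))" by (simp add: field_simps)
      finally have "1 / real (Suc m) \<le> ln (real (Suc m)) - ln (real m)"
        using m by (simp add: ln_div)
      moreover have "0 \<le> ln (real m / a)" using True assms by simp
      moreover have "0 \<le> ln (real (Suc m) / a)" using True assms by simp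
      moreover have "ln (real (Suc m) / a) = ln (real (Suc m)) - ln a" "ln (real m / a) = ln (real m) - ln a"
        using m assms by (simp_all add: ln_div)
      ultimately show ?thesis using Suc.IH unfolding eq by linarith
    next
      case False
      then have e: "H a m = {}" by auto
      have "1 / real (Suc m) \<le> 1" by simp
      then have "1 / real (Suc m) + (\<Sum>\<rho>\<in>({}::nat set). 1 / real \<rho>) \<le> 1 + max 0 (ln (real (Suc m) / a))"
        unfolding sum.empty by linarith
      then show ?thesis unfolding eq e .
    qed
  qed
qed

lemma finite_nrm_le: "finite {x. nrm x \<le> r}"
  by (rule finite_subset[of _ "{..r} \<times> {..r}"]) (auto simp: nrm_def)

lemma card_nrm_le: "card {x. nrm x \<le> r} \<le> (r + 1)\<^sup>2"
proof -
  have "{x. nrm x \<le> r} \<subseteq> {..r} \<times> {..r}" by (auto simp: nrm_def)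
  then have "card {x. nrm x \<le> r} \<le> card ({..r} \<times> {..r})" by (intro card_mono) auto
  then show ?thesis by (simp add: card_cartesian_product power2_eq_square)
qed

lemma card_nrm_eq: "finite {x. nrm x = r} \<and> card {x. nrm x = r} \<le> r + 1"
proof -
  have "inj_on fst {x. nrm x = r}" by (auto simp: inj_on_def nrm_def)
  moreover have "fst ` {x. nrm x = r} \<subseteq> {..r}" by (auto simp: nrm_def)
  ultimately show ?thesis
    using card_inj_on_le[of fst "{x. nrm x = r}" "{..r}"] inj_on_finite[of fst "{x. nrm x = r}" "{..r}"] by simp
qed

definition dist1 :: "nat \<times> nat \<Rightarrow> nat \<times> nat \<Rightarrow> real" where
  "dist1 p q = \<bar>real (fst p) - real (fst q)\<bar> + \<bar>real (snd p) - real (snd q)\<bar>"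

lemma dist1_ge_1: "p \<noteq> q \<Longrightarrow> 1 \<le> dist1 p q"
proof -
  assume "p \<noteq> q"
  then have "fst p \<noteq> fst q \<or> snd p \<noteq> snd q" by (simp add: prod_eq_iff)
  moreover have "1 \<le> \<bar>real a - real b\<bar>" if "a \<noteq> b" for a b :: nat using that by (cases a b rule: linorder_cases) auto
  ultimately show ?thesis unfolding dist1_def
    by (metis abs_ge_zero add_increasing add_increasing2)
qed

lemma card_nat_near: "finite {b::nat. \<bar>real a - real b\<bar> \<le> d} \<and> (0 \<le> d \<longrightarrow> real (card {b::nat. \<bar>real a - real b\<bar> \<le> d}) \<le> 2 * d + 1)"
proof -
  define f where "f = nat \<lfloor>d\<rfloor>"
  have sub: "{b::nat. \<bar>real a - real b\<bar> \<le> d} \<subseteq> {a - f..a + f}"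
  proof
    fix b assume "b \<in> {b::nat. \<bar>real a - real b\<bar> \<le> d}"
    then have "real a - real b \<le> d" "real b - real a \<le> d" by auto
    then have "int a - int b \<le> \<lfloor>d\<rfloor>" "int b - int a \<le> \<lfloor>d\<rfloor>" by (simp_all add: le_floor_iff)
    then show "b \<in> {a - f..a + f}" unfolding f_def by auto
  qed
  then have fin: "finite {b::nat. \<bar>real a - real b\<bar> \<le> d}" by (rule finite_subset) simp
  have "card {b::nat. \<bar>real a - real b\<bar> \<le> d} \<le> card {a - f..a + f}" using sub by (intro card_mono) auto
  also have "\<dots> \<le> 2 * f + 1" by simp
  finally have "real (card {b::nat. \<bar>real a - real b\<bar> \<le> d}) \<le> 2 * real f + 1" by linarith
  moreover have "real f \<le> d" if "0 \<le> d" unfolding f_def using that by simp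
  ultimately show ?thesis using fin by fastforce
qed

lemma card_dist1_le:
  assumes "0 \<le> d"
  shows "finite {q. dist1 p q \<le> d}" "real (card {q. dist1 p q \<le> d}) \<le> (2 * d + 1)\<^sup>2"
proof -
  define X where "X a = {b::nat. \<bar>real a - real b\<bar> \<le> d}" for a
  have X: "finite (X a)" "real (card (X a)) \<le> 2 * d + 1" for a
    using card_nat_near[of a d] assms by (simp_all add: X_def)
  have sub: "{q. dist1 p q \<le> d} \<subseteq> X (fst p) \<times> X (snd p)"
    by (auto simp: dist1_def X_def)
  then show "finite {q. dist1 p q \<le> d}" using X(1) by (meson finite_SigmaI finite_subset)
  have "card {q. dist1 p q \<le> d} \<le> card (X (fst p) \<times> X (snd p))"
    using X(1) sub by (intro card_mono) auto
  then have "real (card {q. dist1 p q \<le> d}) \<le> real (card (X (fst p))) * real (card (X (snd p)))"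
    by (simp add: card_cartesian_product flip: of_nat_mult)
  also have "\<dots> \<le> (2 * d + 1) * (2 * d + 1)" using X(2) assms by (intro mult_mono) auto
  finally show "real (card {q. dist1 p q \<le> d}) \<le> (2 * d + 1)\<^sup>2" by (simp add: power2_eq_square)
qed

text \<open>Will describe the ends of lightly crossed edges inside an arm, apart from those of small
  norm. The end of larger norm stands first and alone enters the condition.\<close>

definition near_pairs :: "real \<Rightarrow> nat \<Rightarrow> ((nat \<times> nat) \<times> (nat \<times> nat)) set" where
  "near_pairs Y R = {(p, q). p \<noteq> q \<and> nrm q \<le> nrm p \<and> nrm p \<le> R \<and> real (nrm p) * dist1 p q \<le> Y}"

lemma finite_near_pairs: "finite (near_pairs Y R)"
  by (rule finite_subset[of _ "{x. nrm x \<le> R} \<times> {x. nrm x \<le> R}"])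
     (auto simp: near_pairs_def finite_nrm_le)

text \<open>There are at most \<open>2 * \<rho>\<close> points of norm \<open>\<rho>\<close>. Each
  has at most \<open>(2 * Y / \<rho> + 1)\<^sup>2\<close> partners by distance and at most
  \<open>(\<rho> + 1)\<^sup>2\<close> by norm. Distinct points have distance at least 1, so
  \<open>\<rho> \<le> Y\<close>, and the summands 1 are absorbed into the constants.\<close>

lemma near_pairs_card_sum:
  defines "F \<equiv> \<lambda>Y \<rho>. min (18 * Y\<^sup>2 / real \<rho>) (8 * (real \<rho>)^ 3)"
  assumes "0 \<le> Y"
  shows "real (card (near_pairs Y R)) \<le> (\<Sum>\<rho>\<in>{1..min R (nat \<lfloor>Y\<rfloor>)}. F Y \<rho>)"
proof -
  define m where "m = min R (nat \<lfloor>Y\<rfloor>)"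
  define Q where "Q p = {q. nrm q \<le> nrm p \<and> real (nrm p) * dist1 p q \<le> Y}" for p
  have finQ: "finite (Q p)" for p
    unfolding Q_def by (rule finite_subset[OF _ finite_nrm_le[of "nrm p"]]) auto
  have "near_pairs Y R \<subseteq> (\<Union>\<rho>\<in>{1..m}. SIGMA p:{x. nrm x = \<rho>}. Q p)"
  proof
    fix x assume "x \<in> near_pairs Y R"
    then obtain p q where x: "x = (p, q)" "p \<noteq> q" "nrm q \<le> nrm p" "nrm p \<le> R" "real (nrm p) * dist1 p q \<le> Y"
      by (auto simp: near_pairs_def)
    have "nrm p \<noteq> 0"
    proof
      assume "nrm p = 0"
      then show False using x(2,3) by (auto simp: nrm_def prod_eq_iff)
    qed
    moreover have "real (nrm p) * 1 \<le> real (nrm p) * dist1 p q"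
      using dist1_ge_1[OF x(2)] by (intro mult_left_mono) auto
    then have "real (nrm p) \<le> Y" using x(5) by linarith
    then have "nrm p \<le> nat \<lfloor>Y\<rfloor>" by (simp add: le_nat_floor)
    ultimately have "nrm p \<in> {1..m}" using x(4) by (simp add: m_def)
    then show "x \<in> (\<Union>\<rho>\<in>{1..m}. SIGMA p:{x. nrm x = \<rho>}. Q p)" using x by (auto simp: Q_def)
  qed
  then have "card (near_pairs Y R) \<le> card (\<Union>\<rho>\<in>{1..m}. SIGMA p:{x. nrm x = \<rho>}. Q p)"
    using card_nrm_eq finQ by (intro card_mono) auto
  also have "\<dots> \<le> (\<Sum>\<rho>\<in>{1..m}. card (SIGMA p:{x. nrm x = \<rho>}. Q p))"
    by (rule card_UN_le) simp
  finally have "real (card (near_pairs Y R)) \<le> (\<Sum>\<rho>\<in>{1..m}. real (card (SIGMA p:{x. nrm x = \<rho>}. Q p)))"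
    by (simp flip: of_nat_sum)
  also have "\<dots> \<le> (\<Sum>\<rho>\<in>{1..m}. F Y \<rho>)"
  proof (rule sum_mono)
    fix \<rho> assume \<rho>: "\<rho> \<in> {1..m}"
    have r1: "1 \<le> real \<rho>" using \<rho> by simp
    have rY: "real \<rho> \<le> Y" using \<rho> assms(2) unfolding m_def by (simp add: le_nat_iff le_floor_iff)
    define G where "G = min (9 * Y\<^sup>2 / (real \<rho>)\<^sup>2) (4 * (real \<rho>)\<^sup>2)"
    have QG: "real (card (Q p)) \<le> G" if p: "nrm p = \<rho>" for p
    proof -
      have "card (Q p) \<le> card {x. nrm x \<le> \<rho>}"
        using p by (intro card_mono finite_nrm_le) (auto simp: Q_def)
      then have "card (Q p) \<le> (\<rho> + 1)\<^sup>2" using card_nrm_le order.trans by blast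
      then have "real (card (Q p)) \<le> (real \<rho> + 1)\<^sup>2" by (metis of_nat_1 of_nat_add of_nat_le_iff of_nat_power)
      also have "\<dots> \<le> (2 * real \<rho>)\<^sup>2" using r1 by (intro power_mono) auto
      finally have 1: "real (card (Q p)) \<le> 4 * (real \<rho>)\<^sup>2" by (simp add: power2_eq_square)
      have d: "1 \<le> Y / real \<rho>" using rY r1 by simp
      have fd: "finite {q. dist1 p q \<le> Y / real \<rho>}" using d by (intro card_dist1_le) simp
      have "Q p \<subseteq> {q. dist1 p q \<le> Y / real \<rho>}"
        using r1 p by (auto simp: Q_def field_simps)
      then have "card (Q p) \<le> card {q. dist1 p q \<le> Y / real \<rho>}" using fd by (intro card_mono)
      then have "real (card (Q p)) \<le> real (card {q. dist1 p q \<le> Y / real \<rho>})" by simp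
      also have "\<dots> \<le> (2 * (Y / real \<rho>) + 1)\<^sup>2" using d by (intro card_dist1_le) simp
      also have "\<dots> \<le> (3 * (Y / real \<rho>))\<^sup>2" using d by (intro power_mono) auto
      finally have 2: "real (card (Q p)) \<le> 9 * Y\<^sup>2 / (real \<rho>)\<^sup>2" by (simp add: power2_eq_square)
      show ?thesis unfolding G_def using 1 2 by simp
    qed
    have G0: "0 \<le> G" unfolding G_def by simp
    have "real (card (SIGMA p:{x. nrm x = \<rho>}. Q p)) = (\<Sum>p\<in>{x. nrm x = \<rho>}. real (card (Q p)))"
      using card_nrm_eq finQ by (simp add: of_nat_sum)
    also have "\<dots> \<le> (\<Sum>p\<in>{x. nrm x = \<rho>}. G)" using QG by (intro sum_mono) simp
    also have "\<dots> = real (card {x. nrm x = \<rho>}) * G" by simp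
    also have "\<dots> \<le> (2 * real \<rho>) * G"
    proof (rule mult_right_mono[OF _ G0])
      have "real (card {x. nrm x = \<rho>}) \<le> real (\<rho> + 1)" using card_nrm_eq of_nat_mono by blast
      then show "real (card {x. nrm x = \<rho>}) \<le> 2 * real \<rho>" using r1 by simp
    qed
    also have "\<dots> = F Y \<rho>"
    proof -
      have "(2 * real \<rho>) * (9 * Y\<^sup>2 / (real \<rho>)\<^sup>2) = 18 * Y\<^sup>2 / real \<rho>" "(2 * real \<rho>) * (4 * (real \<rho>)\<^sup>2) = 8 * (real \<rho>)^ 3"
        using r1 by (simp_all add: power2_eq_square power3_eq_cube)
      then show ?thesis unfolding G_def F_def using r1 by (simp add: min_mult_distrib_left)
    qed
    finally show "real (card (SIGMA p:{x. nrm x = \<rho>}. Q p)) \<le> F Y \<rho>" .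
  qed
  finally show ?thesis unfolding m_def .
qed

text \<open>The sum is split at \<open>a = sqrt Y\<close>. Below, at most \<open>a\<close> terms of
  size at most \<open>8 * a ^ 3\<close> give \<open>8 * Y\<^sup>2\<close>. Above, the harmonic sum
  yields \<open>ln (m / a)\<close>, which is half of \<open>ln (m\<^sup>2 / Y)\<close>; since
  \<open>m\<close> is at most \<open>R\<close> and at most \<open>Y\<close>, the minimum of the two
  regimes appears.\<close>

lemma near_pairs_card:
  assumes "0 \<le> Y"
  shows "real (card (near_pairs Y R)) \<le> 26 * Y\<^sup>2 + 9 * Y\<^sup>2 * max 0 (ln (min Y ((real R)\<^sup>2 / Y)))"
proof -
  define m where "m = min R (nat \<lfloor>Y\<rfloor>)"
  define L where "L = max 0 (ln (min Y ((real R)\<^sup>2 / Y)))"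
  define F where "F \<rho> = min (18 * Y\<^sup>2 / real \<rho>) (8 * (real \<rho>)^ 3)" for \<rho> :: nat
  have card: "real (card (near_pairs Y R)) \<le> (\<Sum>\<rho>\<in>{1..m}. F \<rho>)"
    using near_pairs_card_sum[OF assms, of R] by (simp add: m_def F_def)
  show ?thesis
  proof (cases "m = 0")
    case True
    then have "card (near_pairs Y R) = 0" using card by simp
    then show ?thesis by (simp add: assms)
  next
    case False
    then have m1: "1 \<le> real m" by simp
    have mR: "real m \<le> real R" and mY: "real m \<le> Y"
      using assms by (simp_all add: m_def) linarith
    have Y: "1 \<le> Y" using m1 mY by simp
    define a where "a = sqrt Y"
    have a: "0 < a" "a * a = Y" using Y by (simp_all add: a_def)
    have "(\<Sum>\<rho>\<in>{1..m}. F \<rho>) = (\<Sum>\<rho>\<in>H a m. F \<rho>) + (\<Sum>\<rho>\<in>{1..m} - H a m. F \<rho>)"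
      by (subst add.commute, rule sum.subset_diff) auto
    also have "(\<Sum>\<rho>\<in>H a m. F \<rho>) \<le> (\<Sum>\<rho>\<in>H a m. 18 * Y\<^sup>2 * (1 / real \<rho>))"
      unfolding F_def by (intro sum_mono) simp
    also have "\<dots> = 18 * Y\<^sup>2 * (\<Sum>\<rho>\<in>H a m. 1 / real \<rho>)" by (simp only: sum_distrib_left)
    also have "\<dots> \<le> 18 * Y\<^sup>2 * (1 + L / 2)"
    proof (rule mult_left_mono)
      have "real m * real m / Y \<le> Y"
      proof -
        have "real m * real m \<le> Y * Y" using m1 mY by (intro mult_mono) auto
        then show ?thesis using Y by (simp add: field_simps)
      qed
      moreover have "real m * real m / Y \<le> (real R)\<^sup>2 / Y"
        using m1 mR Y unfolding power2_eq_square by (intro divide_right_mono mult_mono) auto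
      ultimately have mm: "real m * real m / Y \<le> min Y ((real R)\<^sup>2 / Y)" by simp
      have "0 < real m * real m / Y" using m1 Y by simp
      then have "ln (real m * real m / Y) \<le> ln (min Y ((real R)\<^sup>2 / Y))"
        using mm by (meson ln_mono order_less_le_trans)
      moreover have "ln (real m * real m / Y) = 2 * ln (real m / a)"
      proof -
        have "real m * real m / Y = (real m / a) * (real m / a)" using a(2) by simp
        moreover have "0 < real m / a" using m1 a(1) by simp
        ultimately have "ln (real m * real m / Y) = ln (real m / a) + ln (real m / a)"
          by (simp only: ln_mult_pos)
        then show ?thesis by simp
      qed
      ultimately have "max 0 (ln (real m / a)) \<le> L / 2" unfolding L_def by linarith
      then show "(\<Sum>\<rho>\<in>H a m. 1 / real \<rho>) \<le> 1 + L / 2"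
        using harmonic_tail[OF a(1), of m] by linarith
    qed simp
    also have "(\<Sum>\<rho>\<in>{1..m} - H a m. F \<rho>) \<le> (\<Sum>\<rho>\<in>{1..m} - H a m. 8 * (a * Y))"
    proof (rule sum_mono)
      fix \<rho> assume "\<rho> \<in> {1..m} - H a m"
      then have "(real \<rho>) ^ 3 \<le> a ^ 3" by (intro power_mono) auto
      also have "a ^ 3 = a * Y" using a(2) by (simp add: power3_eq_cube)
      finally show "F \<rho> \<le> 8 * (a * Y)" unfolding F_def by simp
    qed
    also have "\<dots> = real (card ({1..m} - H a m)) * (8 * (a * Y))" by simp
    also have "\<dots> \<le> a * (8 * (a * Y))"
    proof (rule mult_right_mono)
      have "{1..m} - H a m \<subseteq> {1..nat \<lfloor>a\<rfloor>}" by (auto, meson le_nat_floor not_less)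
      then have "card ({1..m} - H a m) \<le> card {1..nat \<lfloor>a\<rfloor>}" by (intro card_mono) auto
      also have "\<dots> = nat \<lfloor>a\<rfloor>" by simp
      finally have "real (card ({1..m} - H a m)) \<le> real (nat \<lfloor>a\<rfloor>)" by simp
      also have "\<dots> \<le> a" using a(1) by simp
      finally show "real (card ({1..m} - H a m)) \<le> a" .
    qed (use a(1) Y in simp)
    also have "\<dots> = 8 * Y\<^sup>2" using a(2) by (metis mult.assoc mult.left_commute power2_eq_square)
    finally have "(\<Sum>\<rho>\<in>{1..m}. F \<rho>) \<le> 18 * Y\<^sup>2 * (1 + L / 2) + 8 * Y\<^sup>2" by simp
    also have "\<dots> = 26 * Y\<^sup>2 + 9 * Y\<^sup>2 * L" by (simp add: algebra_simps)
    finally show ?thesis using card unfolding L_def by linarith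
  qed
qed

section \<open>Crossings in the hexagonal drawing\<close>

locale hex_crossings = drawing n p for n p +
  fixes loc :: "nat \<Rightarrow> nat \<times> nat"
  assumes loc_range: "range loc = Lam" and loc_inj: "inj loc"
    and loc_mono: "\<And>i j. nrm (loc i) < nrm (loc j) \<Longrightarrow> i < j"
    and forced: "\<And>s t h y. s < n \<Longrightarrow> t < n \<Longrightarrow> h < n \<Longrightarrow> y < n \<Longrightarrow> forced_crossing loc s t h y \<Longrightarrow>
      open_segment (p s) (p t) \<inter> open_segment (p h) (p y) \<noteq> {}"
begin

abbreviation crosses :: "nat \<Rightarrow> nat \<Rightarrow> nat \<Rightarrow> nat \<Rightarrow> bool" where
  "crosses s t h y \<equiv> h < n \<and> y < n \<and> forced_crossing loc s t h y \<and> (h \<notin> {s, t} \<or> y \<notin> {s, t})"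

definition N :: nat where "N = n div 6"
text \<open>The \<open>n mod 6\<close> surplus vertices carry index \<open>N\<close>, so the norm at
  \<open>N\<close> itself bounds the norms of all vertices.\<close>

definition R :: nat where "R = nrm (loc N)"

lemma loc_Lam: "loc i \<in> Lam" using loc_range by auto

lemma vertex_lt: "i < N \<Longrightarrow> a < 6 \<Longrightarrow> 6 * i + a < n"
  unfolding N_def by linarith

lemma index_le: "6 * i + a < n \<Longrightarrow> i \<le> N"
  unfolding N_def by linarith

lemma nrm_le_R: "i \<le> N \<Longrightarrow> nrm (loc i) \<le> R"
  using loc_mono[of N i] unfolding R_def by fastforce

lemma index_lt: "nrm (loc i) < R \<Longrightarrow> i < N"
  using loc_mono[of i N] unfolding R_def by simp

lemma indices:
  assumes "Z \<subseteq> Lam" "finite Z"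
  shows "finite (loc -` Z)" "card (loc -` Z) = card Z"
  using assms loc_range loc_inj by (auto simp: finite_vimageI card_vimage_inj)

text \<open>Since the arms \<open>a\<close> and \<open>b\<close> differ, an edge reveals which of
  its ends comes from \<open>I\<close>, so no crossing edge is counted twice.\<close>

lemma crossing_count:
  assumes st: "s < n" "t < n" and ab: "a < 6" "b < 6" "a \<noteq> b" and fin: "finite I" "finite J"
    and IJ: "\<And>i j. i \<in> I \<Longrightarrow> j \<in> J \<Longrightarrow> crosses s t (6 * i + a) (6 * j + b)"
  shows "card I * card J \<le> card (crossing_edges n p {s, t})"
proof -
  define f where "f = (\<lambda>(i, j). {6 * i + a, 6 * j + b})"
  have "inj_on f (I \<times> J)"
  proof (rule inj_onI)
    fix x y assume "x \<in> I \<times> J" "y \<in> I \<times> J" and eq: "f x = f y"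
    obtain i j i' j' where xy: "x = (i, j)" "y = (i', j')" by (cases x, cases y) auto
    have ne: "6 * i + a \<noteq> 6 * j' + b"
    proof
      assume "6 * i + a = 6 * j' + b"
      then have "(6 * i + a) mod 6 = (6 * j' + b) mod 6" by simp
      then show False using ab by simp
    qed
    then have "6 * i + a = 6 * i' + a" "6 * j + b = 6 * j' + b"
      using eq unfolding xy f_def by (auto simp: doubleton_eq_iff)
    then show "x = y" unfolding xy by simp
  qed
  moreover have "f ` (I \<times> J) \<subseteq> crossing_edges n p {s, t}"
  proof
    fix e assume "e \<in> f ` (I \<times> J)"
    then obtain i j where ij: "i \<in> I" "j \<in> J" "e = {6 * i + a, 6 * j + b}" by (auto simp: f_def)
    have ne: "6 * i + a \<noteq> 6 * j + b"
    proof
      assume "6 * i + a = 6 * j + b"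
      then have "(6 * i + a) mod 6 = (6 * j + b) mod 6" by simp
      then show False using ab by simp
    qed
    then have "e \<in> K_edges n" unfolding ij using IJ[OF ij(1,2)] by (intro K_edgesI) auto
    moreover have "e \<noteq> {s, t}" using IJ[OF ij(1,2)] unfolding ij by auto
    moreover have "edge_interior p {s, t} \<inter> edge_interior p e \<noteq> {}"
      unfolding ij edge_interior_eq_open_segment using IJ[OF ij(1,2)] st by (intro forced) auto
    ultimately show "e \<in> crossing_edges n p {s, t}" by (simp add: crossing_edges_def)
  qed
  ultimately have "card (I \<times> J) \<le> card (crossing_edges n p {s, t})"
    using finite_crossing_edges by (rule card_inj_on_le)
  then show ?thesis by (simp add: card_cartesian_product)
qed

text \<open>Each counted lattice point below the chord between the two ends, joined to each of
  \<open>N\<close> vertices of the \<open>j\<close>-th next arm, gives an edge that crosses the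
  given one.\<close>

lemma same_arm_crossings:
  assumes a: "a < 6" and lt: "6 * i + a < n" "6 * i' + a < n" and j: "j \<in> {1, 2, 4, 5}"
    and less: "lam j (loc i) < lam j (loc i')"
  shows "(real (lam j (loc i')) - real (lam j (loc i)) - 1) * ((real (dep j (loc i)) + real (dep j (loc i'))) / 20 - 1) * real N
    \<le> card (crossing_edges n p {6 * i + a, 6 * i' + a})"
proof -
  define l1 y1 l2 y2 where "l1 = lam j (loc i)" "y1 = dep j (loc i)" "l2 = lam j (loc i')" "y2 = dep j (loc i')"
  note defs = this
  define Z where "Z = strip (res j) l1 y1 l2 y2"
  define b where "b = (a + j) mod 6"
  have b: "b < 6" "a \<noteq> b"
  proof -
    have "a \<in> {0, 1, 2, 3, 4, 5}" using a by auto
    then show "b < 6" "a \<noteq> b" unfolding b_def using j by auto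
  qed
  have cntZ: "(real l2 - real l1 - 1) * ((real y1 + real y2) / 20 - 1) \<le> card Z"
  proof -
    have "l1 < l2" using less by (simp only: defs)
    then show ?thesis unfolding Z_def by (rule strip_count)
  qed
  have below: "l1 < s \<and> s < l2 \<and> y mod 10 = res j s mod 10 \<and>
      real y * (real l2 - real l1) < real y1 * (real l2 - real s) + real y2 * (real s - real l1)" if "(s, y) \<in> Z" for s y
  proof -
    have "0 < real l2 - real l1" using less by (simp add: defs)
    then show ?thesis using that unfolding Z_def strip_def by (auto simp: pos_less_divide_eq)
  qed
  \<comment> \<open>For \<open>j = 1\<close> and \<open>j = 5\<close> the depth is at most
    \<open>lam j\<close> at both ends, hence along the chord and below it.\<close>
  have ys: "j = 2 \<or> j = 4 \<or> y \<le> s" if "(s, y) \<in> Z" for s y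
  proof (cases "j = 2 \<or> j = 4")
    case False
    then have dl: "real y1 \<le> real l1" "real y2 \<le> real l2" using j by (auto simp: defs lam_def dep_def)
    have z: "real l1 < real s" "real s < real l2" using below[OF that] by auto
    have "real y * (real l2 - real l1) < real y1 * (real l2 - real s) + real y2 * (real s - real l1)"
      using below[OF that] by blast
    also have "\<dots> \<le> real l1 * (real l2 - real s) + real l2 * (real s - real l1)"
      using dl z by (intro add_mono mult_right_mono) auto
    also have "\<dots> = real s * (real l2 - real l1)" by (simp add: algebra_simps)
    finally have "real y < real s" using z by simp
    then show ?thesis by simp
  qed auto
  have pt: "lam_pt j z \<in> Lam" "lam j (lam_pt j z) = fst z" "dep j (lam_pt j z) = snd z" if "z \<in> Z" for z
  proof -
    obtain s y where z: "z = (s, y)" by (cases z)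
    show "lam_pt j z \<in> Lam" "lam j (lam_pt j z) = fst z" "dep j (lam_pt j z) = snd z"
      using lam_pt[OF j] below[of s y] ys[of s y] that unfolding z by auto
  qed
  have "inj_on (lam_pt j) Z"
    using pt by (metis (no_types, lifting) inj_onI prod_eqI)
  then have cardI: "card (lam_pt j ` Z) = card Z" by (rule card_image)
  have finZ: "finite Z"
  proof (rule ccontr)
    assume "infinite Z"
    moreover have "Z \<subseteq> (SIGMA s:{..<l2}. {..y1 * l2 + y2 * l2})"
    proof
      fix z assume z: "z \<in> Z"
      obtain s y where sy: "z = (s, y)" by (cases z)
      have q: "real l1 < real s" "real s < real l2" using below[of s y] z sy by auto
      have "real y * 1 \<le> real y * (real l2 - real l1)" using less by (intro mult_left_mono) (auto simp: defs)
      also have "\<dots> < real y1 * (real l2 - real s) + real y2 * (real s - real l1)"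
        using below[of s y] z sy by blast
      also have "\<dots> \<le> real y1 * real l2 + real y2 * real l2"
        using q by (intro add_mono mult_left_mono) auto
      finally have "real y < real (y1 * l2 + y2 * l2)" by simp
      then have "y \<le> y1 * l2 + y2 * l2" by linarith
      then show "z \<in> (SIGMA s:{..<l2}. {..y1 * l2 + y2 * l2})" using q sy by auto
    qed
    then have "finite Z" by (rule finite_subset) simp
    ultimately show False by simp
  qed
  define I where "I = loc -` (lam_pt j ` Z)"
  have I: "finite I" "card I = card Z"
  proof -
    have sub: "lam_pt j ` Z \<subseteq> Lam" using pt(1) by (rule image_subsetI)
    show "finite I" "card I = card Z"
      unfolding I_def using indices[OF sub finite_imageI[OF finZ]] cardI by simp_all
  qed
  obtain \<kappa> \<omega> :: real where \<kappa>: "0 < \<kappa> * \<omega>" "\<And>x. slope_form j x = \<kappa> * real (lam j x)"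
    "\<And>loc a b c. orient (local_pos loc a) (local_pos loc b) (local_pos loc c) =
      \<omega> * ((real (lam j (loc b)) - real (lam j (loc a))) * (real (dep j (loc c)) - real (dep j (loc a)))
        - (real (dep j (loc b)) - real (dep j (loc a))) * (real (lam j (loc c)) - real (lam j (loc a))))"
    using slope_form_lam[OF j] by metis
  obtain mm where mm: "0 < mm" "\<And>x. lam j x + dep j x = mm * nrm x" using lam_dep_nrm[OF j] by metis
  have "card I * card {..<N} \<le> card (crossing_edges n p {6 * i + a, 6 * i' + a})"
  proof (rule crossing_count[OF lt a b(1,2) I(1)])
    show "finite {..<N}" by simp
    fix h y assume h: "h \<in> I" and y: "y \<in> {..<N}"
    obtain z where z: "z \<in> Z" "loc h = lam_pt j z" using h by (auto simp: I_def)
    define l3 y3 where "l3 = fst z" "y3 = snd z"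
    note d3 = this
    have lz: "lam j (loc h) = l3" "dep j (loc h) = y3" using pt(2,3)[OF z(1)] z(2) d3 by auto
    have bz: "real l1 < real l3" "real l3 < real l2"
      "real y3 * (real l2 - real l1) < real y1 * (real l2 - real l3) + real y2 * (real l3 - real l1)"
      using below[of l3 y3] z(1) d3 by auto
    have hn: "6 * h + a < n"
    proof -
      \<comment> \<open>If neither end had larger norm than \<open>h\<close>, then interpolating
        \<open>lam + dep\<close> between the ends would put \<open>h\<close> on or above the
        chord.\<close>
      have "nrm (loc h) < nrm (loc i) \<or> nrm (loc h) < nrm (loc i')"
      proof (rule ccontr)
        assume "\<not> ?thesis"
        then have "nrm (loc i) \<le> nrm (loc h)" "nrm (loc i') \<le> nrm (loc h)" by auto
        then have "mm * nrm (loc i) \<le> mm * nrm (loc h)" "mm * nrm (loc i') \<le> mm * nrm (loc h)" by simp_all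
        then have "l1 + y1 \<le> l3 + y3" "l2 + y2 \<le> l3 + y3" unfolding mm(2)[symmetric] lz by (simp_all add: defs)
        then have g: "real l1 + real y1 \<le> real l3 + real y3" "real l2 + real y2 \<le> real l3 + real y3" by linarith+
        have "(real l1 + real y1) * (real l2 - real l3) \<le> (real l3 + real y3) * (real l2 - real l3)"
          "(real l2 + real y2) * (real l3 - real l1) \<le> (real l3 + real y3) * (real l3 - real l1)"
          using bz by (intro mult_right_mono[OF g(1)] mult_right_mono[OF g(2)], simp)+
        then show False using bz(3) by (simp add: algebra_simps)
      qed
      then have "h < i \<or> h < i'" using loc_mono by blast
      then show ?thesis using lt by auto
    qed
    have yn: "6 * y + b < n" using vertex_lt[of y b] y b by simp
    have div: "(6 * x + a) div 6 = x" for x using a by simp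
    have mods: "(6 * i' + a) mod 6 = (6 * i + a) mod 6" "(6 * h + a) mod 6 = (6 * i + a) mod 6"
      "(6 * y + b) mod 6 = (6 * i + a + j) mod 6"
    proof -
      have "(6 * i + a + j) mod 6 = (a + j) mod 6" using mod_mult_self4[of 6 i "a + j"] by (simp only: add.assoc)
      moreover have "(6 * y + b) mod 6 = b mod 6" by (rule mod_mult_self4)
      ultimately show "(6 * y + b) mod 6 = (6 * i + a + j) mod 6" by (simp only: b_def mod_mod_trivial)
      show "(6 * i' + a) mod 6 = (6 * i + a) mod 6" "(6 * h + a) mod 6 = (6 * i + a) mod 6" by (simp_all only: mod_mult_self4)
    qed
    have k2: "0 < \<kappa> * \<kappa>" using \<kappa>(1) by (auto simp: zero_less_mult_iff)
    have "\<kappa> * \<kappa> * ((real l3 - real l1) * (real l3 - real l2)) < 0"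
      using k2 bz(1,2) by (simp add: mult_pos_neg)
    then have between: "(slope_form j (loc h) - slope_form j (loc i)) * (slope_form j (loc h) - slope_form j (loc i')) < 0"
      unfolding \<kappa>(2) lz by (simp add: defs algebra_simps)
    have "\<kappa> * \<omega> * ((real l2 - real l1) * ((real l2 - real l1) * (real y3 - real y1) - (real y2 - real y1) * (real l3 - real l1))) < 0"
    proof -
      have "(real l2 - real l1) * (real y3 - real y1) - (real y2 - real y1) * (real l3 - real l1) < 0"
        using bz(3) by (simp add: algebra_simps)
      then show ?thesis using bz(1,2) by (intro mult_pos_neg[OF \<kappa>(1)] mult_pos_neg) auto
    qed
    then have behind: "orient (local_pos loc i) (local_pos loc i') (local_pos loc h) * (slope_form j (loc i') - slope_form j (loc i)) < 0"
      unfolding \<kappa>(2,3) lz by (simp add: defs algebra_simps)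
    have "forced_crossing loc (6 * i + a) (6 * i' + a) (6 * h + a) (6 * y + b)"
      unfolding forced_crossing_def Let_def div using j mods between behind by blast
    moreover have "6 * y + b \<notin> {6 * i + a, 6 * i' + a}"
    proof
      assume "6 * y + b \<in> {6 * i + a, 6 * i' + a}"
      then have "(6 * y + b) mod 6 = (6 * i + a) mod 6" using mods(1) by (metis insertE singletonD)
      then show False using a b by simp
    qed
    ultimately show "crosses (6 * i + a) (6 * i' + a) (6 * h + a) (6 * y + b)"
      using hn yn by blast
  qed
  then have "real (card Z) * real N \<le> card (crossing_edges n p {6 * i + a, 6 * i' + a})"
    unfolding I(2) by (simp flip: of_nat_mult)
  moreover have "(real l2 - real l1 - 1) * ((real y1 + real y2) / 20 - 1) * real N \<le> real (card Z) * real N"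
    using cntZ by (intro mult_right_mono) auto
  ultimately show ?thesis unfolding defs by linarith
qed

text \<open>The coordinate with the larger sum over both ends serves as depth: \<open>v\<close> with
  directions 4 and 5, or \<open>u\<close> with directions 2 and 1. That sum is at least half of the
  total norm, so a total of at least 80 makes it at least 40.\<close>

lemma same_arm_low:
  assumes a: "a < 6" and lt: "6 * i + a < n" "6 * i' + a < n" and ne: "i \<noteq> i'" and N0: "0 < N"
    and low: "card (crossing_edges n p {6 * i + a, 6 * i' + a}) \<le> k"
  shows "nrm (loc i) + nrm (loc i') < 80 \<or>
    real (nrm (loc i) + nrm (loc i')) * dist1 (loc i) (loc i') \<le> 640 * (real k / real N)"
proof -
  define y where "y = real k / real N"
  obtain u v u' v' where uv: "loc i = (u, v)" "loc i' = (u', v')" by (cases "loc i", cases "loc i'") auto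
  have bound: "(\<bar>int (lam j (loc i)) - int (lam j (loc i'))\<bar> - 1) * ((real (dep j (loc i)) + real (dep j (loc i'))) / 20 - 1) \<le> y"
    if j: "j \<in> {1, 2, 4, 5}" and d: "int (lam j (loc i)) - int (lam j (loc i')) \<noteq> 0" for j
  proof -
    have "(\<bar>int (lam j (loc i)) - int (lam j (loc i'))\<bar> - 1) * ((real (dep j (loc i)) + real (dep j (loc i'))) / 20 - 1) * real N \<le> real k"
    proof (cases "lam j (loc i) < lam j (loc i')")
      case True
      then have "real_of_int (\<bar>int (lam j (loc i)) - int (lam j (loc i'))\<bar> - 1) = real (lam j (loc i')) - real (lam j (loc i)) - 1" by simp
      then show ?thesis using same_arm_crossings[OF a lt j True] low by simp
    next
      case False
      then have l: "lam j (loc i') < lam j (loc i)" using d by simp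
      then have "real_of_int (\<bar>int (lam j (loc i)) - int (lam j (loc i'))\<bar> - 1) = real (lam j (loc i)) - real (lam j (loc i')) - 1" by simp
      then show ?thesis using same_arm_crossings[OF a lt(2,1) j l] low by (simp add: insert_commute add.commute)
    qed
    then show ?thesis unfolding y_def using N0 by (simp add: field_simps)
  qed
  show ?thesis
  proof (cases "nrm (loc i) + nrm (loc i') < 80")
    case False
    then have r: "80 \<le> u + u' + v + v'" by (simp add: nrm_def uv)
    define da where "da = int u - int u'"
    define db where "db = int v - int v'"
    have "loc i \<noteq> loc i'" using ne loc_inj by (auto dest: injD)
    then have nz: "da \<noteq> 0 \<or> db \<noteq> 0" using uv by (auto simp: da_def db_def)
    have "u mod 5 = v mod 5" "u' mod 5 = v' mod 5" using loc_Lam[of i] loc_Lam[of i'] uv by (auto simp: Lam_def)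
    then have "int u mod 5 = int v mod 5" "int u' mod 5 = int v' mod 5" by (metis zmod_int of_nat_numeral)+
    then have md: "da mod 5 = db mod 5" unfolding da_def db_def by (rule mod_diff_cong)
    have b4: "da \<noteq> 0 \<Longrightarrow> (\<bar>da\<bar> - 1) * ((real v + real v') / 20 - 1) \<le> y"
      using bound[of 4] by (simp add: uv lam_def dep_def da_def)
    have b5: "2 * da + db \<noteq> 0 \<Longrightarrow> (\<bar>2 * da + db\<bar> - 1) * ((real v + real v') / 20 - 1) \<le> y"
    proof -
      have "int (lam 5 (loc i)) - int (lam 5 (loc i')) = 2 * da + db" by (simp add: uv lam_def da_def db_def)
      then show "2 * da + db \<noteq> 0 \<Longrightarrow> ?thesis" using bound[of 5] by (simp add: uv dep_def)
    qed
    have b2: "db \<noteq> 0 \<Longrightarrow> (\<bar>db\<bar> - 1) * ((real u + real u') / 20 - 1) \<le> y"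
      using bound[of 2] by (simp add: uv lam_def dep_def db_def)
    have b1: "2 * db + da \<noteq> 0 \<Longrightarrow> (\<bar>2 * db + da\<bar> - 1) * ((real u + real u') / 20 - 1) \<le> y"
    proof -
      have "int (lam 1 (loc i)) - int (lam 1 (loc i')) = 2 * db + da" by (simp add: uv lam_def da_def db_def)
      then show "2 * db + da \<noteq> 0 \<Longrightarrow> ?thesis" using bound[of 1] by (simp add: uv dep_def)
    qed
    define r where "r = real (nrm (loc i) + nrm (loc i'))"
    have rr: "r = (real u + real u') + (real v + real v')" by (simp add: r_def uv nrm_def)
    have r80: "80 \<le> (real u + real u') + (real v + real v')" using r by linarith
    have ds: "dist1 (loc i) (loc i') = real_of_int (\<bar>da\<bar> + \<bar>db\<bar>)" by (simp add: dist1_def uv da_def db_def)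
    have "r * (\<bar>da\<bar> + \<bar>db\<bar>) \<le> 640 * y"
    proof (cases "real u + real u' \<le> real v + real v'")
      case True
      then show ?thesis using separation_arith[OF md nz b4 b5, of r] rr r80 by simp
    next
      case False
      have nz': "db \<noteq> 0 \<or> da \<noteq> 0" using nz by auto
      show ?thesis using separation_arith[OF md[symmetric] nz' b2 b1, of r] rr r80 False by (simp add: add.commute)
    qed
    then show ?thesis unfolding r_def y_def ds by simp
  qed simp
qed

end

section \<open>The size of an arm and two large boxes near its outer ends\<close>

context hex_crossings
begin

text \<open>All points \<open>(5 * a, 5 * b)\<close> belong to \<open>Lam\<close>. For
  \<open>a\<close> and \<open>b\<close> up to \<open>(\<rho> - 1) div 20\<close>, twice their norm
  stays below \<open>\<rho>\<close>.\<close>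

lemma lattice_count: "\<rho>\<^sup>2 \<le> 400 * card {x \<in> Lam. 2 * nrm x < \<rho>}"
proof (cases "\<rho> = 0")
  case False
  define c where "c = (\<rho> - 1) div 20"
  define f where "f = (\<lambda>(a, b). (5 * a, 5 * b) :: nat \<times> nat)"
  have c: "20 * c \<le> \<rho> - 1" "\<rho> \<le> 20 * (c + 1)"
  proof -
    define r where "r = (\<rho> - 1) mod 20"
    have r: "r < 20" "\<rho> - 1 = 20 * c + r" unfolding r_def c_def by simp_all
    then have "\<rho> = 20 * c + r + 1" using False by simp
    then show "20 * c \<le> \<rho> - 1" "\<rho> \<le> 20 * (c + 1)" using r(1) by simp_all
  qed
  have "f ` ({..c} \<times> {..c}) \<subseteq> {x \<in> Lam. 2 * nrm x < \<rho>}"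
    using c False by (auto simp: f_def Lam_def nrm_def)
  moreover have "finite {x \<in> Lam. 2 * nrm x < \<rho>}"
    by (rule finite_subset[OF _ finite_nrm_le[of \<rho>]]) auto
  ultimately have "card (f ` ({..c} \<times> {..c})) \<le> card {x \<in> Lam. 2 * nrm x < \<rho>}" by (intro card_mono)
  moreover have "card (f ` ({..c} \<times> {..c})) = (c + 1)\<^sup>2"
    by (subst card_image) (auto simp: f_def inj_on_def card_cartesian_product power2_eq_square)
  moreover have "\<rho>\<^sup>2 \<le> (20 * (c + 1))\<^sup>2" using c by (intro power_mono) auto
  moreover have "(20 * (c + 1))\<^sup>2 = 400 * (c + 1)\<^sup>2" unfolding power_mult_distrib by simp
  ultimately show ?thesis by linarith
qed simp

lemma R_sq_le: "R\<^sup>2 \<le> 100 * N"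
proof -
  have "loc -` {x \<in> Lam. 2 * nrm x < 2 * R} \<subseteq> {..<N}" using index_lt by auto
  then have "card (loc -` {x \<in> Lam. 2 * nrm x < 2 * R}) \<le> card {..<N}" by (intro card_mono) auto
  moreover have "finite {x \<in> Lam. 2 * nrm x < 2 * R}"
    by (rule finite_subset[OF _ finite_nrm_le[of R]]) auto
  ultimately have "card {x \<in> Lam. 2 * nrm x < 2 * R} \<le> N"
    using indices(2)[of "{x \<in> Lam. 2 * nrm x < 2 * R}"] by auto
  then show ?thesis using lattice_count[of "2 * R"] by (simp add: power_mult_distrib)
qed

lemma N_le_R: "N \<le> (R + 1)\<^sup>2"
proof -
  have "loc ` {..<N} \<subseteq> {x. nrm x \<le> R}" using nrm_le_R by auto
  then have "card (loc ` {..<N}) \<le> card {x. nrm x \<le> R}" by (intro card_mono finite_nrm_le)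
  then show ?thesis using card_nrm_le[of R] loc_inj by (simp add: card_image inj_on_subset)
qed

definition box_size :: nat where "box_size = R div 100"

lemma box_size_bounds: "100 * box_size \<le> R" "R < 100 * box_size + 100"
proof -
  have "R mod 100 < 100" by simp
  then show "100 * box_size \<le> R" "R < 100 * box_size + 100"
    using div_mult_mod_eq[of R 100] unfolding box_size_def by linarith+
qed

text \<open>The points have \<open>u\<close> between about 0.85 \<open>R\<close> and 0.9
  \<open>R\<close> and \<open>v\<close> below about 0.05 \<open>R\<close>, so \<open>lam 5\<close>
  exceeds \<open>3 * R / 2\<close> and \<open>lam 1\<close> does not. As
  \<open>lam 1 + lam 5\<close> is three times the norm, no vertex exceeds this threshold in both
  forms. The left box is the mirror image.\<close>

definition right_box :: "(nat \<times> nat) set" where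
  "right_box = (\<lambda>(a, b). (5 * (17 * box_size + a), 5 * b)) ` ({..<box_size} \<times> {..<box_size})"

definition left_box :: "(nat \<times> nat) set" where
  "left_box = (\<lambda>(a, b). (5 * b, 5 * (17 * box_size + a))) ` ({..<box_size} \<times> {..<box_size})"

lemma boxes:
  "finite right_box" "right_box \<subseteq> Lam" "card right_box = box_size\<^sup>2"
  "finite left_box" "left_box \<subseteq> Lam" "card left_box = box_size\<^sup>2"
  unfolding right_box_def left_box_def
  by (auto simp: Lam_def card_image inj_on_def card_cartesian_product power2_eq_square)

lemma right_box_bounds:
  assumes "1000 \<le> R" "x \<in> right_box"
  shows "nrm x < R" "3 * R < 2 * lam 5 x" "2 * lam 1 x < 3 * R"
proof -
  have m: "10 \<le> box_size" "100 * box_size \<le> R" "R < 100 * box_size + 100"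
    using assms(1) box_size_bounds by linarith+
  obtain a b where ab: "x = (5 * (17 * box_size + a), 5 * b)" "a < box_size" "b < box_size"
    using assms(2) by (auto simp: right_box_def)
  show "nrm x < R" "3 * R < 2 * lam 5 x" "2 * lam 1 x < 3 * R"
    using ab m by (auto simp: nrm_def lam_def)
qed

lemma left_box_bounds:
  assumes "1000 \<le> R" "x \<in> left_box"
  shows "nrm x < R" "3 * R < 2 * lam 1 x" "2 * lam 5 x < 3 * R"
proof -
  have m: "10 \<le> box_size" "100 * box_size \<le> R" "R < 100 * box_size + 100"
    using assms(1) box_size_bounds by linarith+
  obtain a b where ab: "x = (5 * b, 5 * (17 * box_size + a))" "a < box_size" "b < box_size"
    using assms(2) by (auto simp: left_box_def)
  show "nrm x < R" "3 * R < 2 * lam 1 x" "2 * lam 5 x < 3 * R"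
    using ab m by (auto simp: nrm_def lam_def)
qed

lemma N_le_box:
  assumes "1000 \<le> R"
  shows "N \<le> 15000 * box_size\<^sup>2"
proof -
  have "R + 1 \<le> 110 * box_size"
  proof -
    have "10 \<le> box_size" using assms box_size_bounds by linarith
    then show ?thesis using box_size_bounds(2) by linarith
  qed
  then have "(R + 1)\<^sup>2 \<le> (110 * box_size)\<^sup>2" by (rule power_mono) simp
  moreover have "(110 * box_size)\<^sup>2 = 12100 * box_size\<^sup>2" unfolding power_mult_distrib by simp
  ultimately show ?thesis using N_le_R by linarith
qed

lemma box_le_N:
  assumes "1000 \<le> R"
  shows "box_size\<^sup>2 \<le> N"
proof -
  have "loc -` right_box \<subseteq> {..<N}" using index_lt right_box_bounds(1)[OF assms] by auto
  then have "card (loc -` right_box) \<le> card {..<N}" by (intro card_mono) auto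
  then show ?thesis using indices(2)[OF boxes(2,1)] boxes(3) by simp
qed

section \<open>Edges between different arms\<close>

lemma arm_mod: "a < 6 \<Longrightarrow> (6 * i + a) mod 6 = (a::nat)" "a < 6 \<Longrightarrow> (6 * i + a) div 6 = (i::nat)"
  by simp_all

lemma arm_neq: "a < 6 \<Longrightarrow> b < 6 \<Longrightarrow> a \<noteq> b \<Longrightarrow> 6 * i + a \<noteq> 6 * j + (b::nat)"
  by (metis arm_mod(1))

lemma arm_shift: "(6 * i + a + j) mod 6 = (a + j) mod (6::nat)"
  using mod_mult_self4[of 6 i "a + j"] by (simp only: add.assoc)

text \<open>If \<open>lam 1\<close> exceeded \<open>3 * R / 2\<close> at the end \<open>i\<close>,
  all edges from the right box of its arm to the previous arm would cross, which is too many;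
  likewise for \<open>lam 5\<close> at \<open>i'\<close>. Hence the right box of the next arm lies
  beyond \<open>i'\<close>, and joining it to the points of less than half the norm of
  \<open>i\<close> gives crossings. The number of these points is quadratic in the norm of
  \<open>i\<close>; the left box does the same for \<open>i'\<close>.\<close>

lemma side_edge_low:
  assumes R: "1000 \<le> R" and a: "a < 6" and b: "b = (a + 1) mod 6" and lt: "6 * i + a < n" "6 * i' + b < n"
    and k: "k < N * box_size\<^sup>2" and low: "card (crossing_edges n p {6 * i + a, 6 * i' + b}) \<le> k"
  shows "(nrm (loc i))\<^sup>2 * box_size\<^sup>2 \<le> 400 * k \<and> (nrm (loc i'))\<^sup>2 * box_size\<^sup>2 \<le> 400 * k"
proof -
  define c where "c = (a + 5) mod 6"
  define d where "d = (a + 2) mod 6"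
  have arms: "b < 6" "c < 6" "d < 6" "a \<noteq> b" "a \<noteq> c" "b \<noteq> c" "b \<noteq> d" "a \<noteq> d"
  proof -
    have "a \<in> {0, 1, 2, 3, 4, 5}" using a by auto
    then show "b < 6" "c < 6" "d < 6" "a \<noteq> b" "a \<noteq> c" "b \<noteq> c" "b \<noteq> d" "a \<noteq> d"
      unfolding b c_def d_def by auto
  qed
  define TR where "TR = loc -` right_box"
  define TL where "TL = loc -` left_box"
  have TR: "finite TR" "card TR = box_size\<^sup>2" unfolding TR_def using indices[OF boxes(2,1)] boxes(3) by auto
  have TL: "finite TL" "card TL = box_size\<^sup>2" unfolding TL_def using indices[OF boxes(5,4)] boxes(6) by auto
  have inTR: "h < N" "3 * R < 2 * lam 5 (loc h)" "2 * lam 1 (loc h) < 3 * R" if "h \<in> TR" for h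
    using that right_box_bounds[OF R, of "loc h"] index_lt by (auto simp: TR_def)
  have inTL: "h < N" "3 * R < 2 * lam 1 (loc h)" "2 * lam 5 (loc h) < 3 * R" if "h \<in> TL" for h
    using that left_box_bounds[OF R, of "loc h"] index_lt by (auto simp: TL_def)
  have iN: "nrm (loc i) \<le> R" "nrm (loc i') \<le> R"
    using lt index_le by (auto intro!: nrm_le_R)
  have mods: "b = (6 * i + a + 1) mod 6" "c = (6 * i + a + 5) mod 6" "d = (6 * i + a + 2) mod 6"
    unfolding arm_shift b c_def d_def by simp_all
  have s1: "2 * lam 1 (loc i) \<le> 3 * R"
  proof (rule ccontr)
    assume big: "\<not> 2 * lam 1 (loc i) \<le> 3 * R"
    then have small: "2 * lam 5 (loc i) \<le> 3 * R" using lam1_5(1)[of "loc i"] iN(1) by linarith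
    have "card TR * card {..<N} \<le> card (crossing_edges n p {6 * i + a, 6 * i' + b})"
    proof (rule crossing_count[OF lt a arms(2,5) TR(1)])
      show "finite {..<N}" by simp
      fix h y assume hy: "h \<in> TR" "y \<in> {..<N}"
      have "6 * h + a < n" "6 * y + c < n" using vertex_lt[of h a] vertex_lt[of y c] inTR(1) hy a arms by auto
      moreover have "6 * y + c \<notin> {6 * i + a, 6 * i' + b}"
        using arm_neq[of c a] arm_neq[of c b] a arms by auto
      moreover have "slope_form 1 (loc i) < slope_form 1 (loc h)" "slope_form 5 (loc i) < slope_form 5 (loc h)"
        using inTR(2,3)[OF hy(1)] big small unfolding slope_form_1_5 by simp_all
      then have "forced_crossing loc (6 * i + a) (6 * i' + b) (6 * h + a) (6 * y + c)"
        unfolding forced_crossing_def Let_def arm_mod[OF a] arm_mod[OF arms(1)] arm_mod[OF arms(2)]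
        using mods by blast
      ultimately show "crosses (6 * i + a) (6 * i' + b) (6 * h + a) (6 * y + c)" by blast
    qed
    then show False using low k TR(2) by (simp add: mult.commute)
  qed
  have s5: "2 * lam 5 (loc i') \<le> 3 * R"
  proof (rule ccontr)
    assume big: "\<not> 2 * lam 5 (loc i') \<le> 3 * R"
    then have small: "2 * lam 1 (loc i') \<le> 3 * R" using lam1_5(1)[of "loc i'"] iN(2) by linarith
    have "card TL * card {..<N} \<le> card (crossing_edges n p {6 * i + a, 6 * i' + b})"
    proof (rule crossing_count[OF lt arms(1,3,7) TL(1)])
      show "finite {..<N}" by simp
      fix h y assume hy: "h \<in> TL" "y \<in> {..<N}"
      have "6 * h + b < n" "6 * y + d < n" using vertex_lt[of h b] vertex_lt[of y d] inTL(1) hy arms by auto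
      moreover have "6 * y + d \<notin> {6 * i + a, 6 * i' + b}"
        using arm_neq[of d a] arm_neq[of d b] a arms by auto
      moreover have "slope_form 5 (loc h) < slope_form 5 (loc i')" "slope_form 1 (loc h) < slope_form 1 (loc i')"
        using inTL(2,3)[OF hy(1)] big small unfolding slope_form_1_5 by simp_all
      then have "forced_crossing loc (6 * i + a) (6 * i' + b) (6 * h + b) (6 * y + d)"
        unfolding forced_crossing_def Let_def arm_mod[OF a] arm_mod[OF arms(1)] arm_mod[OF arms(3)]
        using mods by blast
      ultimately show "crosses (6 * i + a) (6 * i' + b) (6 * h + b) (6 * y + d)" by blast
    qed
    then show False using low k TL(2) by (simp add: mult.commute)
  qed
  have par: "card I * card J \<le> k"
    if fin: "finite I" "finite J" and I: "\<And>h. h \<in> I \<Longrightarrow> 6 * h + a < n" and J: "\<And>y. y \<in> J \<Longrightarrow> 6 * y + b < n"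
      and opp: "\<And>h y. h \<in> I \<Longrightarrow> y \<in> J \<Longrightarrow> lam 1 (loc h) < lam 1 (loc i) \<and> lam 5 (loc i') < lam 5 (loc y) \<or>
        lam 1 (loc i) < lam 1 (loc h) \<and> lam 5 (loc y) < lam 5 (loc i')" for I J
  proof -
    have "card I * card J \<le> card (crossing_edges n p {6 * i + a, 6 * i' + b})"
    proof (rule crossing_count[OF lt a arms(1,4) fin])
      fix h y assume hy: "h \<in> I" "y \<in> J"
      have "h \<noteq> i" using opp[OF hy] by auto
      then have "6 * h + a \<notin> {6 * i + a, 6 * i' + b}" using arm_neq[OF a arms(1,4)] by auto
      moreover have "(slope_form 1 (loc i) - slope_form 1 (loc h)) * (slope_form 5 (loc y) - slope_form 5 (loc i')) < 0"
        using opp[OF hy] unfolding slope_form_1_5 by (auto simp: mult_less_0_iff)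
      then have "forced_crossing loc (6 * i + a) (6 * i' + b) (6 * h + a) (6 * y + b)"
        unfolding forced_crossing_def Let_def arm_mod[OF a] arm_mod[OF arms(1)]
        using mods by blast
      ultimately show "crosses (6 * i + a) (6 * i' + b) (6 * h + a) (6 * y + b)"
        using I[OF hy(1)] J[OF hy(2)] by blast
    qed
    then show ?thesis using low by linarith
  qed
  define D where "D \<rho> = loc -` {x \<in> Lam. 2 * nrm x < \<rho>}" for \<rho>
  have D: "finite (D \<rho>)" "\<rho>\<^sup>2 \<le> 400 * card (D \<rho>)" for \<rho>
  proof -
    have "finite {x \<in> Lam. 2 * nrm x < \<rho>}"
      by (rule finite_subset[OF _ finite_nrm_le[of \<rho>]]) auto
    then show "finite (D \<rho>)" "\<rho>\<^sup>2 \<le> 400 * card (D \<rho>)"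
      unfolding D_def using indices[of "{x \<in> Lam. 2 * nrm x < \<rho>}"] lattice_count[of \<rho>] by auto
  qed
  have Dlt: "2 * nrm (loc h) < \<rho>" if "h \<in> D \<rho>" for h \<rho> using that by (simp add: D_def)
  \<comment> \<open>\<open>lam 1\<close> and \<open>lam 5\<close> lie between once and twice the
    norm, so less than half the norm of \<open>i\<close> guarantees a smaller
    \<open>lam 1\<close>.\<close>
  have "card (D (nrm (loc i))) * card TR \<le> k"
  proof (rule par[OF D(1) TR(1)])
    fix h assume h: "h \<in> D (nrm (loc i))"
    have "h < i" by (rule loc_mono) (use Dlt[OF h] in linarith)
    then show "6 * h + a < n" using lt(1) by linarith
  next
    fix y assume "y \<in> TR"
    then show "6 * y + b < n" using inTR(1) vertex_lt arms(1) by blast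
  next
    fix h y assume hy: "h \<in> D (nrm (loc i))" "y \<in> TR"
    show "lam 1 (loc h) < lam 1 (loc i) \<and> lam 5 (loc i') < lam 5 (loc y) \<or>
        lam 1 (loc i) < lam 1 (loc h) \<and> lam 5 (loc y) < lam 5 (loc i')"
      using Dlt[OF hy(1)] lam1_5(3)[of "loc h"] lam1_5(2)[of "loc i"] inTR(2)[OF hy(2)] s5 by linarith
  qed
  moreover have "card TL * card (D (nrm (loc i'))) \<le> k"
  proof (rule par[OF TL(1) D(1)])
    fix h assume h: "h \<in> D (nrm (loc i'))"
    have "h < i'" by (rule loc_mono) (use Dlt[OF h] in linarith)
    then show "6 * h + b < n" using lt(2) by linarith
  next
    fix y assume "y \<in> TL"
    then show "6 * y + a < n" using inTL(1) vertex_lt a by blast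
  next
    fix h y assume hy: "h \<in> TL" "y \<in> D (nrm (loc i'))"
    show "lam 1 (loc h) < lam 1 (loc i) \<and> lam 5 (loc i') < lam 5 (loc y) \<or>
        lam 1 (loc i) < lam 1 (loc h) \<and> lam 5 (loc y) < lam 5 (loc i')"
      using Dlt[OF hy(2)] lam1_5(5)[of "loc y"] lam1_5(4)[of "loc i'"] inTL(2)[OF hy(1)] s1 by linarith
  qed
  ultimately have fin: "card (D (nrm (loc i))) * box_size\<^sup>2 \<le> k" "card (D (nrm (loc i'))) * box_size\<^sup>2 \<le> k"
    unfolding TR(2) TL(2) by (simp_all add: mult.commute)
  have "\<rho>\<^sup>2 * box_size\<^sup>2 \<le> 400 * k" if "card (D \<rho>) * box_size\<^sup>2 \<le> k" for \<rho>
  proof -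
    have "\<rho>\<^sup>2 * box_size\<^sup>2 \<le> (400 * card (D \<rho>)) * box_size\<^sup>2" using D(2) by (rule mult_right_mono) simp
    also have "\<dots> \<le> 400 * k" unfolding mult.assoc using that by (rule mult_left_mono) simp
    finally show ?thesis .
  qed
  then show ?thesis using fin by blast
qed

text \<open>The edges between the arms \<open>a + 1\<close> and \<open>a + 4\<close> all cross the
  given one.\<close>

lemma diagonal_crossings:
  assumes a: "a < 6" and b: "b = (a + 2) mod 6 \<or> b = (a + 3) mod 6" and lt: "6 * i + a < n" "6 * i' + b < n"
  shows "N * N \<le> card (crossing_edges n p {6 * i + a, 6 * i' + b})"
proof -
  define c where "c = (a + 1) mod 6"
  define d where "d = (a + 4) mod 6"
  have arms: "b < 6" "c < 6" "d < 6" "c \<noteq> d" "c \<noteq> a" "c \<noteq> b"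
  proof -
    have "a \<in> {0, 1, 2, 3, 4, 5}" using a by auto
    then show "b < 6" "c < 6" "d < 6" "c \<noteq> d" "c \<noteq> a" "c \<noteq> b"
      using b unfolding c_def d_def by auto
  qed
  have mods: "c = (6 * i + a + 1) mod 6" "d = (6 * i + a + 4) mod 6"
    "b = (6 * i + a + 2) mod 6 \<or> b = (6 * i + a + 3) mod 6"
    unfolding arm_shift using b by (simp_all add: c_def d_def)
  have "card {..<N} * card {..<N} \<le> card (crossing_edges n p {6 * i + a, 6 * i' + b})"
  proof (rule crossing_count[OF lt arms(2,3,4)])
    fix h y assume hy: "h \<in> {..<N}" "y \<in> {..<N}"
    have "6 * h + c < n" "6 * y + d < n" using vertex_lt[of h c] vertex_lt[of y d] hy arms by auto
    moreover have "6 * h + c \<notin> {6 * i + a, 6 * i' + b}"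
      using arm_neq[of c a] arm_neq[of c b] a arms by auto
    moreover have "forced_crossing loc (6 * i + a) (6 * i' + b) (6 * h + c) (6 * y + d)"
      unfolding forced_crossing_def Let_def arm_mod[OF a] arm_mod[OF arms(1)] arm_mod[OF arms(2)] arm_mod[OF arms(3)]
      using mods by blast
    ultimately show "crosses (6 * i + a) (6 * i' + b) (6 * h + c) (6 * y + d)" by blast
  qed auto
  then show ?thesis by simp
qed

section \<open>The number of lightly crossed edges of the hexagonal drawing\<close>

lemma low_edge_cases:
  assumes e: "e \<in> K_edges n" "card (crossing_edges n p e) \<le> k" and R: "1000 \<le> R" and k: "k < N * box_size\<^sup>2"
  shows "\<exists>a<6. \<exists>i i'. (e = {6 * i + a, 6 * i' + a} \<and> i \<noteq> i' \<and> 6 * i + a < n \<and> 6 * i' + a < n \<and> nrm (loc i') \<le> nrm (loc i)) \<or>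
    (e = {6 * i + a, 6 * i' + (a + 1) mod 6} \<and> 6 * i + a < n \<and> 6 * i' + (a + 1) mod 6 < n)"
proof -
  obtain s t where st: "e = {s, t}" "s \<noteq> t" "s < n" "t < n" using e(1) by (rule K_edgesE)
  define a i b i' where "a = s mod 6" "i = s div 6" "b = t mod 6" "i' = t div 6"
  note defs = this
  have ab: "a < 6" "b < 6" by (simp_all add: defs)
  have s: "s = 6 * i + a" and t: "t = 6 * i' + b" by (simp_all add: defs)
  have kN: "k < N * N" using k box_le_N[OF R] by (meson less_le_trans mult_le_mono2)
  have nd: "\<not> (b = (a + 2) mod 6 \<or> b = (a + 3) mod 6)"
    using diagonal_crossings[OF ab(1), of b i i'] st e(2) kN unfolding s t st by fastforce
  have nd': "\<not> (a = (b + 2) mod 6 \<or> a = (b + 3) mod 6)"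
    using diagonal_crossings[OF ab(2), of a i' i] st e(2) kN unfolding s t st insert_commute[of _ "6 * i' + b"] by fastforce
  have "a \<in> {0, 1, 2, 3, 4, 5}" "b \<in> {0, 1, 2, 3, 4, 5}" using ab by auto
  then consider "a = b" | "b = (a + 1) mod 6" | "a = (b + 1) mod 6"
    using nd nd' by auto
  then show ?thesis
  proof cases
    case 1
    then have ne: "i \<noteq> i'" using st s t by auto
    consider "nrm (loc i') \<le> nrm (loc i)" | "nrm (loc i) \<le> nrm (loc i')" by linarith
    then show ?thesis
    proof cases
      case 1
      then show ?thesis using \<open>a = b\<close> ne st s t ab by blast
    next
      case 2
      then show ?thesis using \<open>a = b\<close> ne[symmetric] st s t ab insert_commute[of s t "{}"] by blast
    qed
  next
    case 2
    then show ?thesis using st s t ab by blast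
  next
    case 3
    then show ?thesis using st s t ab insert_commute[of s t "{}"] by blast
  qed
qed

text \<open>The number 40960000 is the square of 6400, which bounds the points of norm at most 79.
  The last term counts edges between adjacent arms: both ends lie in \<open>Q\<close>, which has
  only O(\<open>y\<close> + 1) points, so no logarithm arises from them. Its constant comes from 400
  * 15000 and from \<open>(B + 1)\<^sup>2 \<le> 2 * B\<^sup>2 + 2\<close>.\<close>

lemma S_le_counts:
  assumes R: "1000 \<le> R" and k: "k < N * box_size\<^sup>2" and N0: "0 < N"
  defines "y \<equiv> real k / real N"
  shows "real (S k (K_edges n) p) \<le> 6 * (40960000 + real (card (near_pairs (640 * y) R))) + 6 * (12000000 * y + 2)\<^sup>2"
proof -
  define PA where "PA = {x. nrm x \<le> 79} \<times> {x. nrm x \<le> 79} \<union> near_pairs (640 * y) R"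
  define Q where "Q = {x. (nrm x)\<^sup>2 * box_size\<^sup>2 \<le> 400 * k}"
  define IA where "IA = (\<lambda>(i, i'). (loc i, loc i')) -` PA"
  define IB where "IB = (loc -` Q) \<times> (loc -` Q)"
  define f where "f = (\<lambda>(a, i, i'). {6 * i + a, 6 * i' + a :: nat})"
  define g where "g = (\<lambda>(a, i, i'). {6 * i + a, 6 * i' + (a + 1) mod 6 :: nat})"
  have b0: "0 < box_size" using k by (cases "box_size = 0") auto
  have injp: "inj (\<lambda>(i, i'). (loc i, loc i'))" using loc_inj by (auto simp: inj_on_def)
  have finPA: "finite PA" unfolding PA_def using finite_nrm_le finite_near_pairs by auto
  have cPA: "real (card PA) \<le> 40960000 + real (card (near_pairs (640 * y) R))"
  proof -
    have c: "card {x. nrm x \<le> 79} \<le> 6400" using card_nrm_le[of 79] by simp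
    have "card PA \<le> card ({x. nrm x \<le> 79} \<times> {x. nrm x \<le> 79}) + card (near_pairs (640 * y) R)"
      unfolding PA_def by (rule card_Un_le)
    also have "card ({x. nrm x \<le> 79} \<times> {x. nrm x \<le> 79}) \<le> 6400 * 6400"
      unfolding card_cartesian_product using c by (rule mult_le_mono[OF c])
    finally show ?thesis by simp
  qed
  have finIA: "finite IA" and cIA: "card IA \<le> card PA"
    unfolding IA_def using finite_vimageI[OF finPA injp] card_vimage_inj_on_le[of "\<lambda>(i, i'). (loc i, loc i')" UNIV PA] injp finPA by auto
  define B where "B = nat \<lfloor>sqrt (400 * real k / (real box_size)\<^sup>2)\<rfloor>"
  have nn: "0 \<le> 400 * real k / (real box_size)\<^sup>2" by simp
  have Qsub: "Q \<subseteq> {x. nrm x \<le> B}"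
  proof
    fix x assume "x \<in> Q"
    then have "real ((nrm x)\<^sup>2 * box_size\<^sup>2) \<le> real (400 * k)" unfolding Q_def using of_nat_le_iff by blast
    then have "(real (nrm x))\<^sup>2 \<le> 400 * real k / (real box_size)\<^sup>2" using b0 by (simp add: field_simps)
    then have "real (nrm x) \<le> sqrt (400 * real k / (real box_size)\<^sup>2)" by (rule real_le_rsqrt)
    then show "x \<in> {x. nrm x \<le> B}" unfolding B_def by (simp add: le_nat_floor)
  qed
  have finQ: "finite Q" using Qsub finite_nrm_le by (rule finite_subset)
  have cQ: "real (card Q) \<le> 12000000 * y + 2"
  proof -
    have "card Q \<le> (B + 1)\<^sup>2" using card_mono[OF finite_nrm_le Qsub] card_nrm_le[of B] by linarith
    then have "real (card Q) \<le> (real B + 1)\<^sup>2" by (metis of_nat_1 of_nat_add of_nat_le_iff of_nat_power)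
    also have "\<dots> \<le> 2 * (real B)\<^sup>2 + 2"
    proof -
      have "0 \<le> (real B - 1)\<^sup>2" by simp
      then show ?thesis by (simp add: power2_eq_square algebra_simps)
    qed
    also have "(real B)\<^sup>2 \<le> 400 * real k / (real box_size)\<^sup>2"
    proof -
      have "real B \<le> sqrt (400 * real k / (real box_size)\<^sup>2)" unfolding B_def using nn by simp
      then have "(real B)\<^sup>2 \<le> (sqrt (400 * real k / (real box_size)\<^sup>2))\<^sup>2" by (rule power_mono) simp
      then show ?thesis using nn by simp
    qed
    also have "400 * real k / (real box_size)\<^sup>2 \<le> 6000000 * y"
    proof -
      have "real N \<le> real (15000 * box_size\<^sup>2)" using N_le_box[OF R] of_nat_le_iff by blast
      then have "400 * real k * real N \<le> 400 * real k * (15000 * (real box_size)\<^sup>2)" by (intro mult_left_mono) auto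
      then show ?thesis unfolding y_def using N0 b0 by (simp add: field_simps)
    qed
    finally show ?thesis by simp
  qed
  have finIB: "finite IB" and cIB: "card IB \<le> (card Q)\<^sup>2"
  proof -
    have q: "finite (loc -` Q)" "card (loc -` Q) \<le> card Q"
      using finite_vimageI[OF finQ loc_inj] card_vimage_inj_on_le[of loc UNIV Q] loc_inj finQ by auto
    then show "finite IB" "card IB \<le> (card Q)\<^sup>2"
      unfolding IB_def by (simp_all add: card_cartesian_product power2_eq_square mult_le_mono)
  qed
  have "{e\<in>K_edges n. card (crossing_edges n p e) \<le> k} \<subseteq> f ` ({..<6} \<times> IA) \<union> g ` ({..<6} \<times> IB)"
  proof
    fix e assume "e \<in> {e\<in>K_edges n. card (crossing_edges n p e) \<le> k}"
    then have e: "e \<in> K_edges n" "card (crossing_edges n p e) \<le> k" by auto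
    let ?same = "\<lambda>a i i'. e = {6 * i + a, 6 * i' + a} \<and> i \<noteq> i' \<and> 6 * i + a < n \<and> 6 * i' + a < n \<and> nrm (loc i') \<le> nrm (loc i)"
    let ?side = "\<lambda>a i i'. e = {6 * i + a, 6 * i' + (a + 1) mod 6} \<and> 6 * i + a < n \<and> 6 * i' + (a + 1) mod 6 < n"
    from low_edge_cases[OF e R k] obtain a i i' where a: "a < 6" and or: "?same a i i' \<or> ?side a i i'" by blast
    from or show "e \<in> f ` ({..<6} \<times> IA) \<union> g ` ({..<6} \<times> IB)"
    proof
      assume A: "?same a i i'"
      then have "nrm (loc i) + nrm (loc i') < 80 \<or> real (nrm (loc i) + nrm (loc i')) * dist1 (loc i) (loc i') \<le> 640 * y"
        unfolding y_def using same_arm_low[OF a, of i i' k] N0 e(2) by auto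
      moreover have "real (nrm (loc i)) * dist1 (loc i) (loc i') \<le> real (nrm (loc i) + nrm (loc i')) * dist1 (loc i) (loc i')"
        by (intro mult_right_mono) (auto simp: dist1_def)
      moreover have "loc i \<noteq> loc i'" using A loc_inj by (auto dest: injD)
      moreover have "nrm (loc i) \<le> R" using A index_le by (intro nrm_le_R) auto
      ultimately have "(loc i, loc i') \<in> PA" using A unfolding PA_def near_pairs_def by auto
      then have "(i, i') \<in> IA" by (simp add: IA_def)
      then have "e \<in> f ` ({..<6} \<times> IA)" using A a by (intro image_eqI[of _ _ "(a, i, i')"]) (auto simp: f_def)
      then show ?thesis by blast
    next
      assume A: "?side a i i'"
      then have "(nrm (loc i))\<^sup>2 * box_size\<^sup>2 \<le> 400 * k \<and> (nrm (loc i'))\<^sup>2 * box_size\<^sup>2 \<le> 400 * k"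
        using side_edge_low[OF R a refl, of i i' k] k e(2) by blast
      then have "(i, i') \<in> IB" by (simp add: IB_def Q_def)
      then have "e \<in> g ` ({..<6} \<times> IB)" using A a by (intro image_eqI[of _ _ "(a, i, i')"]) (auto simp: g_def)
      then show ?thesis by blast
    qed
  qed
  then have "S k (K_edges n) p \<le> card (f ` ({..<6} \<times> IA) \<union> g ` ({..<6} \<times> IB))"
    unfolding S_eq using finIA finIB by (intro card_mono) auto
  also have "\<dots> \<le> card (f ` ({..<6} \<times> IA)) + card (g ` ({..<6} \<times> IB))" by (rule card_Un_le)
  also have "\<dots> \<le> card ({..<6::nat} \<times> IA) + card ({..<6::nat} \<times> IB)"
    using finIA finIB by (intro add_mono card_image_le) auto
  also have "\<dots> = 6 * card IA + 6 * card IB" by (simp add: card_cartesian_product)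
  also have "\<dots> \<le> 6 * card PA + 6 * (card Q)\<^sup>2" using cIA cIB by simp
  finally have "real (S k (K_edges n) p) \<le> 6 * real (card PA) + 6 * (real (card Q))\<^sup>2"
    using of_nat_mono[of "S k (K_edges n) p" "6 * card PA + 6 * (card Q)\<^sup>2"] by simp
  also have "\<dots> \<le> 6 * (40960000 + real (card (near_pairs (640 * y) R))) + 6 * (12000000 * y + 2)\<^sup>2"
    using cQ by (intro add_mono mult_left_mono cPA power_mono) auto
  finally show ?thesis .
qed

end

section \<open>The three regimes\<close>

abbreviation min_S_K :: "nat \<Rightarrow> nat \<Rightarrow> nat" where
  "min_S_K n k \<equiv> min_S k (K_verts n) (K_edges n)"

lemma min_S_attained: "\<exists>p. drawing n p \<and> min_S_K n k = S k (K_edges n) p"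
proof -
  let ?A = "{S k (K_edges n) p | p. rectilinear_drawing (K_verts n) (K_edges n) p}"
  obtain q where "drawing n q" using generic_drawing[of 1 n "\<lambda>_. 0"] by auto
  then have "S k (K_edges n) q \<in> ?A" by (auto simp: drawing_def)
  then have "?A \<noteq> {}" by blast
  then have "Inf ?A \<in> ?A" by (rule Inf_nat_def1)
  then show ?thesis unfolding min_S_def by (auto simp: drawing_def)
qed

lemma min_S_le: "drawing n p \<Longrightarrow> min_S_K n k \<le> S k (K_edges n) p"
  unfolding min_S_def by (rule wellorder_Inf_le1) (auto simp: drawing_def)

lemma min_S_le_square: "real (min_S_K n k) \<le> (real n)\<^sup>2"
proof -
  obtain p where p: "min_S_K n k = S k (K_edges n) p" using min_S_attained by blast
  have "S k (K_edges n) p \<le> card (K_edges n)"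
    unfolding S_def using finite_K_edges by (intro card_mono) auto
  also have "card (K_edges n) = n choose 2"
    unfolding K_edges_def K_verts_def using n_subsets[of "{..<n}" 2] by simp
  also have "\<dots> \<le> n * n" unfolding choose_two by (rule order.trans[OF div_le_dividend]) simp
  finally have "real (S k (K_edges n) p) \<le> real (n * n)" by (rule of_nat_mono)
  then show ?thesis unfolding p by (simp add: power2_eq_square)
qed

text \<open>The assumptions ensure \<open>R \<ge> 1000\<close> and
  \<open>k < N * box_size\<^sup>2\<close>, so that the boxes are large enough and meeting all edges
  from one box to an arm exceeds \<open>k\<close>.\<close>

lemma min_S_upper_generic:
  assumes N: "1000000 < n div 6" and k: "15000 * k < (n div 6) * (n div 6)"
  obtains R where "R\<^sup>2 \<le> 100 * (n div 6)"
    "real (min_S_K n k) \<le>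
       6 * (40960000 + real (card (near_pairs (640 * (real k / real (n div 6))) R)))
       + 6 * (12000000 * (real k / real (n div 6)) + 2)\<^sup>2"
proof -
  obtain loc :: "nat \<Rightarrow> nat \<times> nat" where loc: "range loc = Lam" "inj loc" "\<And>i j. nrm (loc i) < nrm (loc j) \<Longrightarrow> i < j"
    using lattice_enumeration by blast
  obtain p where p: "drawing n p" "\<forall>s<n. \<forall>t<n. \<forall>h<n. \<forall>y<n. forced_crossing loc s t h y \<longrightarrow>
     open_segment (p s) (p t) \<inter> open_segment (p h) (p y) \<noteq> {}"
    using hex_drawing by blast
  interpret drawing n p by (rule p(1))
  interpret hex_crossings n p loc
    by unfold_locales (rule loc p(2)[rule_format]; assumption?)+
  have "1000 * 1000 < (R + 1) * (R + 1)" using N N_le_R unfolding N_def power2_eq_square by linarith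
  then have "1000 < R + 1" by (meson mult_le_mono not_less)
  then have R: "1000 \<le> R" by simp
  have "15000 * k < N * (15000 * box_size\<^sup>2)"
    using k N_le_box[OF R] unfolding N_def by (meson less_le_trans mult_le_mono2)
  then have kb: "k < N * box_size\<^sup>2" by simp
  have N0: "0 < N" using N by (simp add: N_def)
  have "real (min_S_K n k) \<le> real (S k (K_edges n) p)"
    using min_S_le[OF p(1)] by simp
  also note S_le_counts[OF R kb N0]
  finally show ?thesis using that[OF R_sq_le[unfolded N_def]] unfolding N_def by blast
qed

text \<open>One expression for all regimes: the minimum switches where \<open>x\<^sup>2 = n\<close>,
  which is \<open>k = n powr (3 / 2)\<close>.\<close>

definition rate :: "real \<Rightarrow> real \<Rightarrow> real" where
  "rate n x = x\<^sup>2 * max 1 (ln (min x (n / x)))"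

text \<open>Outside the range of the hexagonal bound the trivial bound \<open>n\<^sup>2\<close>
  suffices: either \<open>n\<close> is bounded, or \<open>k\<close> has order
  \<open>n\<^sup>2\<close> and \<open>n \<le> 735000 * x\<close> with 735000 = 49 * 15000. The size
  of the constant is due to the edges between adjacent arms.\<close>

lemma min_S_upper:
  assumes n: "3 \<le> n" and x: "x = real k / real n"
  shows "real (min_S_K n k) \<le> 10 ^ 18 * (1 + rate n x)"
proof -
  define N where "N = n div 6"
  define M where "M = max 1 (ln (min x (real n / x)))"
  have M1: "1 \<le> M" by (simp add: M_def)
  have xM: "x\<^sup>2 \<le> x\<^sup>2 * M" using M1 by (simp add: mult_le_cancel_left1)
  have rate: "rate n x = x\<^sup>2 * M" by (simp add: rate_def M_def)
  have n6: "real n \<le> 6 * real N + 6" "6 * real N \<le> real n" unfolding N_def by linarith+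
  consider "N \<le> 1000000" | "1000000 < N" "N * N \<le> 15000 * k" | "1000000 < N" "15000 * k < N * N" by linarith
  then show ?thesis
  proof cases
    case 1
    then have "real n \<le> 10 ^ 7" using n6 by simp
    then have "(real n)\<^sup>2 \<le> (10 ^ 7)\<^sup>2" by (intro power_mono) auto
    also have "\<dots> \<le> (10::real) ^ 18 * 1" by simp
    also have "\<dots> \<le> 10 ^ 18 * (1 + rate n x)" using xM rate zero_le_power2[of x] by (intro mult_left_mono) (linarith | simp)+
    finally show ?thesis using min_S_le_square[of k n] by linarith
  next
    case 2
    have "real (N * N) \<le> real (15000 * k)" using 2(2) by (rule of_nat_mono)
    then have "real N * real N \<le> 15000 * real k" by simp
    moreover have "real n * real n \<le> (7 * real N) * (7 * real N)" using n6 2 by (intro mult_mono) auto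
    ultimately have "real n * real n \<le> 735000 * real k" by simp
    then have "real n \<le> 735000 * x" using n unfolding x by (simp add: field_simps)
    then have "(real n)\<^sup>2 \<le> (735000 * x)\<^sup>2" by (intro power_mono) auto
    also have "\<dots> = 735000\<^sup>2 * x\<^sup>2" by (simp add: power_mult_distrib)
    also have "\<dots> \<le> 10 ^ 18 * (x\<^sup>2 * M)" using xM by (intro mult_mono) auto
    also have "\<dots> \<le> 10 ^ 18 * (1 + rate n x)" unfolding rate by simp
    finally show ?thesis using min_S_le_square[of k n] by linarith
  next
    case 3
    define y where "y = real k / real N"
    define Y where "Y = 640 * y"
    obtain R where R: "R\<^sup>2 \<le> 100 * N" and up: "real (min_S_K n k) \<le>
       6 * (40960000 + real (card (near_pairs Y R))) + 6 * (12000000 * y + 2)\<^sup>2"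
      using min_S_upper_generic[of n k] 3 unfolding N_def Y_def y_def by blast
    have N0: "0 < real N" using 3 by simp
    have y0: "0 \<le> y" by (simp add: y_def)
    have yx: "y \<le> 7 * x"
    proof -
      have "real k * real n \<le> real k * (7 * real N)" using n6 3 by (intro mult_left_mono) auto
      then show ?thesis unfolding y_def x using N0 n by (simp add: field_simps)
    qed
    then have Yx: "Y \<le> 4480 * x" by (simp add: Y_def)
    have Y0: "0 \<le> Y" using y0 by (simp add: Y_def)
    define L where "L = max 0 (ln (min Y ((real R)\<^sup>2 / Y)))"
    have np: "real (card (near_pairs Y R)) \<le> 26 * Y\<^sup>2 + 9 * Y\<^sup>2 * L"
      unfolding L_def by (rule near_pairs_card[OF Y0])
    have L: "L \<le> 14 * M"
    proof (cases "0 < min Y ((real R)\<^sup>2 / Y)")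
      \<comment> \<open>This is a case of zero: with \<open>Y = 0\<close> the quotient is 0 by
        convention, and \<open>ln 0 = 0\<close>.\<close>
      case False
      then have "ln (min Y ((real R)\<^sup>2 / Y)) \<le> 0 \<or> min Y ((real R)\<^sup>2 / Y) = 0"
        using Y0 by (smt (verit) divide_nonneg_nonneg zero_le_power2)
      then have "L = 0" unfolding L_def by auto
      then show ?thesis using M1 by simp
    next
      case True
      then have Yp: "0 < Y" by simp
      then have kp: "0 < real k" unfolding Y_def y_def using N0 by (simp add: zero_less_divide_iff)
      have xp: "0 < x" unfolding x using kp n by simp
      define X where "X = min x (real n / x)"
      have Xp: "0 < X" using xp n by (simp add: X_def)
      have "real (R\<^sup>2) \<le> real (100 * N)" using R by (rule of_nat_mono)
      then have "(real R)\<^sup>2 / Y \<le> 100 * real N / Y" using Yp by (intro divide_right_mono) auto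
      also have "\<dots> = 100 * real N * real N / (640 * real k)" unfolding Y_def y_def by simp
      also have "\<dots> \<le> real n * real n / real k"
      proof -
        have "100 * real N * real N / (640 * real k) \<le> real N * real N / real k"
          using kp by (simp add: field_simps)
        also have "\<dots> \<le> real n * real n / real k"
          using n6 by (intro divide_right_mono mult_mono) auto
        finally show ?thesis .
      qed
      also have "\<dots> = real n / x" unfolding x using n kp by simp
      also have "\<dots> \<le> 4480 * (real n / x)" using xp mult_right_mono[of 1 4480 "real n / x"] by simp
      finally have "min Y ((real R)\<^sup>2 / Y) \<le> 4480 * X"
        using Yx xp unfolding X_def by (simp add: min_mult_distrib_left min.coboundedI1 min.coboundedI2)
      then have "ln (min Y ((real R)\<^sup>2 / Y)) \<le> ln (4480 * X)" using True Xp by (intro ln_mono) auto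
      also have "\<dots> = ln 4480 + ln X" using Xp by (intro ln_mult_pos) auto
      also have "ln 4480 \<le> (13::real)"
      proof -
        have "ln 4480 \<le> ln (2 ^ 13 :: real)" by (intro ln_mono) auto
        also have "\<dots> = 13 * ln 2" using ln_realpow[of 2 13] by simp
        also have "\<dots> \<le> 13" using ln_2_less_1 by simp
        finally show ?thesis .
      qed
      finally have "ln (min Y ((real R)\<^sup>2 / Y)) \<le> 13 + M" unfolding M_def X_def by simp
      then show ?thesis unfolding L_def using M1 by simp
    qed
    have Y2: "Y\<^sup>2 \<le> 20070400 * x\<^sup>2"
    proof -
      have "Y\<^sup>2 \<le> (4480 * x)\<^sup>2" using Yx Y0 by (rule power_mono)
      then show ?thesis by (simp add: power_mult_distrib)
    qed
    have Y2M: "Y\<^sup>2 \<le> 20070400 * (x\<^sup>2 * M)" using Y2 xM by linarith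
    have "Y\<^sup>2 * L \<le> (20070400 * x\<^sup>2) * (14 * M)"
      using Y2 L by (intro mult_mono) (auto simp: L_def)
    then have YL: "Y\<^sup>2 * L \<le> 280985600 * (x\<^sup>2 * M)" by simp
    have "(12000000 * y + 2)\<^sup>2 \<le> 2 * (12000000 * y)\<^sup>2 + 8"
    proof -
      have "0 \<le> (12000000 * y - 2)\<^sup>2" by simp
      then show ?thesis by (simp add: power2_eq_square algebra_simps)
    qed
    also have "(12000000 * y)\<^sup>2 \<le> (84000000 * x)\<^sup>2" using yx y0 by (intro power_mono) auto
    finally have q: "(12000000 * y + 2)\<^sup>2 \<le> 14112000000000000 * (x\<^sup>2 * M) + 8"
      using xM by (simp add: power_mult_distrib)
    have "real (card (near_pairs Y R)) \<le> 3050700800 * (x\<^sup>2 * M)"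
      using np Y2M YL by (simp add: mult.assoc)
    then show ?thesis using up q M1 zero_le_power2[of x] xM unfolding rate by simp
  qed
qed

lemma min_S_lower:
  assumes "3 \<le> n" "n \<le> k" "k \<le> n choose 2" and x: "x = real k / real n"
  shows "rate n x / 2048 \<le> real (min_S_K n k)"
proof -
  obtain p where p: "drawing n p" "min_S_K n k = S k (K_edges n) p"
    using min_S_attained by blast
  show ?thesis using drawing.S_lower[OF p(1) assms] unfolding p(2) rate_def by simp
qed

lemma min_S_pos:
  assumes "3 \<le> n"
  shows "1 \<le> real (min_S_K n k)"
proof -
  obtain p where p: "drawing n p" "min_S_K n k = S k (K_edges n) p"
    using min_S_attained by blast
  show ?thesis using drawing.S_pos[OF p(1), of k] assms unfolding p(2) by simp
qed

lemma powr_three_halves: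
  assumes "0 < n"
  shows "real k \<le> real n powr (3 / 2) \<longleftrightarrow> (real k / real n)\<^sup>2 \<le> real n"
proof -
  have "real n powr (3 / 2) = real n powr (1 + 1 / 2)" by simp
  also have "\<dots> = real n * sqrt (real n)" using assms by (simp only: powr_add) (simp add: powr_half_sqrt)
  finally have "real k \<le> real n powr (3 / 2) \<longleftrightarrow> real k / real n \<le> sqrt (real n)"
    using assms by (simp add: field_simps)
  also have "\<dots> \<longleftrightarrow> (real k / real n)\<^sup>2 \<le> real n"
    using assms by (metis divide_nonneg_nonneg of_nat_0_le_iff real_le_rsqrt real_sqrt_le_iff real_sqrt_unique)
  finally show ?thesis .
qed

lemma Theta_onI:
  assumes "\<And>n k. (n, k) \<in> R \<Longrightarrow> c * g n k \<le> f n k \<and> f n k \<le> C * g n k" "0 < c" "0 < C"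
  shows "Theta_on R f g"
  unfolding Theta_on_def using assms by blast

theorem theorem6p1:
  shows "Theta_on {(n, k). 3 \<le> n \<and> k \<le> n choose 2 \<and> k \<le> n}
           (\<lambda>n k. real (min_S k (K_verts n) (K_edges n)))
           (\<lambda>n k. 1)
       \<and> Theta_on {(n, k). 3 \<le> n \<and> k \<le> n choose 2 \<and> n < k \<and> real k \<le> real n powr (3/2)}
           (\<lambda>n k. real (min_S k (K_verts n) (K_edges n)))
           (\<lambda>n k. (real k / real n)\<^sup>2 * log1 (real k / real n))
       \<and> Theta_on {(n, k). 3 \<le> n \<and> k \<le> n choose 2 \<and> real n powr (3/2) < real k}
           (\<lambda>n k. real (min_S k (K_verts n) (K_edges n)))
           (\<lambda>n k. (real k / real n)\<^sup>2 * ln ((real n)\<^sup>2 / real k))"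
proof (intro conjI)
  let ?m = "\<lambda>n k. real (min_S k (K_verts n) (K_edges n))"
  show "Theta_on {(n, k). 3 \<le> n \<and> k \<le> n choose 2 \<and> k \<le> n} ?m (\<lambda>n k. 1)" (is "Theta_on ?R _ ?g")
  proof (rule Theta_onI)
    fix n k assume "(n, k) \<in> ?R"
    then have z: "3 \<le> n" "k \<le> n" by auto
    define x where "x = real k / real n"
    have x: "0 \<le> x" "x \<le> 1" using z by (auto simp: x_def)
    \<comment> \<open>For \<open>k = 0\<close> the conventions \<open>n / 0 = 0\<close> and
      \<open>ln 0 = 0\<close> apply.\<close>
    have "ln (min x (real n / x)) \<le> 0"
    proof (cases "x = 0")
      case False
      then show ?thesis using x z by simp
    qed simp
    then have "rate n x = x\<^sup>2" by (simp add: rate_def)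
    also have "\<dots> \<le> 1" using x by (simp add: power_le_one)
    finally have "10 ^ 18 * (1 + rate n x) \<le> 10 ^ 18 * (1 + 1)" by (intro mult_left_mono) auto
    then have "?m n k \<le> 10 ^ 18 * (1 + 1)"
      using min_S_upper[OF z(1) x_def] by (rule order.trans[rotated])
    then show "1 * ?g n k \<le> ?m n k \<and> ?m n k \<le> (2 * 10 ^ 18) * ?g n k"
      using min_S_pos[OF z(1)] by simp
  qed simp_all
  show "Theta_on {(n, k). 3 \<le> n \<and> k \<le> n choose 2 \<and> n < k \<and> real k \<le> real n powr (3/2)} ?m
      (\<lambda>n k. (real k / real n)\<^sup>2 * log1 (real k / real n))" (is "Theta_on ?R _ ?g")
  proof (rule Theta_onI)
    fix n k assume "(n, k) \<in> ?R"
    then have z: "3 \<le> n" "k \<le> n choose 2" "n < k" "real k \<le> real n powr (3/2)" by auto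
    define x where "x = real k / real n"
    have x: "1 < x" "x\<^sup>2 \<le> real n" using z powr_three_halves[of n k] by (auto simp: x_def)
    then have "x \<le> real n / x" by (simp add: power2_eq_square field_simps)
    then have rate: "rate n x = x\<^sup>2 * log1 x" by (simp add: rate_def log1_def)
    have "1 * 1 \<le> x\<^sup>2 * log1 x" using x by (intro mult_mono) (auto simp: log1_def one_le_power)
    then have "?m n k \<le> (2 * 10 ^ 18) * (x\<^sup>2 * log1 x)"
      using min_S_upper[OF z(1) x_def] unfolding rate by simp
    moreover have "1 / 2048 * (x\<^sup>2 * log1 x) \<le> ?m n k"
      using min_S_lower[OF z(1) less_imp_le[OF z(3)] z(2) x_def] unfolding rate by simp
    ultimately show "1 / 2048 * ?g n k \<le> ?m n k \<and> ?m n k \<le> (2 * 10 ^ 18) * ?g n k"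
      unfolding x_def by simp
  qed simp_all
  show "Theta_on {(n, k). 3 \<le> n \<and> k \<le> n choose 2 \<and> real n powr (3/2) < real k} ?m
      (\<lambda>n k. (real k / real n)\<^sup>2 * ln ((real n)\<^sup>2 / real k))" (is "Theta_on ?R _ ?g")
  proof (rule Theta_onI)
    fix n k assume "(n, k) \<in> ?R"
    then have z: "3 \<le> n" "k \<le> n choose 2" "\<not> real k \<le> real n powr (3/2)" by auto
    define x where "x = real k / real n"
    have x2: "real n < x\<^sup>2" using z powr_three_halves[of n k] by (auto simp: x_def)
    have x1: "1 < x"
    proof (rule ccontr)
      assume "\<not> 1 < x"
      moreover have "0 \<le> x" by (simp add: x_def)
      ultimately have "x\<^sup>2 \<le> 1" by (simp add: power_le_one)
      then show False using x2 z(1) by simp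
    qed
    have nk: "n < k" using x1 z(1) by (simp add: x_def)
    have eq: "real n / x = (real n)\<^sup>2 / real k" by (simp add: x_def power2_eq_square)
    have "real n / x \<le> x" using x1 x2 by (simp add: power2_eq_square field_simps)
    then have mn: "min x (real n / x) = (real n)\<^sup>2 / real k" using eq by simp
    \<comment> \<open>The bound on \<open>k\<close> keeps \<open>n\<^sup>2 / k\<close> at least 2.
      Its logarithm is then at least 2/3, so taking the maximum with 1 changes it by a factor of at
      most 3/2.\<close>
    have "2 * k \<le> n * n"
    proof -
      have "2 * (n choose 2) \<le> n * (n - 1)" unfolding choose_two by simp
      also have "\<dots> \<le> n * n" by simp
      finally show ?thesis using z(2) by linarith
    qed
    then have "real (2 * k) \<le> real (n * n)" by (rule of_nat_mono)
    then have "2 \<le> (real n)\<^sup>2 / real k" using nk by (simp add: power2_eq_square field_simps)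
    then have "ln 2 \<le> ln ((real n)\<^sup>2 / real k)" by (intro ln_mono) auto
    then have ln: "2 / 3 \<le> ln ((real n)\<^sup>2 / real k)" using ln2_ge_two_thirds by linarith
    define l where "l = ln ((real n)\<^sup>2 / real k)"
    have rate: "rate n x = x\<^sup>2 * max 1 l" by (simp add: rate_def mn l_def)
    have M: "max 1 l \<le> 3 / 2 * l" using ln by (simp add: l_def)
    have x21: "1 \<le> x\<^sup>2" using x1 by (simp add: one_le_power)
    have up: "x\<^sup>2 * max 1 l \<le> x\<^sup>2 * (3 / 2 * l)" using M by (intro mult_left_mono) auto
    have "1 * 1 \<le> x\<^sup>2 * max 1 l" using x21 by (intro mult_mono) auto
    then have "1 + rate n x \<le> 2 * (x\<^sup>2 * (3 / 2 * l))" using up unfolding rate by linarith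
    then have "10 ^ 18 * (1 + rate n x) \<le> 10 ^ 18 * (2 * (x\<^sup>2 * (3 / 2 * l)))" by (intro mult_left_mono) auto
    then have upper: "?m n k \<le> (3 * 10 ^ 18) * (x\<^sup>2 * l)"
      using min_S_upper[OF z(1) x_def] by (simp add: mult.commute)
    have "x\<^sup>2 * l \<le> x\<^sup>2 * max 1 l" by (intro mult_left_mono) auto
    then have "1 / 2048 * (x\<^sup>2 * l) \<le> ?m n k"
      using min_S_lower[OF z(1) less_imp_le[OF nk] z(2) x_def] unfolding rate by simp
    then show "1 / 2048 * ?g n k \<le> ?m n k \<and> ?m n k \<le> (3 * 10 ^ 18) * ?g n k"
      using upper unfolding x_def l_def by simp
  qed simp_all
qed

end
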